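(* Let $x_1,x_2\in\mathbb{R}^d$, $r_1,r_2>0$, and set $B_1=B_C(x_1;r_1)$, $B_2=B_C(x_2;r_2)$ and $\tilde d_C(B_1;B_2)=(d_C(x_1;x_2)-r_1-r_2)\vee 0\in[0,\infty]$. If $\varphi_1\in L_2(B_1)$ and $\varphi_2\in L_2(B_2)$ then \[ (\varphi_1,\cos(tH_0^{1/2})\varphi_2)=0 \] for all real $t\geq0$ with $t\le\tilde d_C(B_1;B_2)$, where $H_0$ is the viscosity operator with coefficients $C$.
   Context: Let $C=(c_{ij})$ be a $d\times d$ matrix of real-valued $L_\infty(\mathbb{R}^d)$ functions, symmetric and positive semidefinite almost everywhere. Let $L_{2;1}(\mathbb{R}^d)=W^{1,2}(\mathbb{R}^d)$ and define $h(\varphi)=\sum_{i,j=1}^d(\partial_i\varphi,c_{ij}\partial_j\varphi)$, $l(\varphi)=\sum_{i=1}^d\|\partial_i\varphi\|_2^2$, both with domain $L_{2;1}(\mathbb{R}^d)$. For $\varepsilon\in(0,1]$ the form $h_\varepsilon=h+\varepsilon l$ is closed; let $H_\varepsilon$ be the associated positive self-adjoint operator on $L_2(\mathbb{R}^d)$. As $\varepsilon\downarrow0$, $H_\varepsilon$ converges in the strong resolvent sense to a positive self-adjoint operator $H_0$, the viscosity operator with coefficients $C$. The pseudodistance $d_C:\mathbb{R}^d\times\mathbb{R}^d\to[0,\infty]$ is $d_C(x;y)=\sup\{|\psi(x)-\psi(y)|:\psi\in\mathcal D\}$, where $\mathcal D$ is the set of real $\psi\in C_c^\infty(\mathbb{R}^d)$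 with $\|\sum_{i,j=1}^d c_{ij}(\partial_i\psi)(\partial_j\psi)\|_\infty\le1$. Balls: $B_C(x;r)=\{y\in\mathbb{R}^d:d_C(x;y)<r\}$. Here $a\vee b$ denotes the maximum of $a$ and $b$. For measurable $V\subseteq\mathbb{R}^d$, $L_2(V)$ denotes the functions in $L_2(\mathbb{R}^d)$ vanishing a.e. outside $V$. The operator $\cos(tH_0^{1/2})$ is defined by spectral theory.
   Formalization: If d_C(x1;x2) < r1+r2 (so only t=0 is allowed), it is additionally assumed that B1∩B2 is a null set; otherwise the claim fails at t=0, e.g. C=I, x1=x2, r1=r2, φ1=φ2 the indicator function of the ball. *)

theory Defs
  imports "HOL-Analysis.Analysis"
begin

section \<open>The complex Hilbert space \<open>L\<^sub>2\<close>\<close>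

definition square_integrable :: "('a::euclidean_space \<Rightarrow> complex) \<Rightarrow> bool" where
  "square_integrable f \<longleftrightarrow>
     f \<in> borel_measurable lebesgue \<and> integrable lebesgue (\<lambda>x. (cmod (f x))\<^sup>2)"

lemma square_integrable_zero: "square_integrable (\<lambda>_. 0)"
  by (simp add: square_integrable_def)

lemma square_integrable_scale:
  assumes "square_integrable f"
  shows "square_integrable (\<lambda>x. c * f x)"
  using assms by (auto simp: square_integrable_def norm_mult power_mult_distrib)

lemma square_integrable_add:
  assumes "square_integrable f" "square_integrable g"
  shows "square_integrable (\<lambda>x. f x + g x)"
proof -
  have m: "f \<in> borel_measurable lebesgue" "g \<in> borel_measurable lebesgue"
    and i: "integrable lebesgue (\<lambda>x. (cmod (f x))\<^sup>2)" "integrable lebesgue (\<lambda>x. (cmod (g x))\<^sup>2)"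
    using assms by (auto simp: square_integrable_def)
  have "integrable lebesgue (\<lambda>x. (cmod (f x + g x))\<^sup>2)"
  proof (rule Bochner_Integration.integrable_bound)
    show "integrable lebesgue (\<lambda>x. 2 * (cmod (f x))\<^sup>2 + 2 * (cmod (g x))\<^sup>2)"
      using i by auto
    show "(\<lambda>x. (cmod (f x + g x))\<^sup>2) \<in> borel_measurable lebesgue"
      using m by measurable
    have "(cmod (a + b))\<^sup>2 \<le> 2 * (cmod a)\<^sup>2 + 2 * (cmod b)\<^sup>2" for a b :: complex
    proof -
      have "(cmod (a + b))\<^sup>2 \<le> (cmod a + cmod b)\<^sup>2"
        by (intro power_mono norm_triangle_ineq norm_ge_zero)
      also have "\<dots> \<le> 2 * (cmod a)\<^sup>2 + 2 * (cmod b)\<^sup>2"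
        using sum_squares_bound[of "cmod a" "cmod b"] by (simp add: power2_sum)
      finally show ?thesis .
    qed
    then show "AE x in lebesgue. norm ((cmod (f x + g x))\<^sup>2)
        \<le> norm (2 * (cmod (f x))\<^sup>2 + 2 * (cmod (g x))\<^sup>2)"
      by (intro AE_I2) (simp add: abs_of_nonneg)
  qed
  then show ?thesis using m by (simp add: square_integrable_def)
qed

lemma measurable_cnj_lebesgue:
  assumes "f \<in> borel_measurable lebesgue"
  shows "(\<lambda>x. cnj (f x)) \<in> borel_measurable lebesgue"
  by (rule borel_measurable_continuous_on[OF _ assms]) (intro continuous_intros)

lemma integrable_cnj_mult:
  assumes "square_integrable f" "square_integrable g"
  shows "integrable lebesgue (\<lambda>x. cnj (f x) * g x)"
proof (rule Bochner_Integration.integrable_bound)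
  show "integrable lebesgue (\<lambda>x. (cmod (f x))\<^sup>2 + (cmod (g x))\<^sup>2)"
    using assms by (auto simp: square_integrable_def)
  show "(\<lambda>x. cnj (f x) * g x) \<in> borel_measurable lebesgue"
    using assms by (intro borel_measurable_times measurable_cnj_lebesgue)
      (auto simp: square_integrable_def)
  have "cmod a * cmod b \<le> (cmod a)\<^sup>2 + (cmod b)\<^sup>2" for a b
  proof -
    have "0 \<le> cmod a * cmod b" by simp
    then show ?thesis using sum_squares_bound[of "cmod a" "cmod b"] by linarith
  qed
  then show "AE x in lebesgue. norm (cnj (f x) * g x) \<le> norm ((cmod (f x))\<^sup>2 + (cmod (g x))\<^sup>2)"
    by (intro AE_I2) (simp add: norm_mult abs_of_nonneg)
qed

definition L2_rel :: "('a::euclidean_space \<Rightarrow> complex) \<Rightarrow> ('a \<Rightarrow> complex) \<Rightarrow> bool" where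
  "L2_rel f g \<longleftrightarrow> square_integrable f \<and> square_integrable g \<and> (AE x in lebesgue. f x = g x)"

quotient_type (overloaded) 'a L2 = "'a::euclidean_space \<Rightarrow> complex" / partial: L2_rel
proof (rule part_equivpI)
  show "\<exists>f. L2_rel f f"
    by (rule exI[of _ "\<lambda>_. 0"]) (simp add: L2_rel_def square_integrable_zero)
  show "symp L2_rel"
    by (auto simp: symp_def L2_rel_def)
  show "transp L2_rel"
    unfolding transp_def L2_rel_def by auto
qed

lift_definition cinner :: "'a::euclidean_space L2 \<Rightarrow> 'a L2 \<Rightarrow> complex"
  is "\<lambda>f g. LINT x|lebesgue. cnj (f x) * g x"
proof -
  fix f f' g g' :: "'a \<Rightarrow> complex"
  assume a: "L2_rel f f'" "L2_rel g g'"
  show "(LINT x|lebesgue. cnj (f x) * g x) = (LINT x|lebesgue. cnj (f' x) * g' x)"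
  proof (rule integral_cong_AE)
    show "AE x in lebesgue. cnj (f x) * g x = cnj (f' x) * g' x"
      using a unfolding L2_rel_def by auto
  qed (use a in \<open>auto simp: L2_rel_def intro!: borel_measurable_integrable integrable_cnj_mult\<close>)
qed

lift_definition scaleC :: "complex \<Rightarrow> 'a::euclidean_space L2 \<Rightarrow> 'a L2"  (infixr \<open>*\<^sub>C\<close> 75)
  is "\<lambda>c f x. c * f x"
  by (auto simp: L2_rel_def intro: square_integrable_scale)

instantiation L2 :: (euclidean_space) real_vector
begin

lift_definition zero_L2 :: "'a L2" is "\<lambda>_. 0"
  by (simp add: L2_rel_def square_integrable_zero)

lift_definition plus_L2 :: "'a L2 \<Rightarrow> 'a L2 \<Rightarrow> 'a L2" is "\<lambda>f g x. f x + g x"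
  by (auto simp: L2_rel_def intro: square_integrable_add)

definition uminus_L2 :: "'a L2 \<Rightarrow> 'a L2" where "- u = (-1) *\<^sub>C u"

definition minus_L2 :: "'a L2 \<Rightarrow> 'a L2 \<Rightarrow> 'a L2" where "u - v = u + - v" for u v :: "'a L2"

definition scaleR_L2 :: "real \<Rightarrow> 'a L2 \<Rightarrow> 'a L2" where "r *\<^sub>R u = complex_of_real r *\<^sub>C u" for u :: "'a L2"

instance
proof
  fix u v w :: "'a L2" and r s :: real
  show "u + v + w = u + (v + w)"
    by transfer (auto simp: L2_rel_def add.assoc intro!: square_integrable_add)
  show "u + v = v + u"
    by transfer (auto simp: L2_rel_def add.commute intro!: square_integrable_add)
  show "0 + u = u"
    by transfer (auto simp: L2_rel_def)
  show "- u + u = 0"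
    unfolding uminus_L2_def
    by transfer (auto simp: L2_rel_def square_integrable_zero)
  show "u - v = u + - v" by (rule minus_L2_def)
  show "r *\<^sub>R (u + v) = r *\<^sub>R u + r *\<^sub>R v"
    unfolding scaleR_L2_def
    by transfer (auto simp: L2_rel_def ring_distribs
        intro!: square_integrable_add square_integrable_scale)
  show "(r + s) *\<^sub>R u = r *\<^sub>R u + s *\<^sub>R u"
    unfolding scaleR_L2_def of_real_add
    by transfer (auto simp: L2_rel_def ring_distribs
        intro!: square_integrable_add square_integrable_scale)
  show "r *\<^sub>R s *\<^sub>R u = (r * s) *\<^sub>R u"
    unfolding scaleR_L2_def of_real_mult
    by transfer (auto simp: L2_rel_def mult.assoc
        intro!: square_integrable_scale)
  show "1 *\<^sub>R u = u"
    unfolding scaleR_L2_def of_real_1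
    by transfer (auto simp: L2_rel_def)
qed

end

lemma cinner_add_right: "cinner u (v + w) = cinner u v + cinner u w"
  by transfer (auto simp: L2_rel_def ring_distribs integrable_cnj_mult
      intro!: Bochner_Integration.integral_add)

lemma cinner_scaleC_right: "cinner u (c *\<^sub>C v) = c * cinner u v"
  by transfer (auto simp: L2_rel_def mult.left_commute)

lemma cinner_cnj: "cinner v u = cnj (cinner u v)"
  by transfer (simp add: mult.commute flip: Bochner_Integration.integral_cnj)

lemma cinner_self: "cinner u u = complex_of_real (Re (cinner u u))"
  using cinner_cnj[of u u] by (simp add: complex_eq_iff)

lemma Re_cinner_self_nonneg: "0 \<le> Re (cinner u u)"
proof transfer
  fix f :: "'a \<Rightarrow> complex" assume "L2_rel f f"
  have "cnj (f x) * f x = complex_of_real ((cmod (f x))\<^sup>2)" for x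
    using complex_norm_square[of "f x"] by (simp add: mult.commute)
  then show "0 \<le> Re (LINT x|lebesgue. cnj (f x) * f x)"
    by (simp only: integral_complex_of_real Re_complex_of_real) simp
qed

lemma Re_cinner_self_eq_0: "Re (cinner u u) = 0 \<longleftrightarrow> u = 0"
proof transfer
  fix f :: "'a \<Rightarrow> complex" assume f: "L2_rel f f"
  have "cnj (f x) * f x = complex_of_real ((cmod (f x))\<^sup>2)" for x
    using complex_norm_square[of "f x"] by (simp add: mult.commute)
  then have "Re (LINT x|lebesgue. cnj (f x) * f x) = (LINT x|lebesgue. (cmod (f x))\<^sup>2)"
    by (simp only: integral_complex_of_real Re_complex_of_real)
  also have "\<dots> = 0 \<longleftrightarrow> (AE x in lebesgue. (cmod (f x))\<^sup>2 = 0)"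
    using f by (intro integral_nonneg_eq_0_iff_AE) (auto simp: L2_rel_def square_integrable_def)
  also have "\<dots> \<longleftrightarrow> L2_rel f (\<lambda>_. 0)"
    using f by (auto simp: L2_rel_def square_integrable_zero)
  finally show "(Re (LINT x|lebesgue. cnj (f x) * f x) = 0) = L2_rel f (\<lambda>_. 0)" .
qed

instantiation L2 :: (euclidean_space) real_inner
begin

definition inner_L2 :: "'a L2 \<Rightarrow> 'a L2 \<Rightarrow> real" where "u \<bullet> v = Re (cinner u v)"
definition norm_L2 :: "'a L2 \<Rightarrow> real" where "norm u = sqrt (Re (cinner u u))"
definition sgn_L2 :: "'a L2 \<Rightarrow> 'a L2" where "sgn u = u /\<^sub>R norm u" for u :: "'a L2"
definition dist_L2 :: "'a L2 \<Rightarrow> 'a L2 \<Rightarrow> real" where "dist u v = norm (u - v)" for u v :: "'a L2"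
definition uniformity_L2 :: "('a L2 \<times> 'a L2) filter" where
  "uniformity = (INF e\<in>{0<..}. principal {(u, v). dist u (v::'a L2) < e})"
definition open_L2 :: "'a L2 set \<Rightarrow> bool" where
  "open U = (\<forall>u\<in>U. \<forall>\<^sub>F (u', v) in uniformity. u' = u \<longrightarrow> v \<in> U)" for U :: "'a L2 set"

instance
proof
  fix u v w :: "'a L2" and r :: real
  show "u \<bullet> v = v \<bullet> u"
    unfolding inner_L2_def by (subst cinner_cnj) simp
  have add: "x \<bullet> (y + z) = x \<bullet> y + x \<bullet> z" for x y z :: "'a L2"
    by (simp add: inner_L2_def cinner_add_right)
  have comm: "x \<bullet> y = y \<bullet> x" for x y :: "'a L2"
    unfolding inner_L2_def by (subst cinner_cnj) simp
  show "(u + v) \<bullet> w = u \<bullet> w + v \<bullet> w"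
    using add comm by metis
  have "v \<bullet> (r *\<^sub>R u) = r * (v \<bullet> u)"
    by (simp add: inner_L2_def scaleR_L2_def cinner_scaleC_right)
  then show "(r *\<^sub>R u) \<bullet> v = r * (u \<bullet> v)"
    using comm by metis
  show "0 \<le> u \<bullet> u" by (simp add: inner_L2_def Re_cinner_self_nonneg)
  show "u \<bullet> u = 0 \<longleftrightarrow> u = 0" by (simp add: inner_L2_def Re_cinner_self_eq_0)
  show "norm u = sqrt (u \<bullet> u)" by (simp add: inner_L2_def norm_L2_def)
qed (simp_all add: sgn_L2_def dist_L2_def uniformity_L2_def open_L2_def)

end

text \<open>
  \<open>L2_fun u\<close> is an arbitrary representative of the class \<open>u\<close>; it is only used in expressions
  that depend on \<open>u\<close> alone.
\<close>

definition L2_fun :: "'a::euclidean_space L2 \<Rightarrow> 'a \<Rightarrow> complex" where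
  "L2_fun u = rep_L2 u"

definition L2_on :: "'a::euclidean_space set \<Rightarrow> 'a L2 set" where
  "L2_on V = {u. AE x in lebesgue. x \<notin> V \<longrightarrow> L2_fun u x = 0}"


section \<open>Unbounded operators\<close>

text \<open>An unbounded operator on \<open>L\<^sub>2\<close> is identified with its graph.\<close>

type_synonym 'a operator = "('a L2 \<times> 'a L2) set"

definition op_apply :: "'a::euclidean_space operator \<Rightarrow> 'a L2 \<Rightarrow> 'a L2" where
  "op_apply G u = (THE f. (u, f) \<in> G)"

definition adjoint_op :: "'a::euclidean_space operator \<Rightarrow> 'a operator" where
  "adjoint_op G = {(v, w). \<forall>(u, f) \<in> G. cinner v f = cinner w u}"

text \<open>
  Linearity of \<open>G\<close> is automatic here, because every adjoint is a linear subspace, and so is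
  single-valuedness, because the domain is dense.
\<close>

definition self_adjoint_op :: "'a::euclidean_space operator \<Rightarrow> bool" where
  "self_adjoint_op G \<longleftrightarrow> closure (Domain G) = UNIV \<and> adjoint_op G = G"

definition positive_op :: "'a::euclidean_space operator \<Rightarrow> bool" where
  "positive_op G \<longleftrightarrow> (\<forall>(u, f) \<in> G. cinner u f \<in> \<real> \<and> 0 \<le> Re (cinner u f))"

text \<open>\<open>resolvent G z = (G - z)\<inverse>\<close>\<close>

definition resolvent :: "'a::euclidean_space operator \<Rightarrow> complex \<Rightarrow> 'a L2 \<Rightarrow> 'a L2" where
  "resolvent G z f = (THE u. (u, f + z *\<^sub>C u) \<in> G)"

definition strong_resolvent_limit ::
    "('b \<Rightarrow> 'a::euclidean_space operator) \<Rightarrow> 'a operator \<Rightarrow> 'b filter \<Rightarrow> bool" where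
  "strong_resolvent_limit H G F \<longleftrightarrow>
     (\<forall>z f. Im z \<noteq> 0 \<longrightarrow> ((\<lambda>e. resolvent (H e) z f) \<longlongrightarrow> resolvent G z f) F)"

text \<open>
  The operator associated with a sesquilinear form \<open>a\<close> with domain \<open>D\<close>, as in the first
  representation theorem.
\<close>

definition form_operator ::
    "'a::euclidean_space L2 set \<Rightarrow> ('a L2 \<Rightarrow> 'a L2 \<Rightarrow> complex) \<Rightarrow> 'a operator" where
  "form_operator D a = {(u, f). u \<in> D \<and> (\<forall>v\<in>D. a v u = cinner v f)}"


section \<open>Functional calculus\<close>

text \<open>A symmetric map defined on all of \<open>L\<^sub>2\<close> is automatically complex linear.\<close>

definition orthogonal_projection :: "('a::euclidean_space L2 \<Rightarrow> 'a L2) \<Rightarrow> bool" where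
  "orthogonal_projection P \<longleftrightarrow>
     (\<forall>u. P (P u) = P u) \<and> (\<forall>u v. cinner (P u) v = cinner u (P v))"

definition projection_valued_measure ::
    "(real set \<Rightarrow> 'a::euclidean_space L2 \<Rightarrow> 'a L2) \<Rightarrow> bool" where
  "projection_valued_measure E \<longleftrightarrow>
     (\<forall>A \<in> sets borel. orthogonal_projection (E A)) \<and>
     (\<forall>u. E {} u = 0) \<and> (\<forall>u. E UNIV u = u) \<and>
     (\<forall>A \<in> sets borel. \<forall>B \<in> sets borel. \<forall>u. E (A \<inter> B) u = E A (E B u)) \<and>
     (\<forall>A :: nat \<Rightarrow> real set. range A \<subseteq> sets borel \<longrightarrow> disjoint_family A \<longrightarrow>
        (\<forall>u. (\<lambda>n. E (A n) u) sums E (\<Union>n. A n) u))"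

definition diagonal_measure ::
    "(real set \<Rightarrow> 'a::euclidean_space L2 \<Rightarrow> 'a L2) \<Rightarrow> 'a L2 \<Rightarrow> real measure" where
  "diagonal_measure E u = measure_of UNIV (sets borel) (\<lambda>A. ennreal (Re (cinner u (E A u))))"

definition spectral_domain ::
    "(real set \<Rightarrow> 'a::euclidean_space L2 \<Rightarrow> 'a L2) \<Rightarrow> (real \<Rightarrow> real) \<Rightarrow> 'a L2 set" where
  "spectral_domain E f = {u. integrable (diagonal_measure E u) (\<lambda>s. (f s)\<^sup>2)}"

text \<open>
  The integral of a Borel function \<open>f\<close> against the complex measure \<open>A \<mapsto> (v, E A u)\<close>, obtained
  from the diagonal measures by polarization.
\<close>

definition polarized_integral ::
    "(real set \<Rightarrow> 'a::euclidean_space L2 \<Rightarrow> 'a L2) \<Rightarrow> (real \<Rightarrow> real) \<Rightarrow> 'a L2 \<Rightarrow> 'a L2 \<Rightarrow> complex"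
  where
  "polarized_integral E f v u =
     (\<Sum>k<4. \<i> ^ k * complex_of_real (LINT s|diagonal_measure E (u + \<i> ^ k *\<^sub>C v). f s)) / 4"

text \<open>The self-adjoint operator \<open>\<integral> f dE\<close> for a real Borel function \<open>f\<close>.\<close>

definition spectral_integral ::
    "(real set \<Rightarrow> 'a::euclidean_space L2 \<Rightarrow> 'a L2) \<Rightarrow> (real \<Rightarrow> real) \<Rightarrow> 'a operator" where
  "spectral_integral E f =
     {(u, w). u \<in> spectral_domain E f \<and>
        (\<forall>v \<in> spectral_domain E f. cinner v w = polarized_integral E f v u)}"

text \<open>
  By the spectral theorem every self-adjoint operator \<open>G\<close> has exactly one such \<open>E\<close> (on Borel
  sets), and \<open>f(G)\<close> is \<open>spectral_integral E f\<close>.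
\<close>

definition spectral_resolution ::
    "'a::euclidean_space operator \<Rightarrow> (real set \<Rightarrow> 'a L2 \<Rightarrow> 'a L2) \<Rightarrow> bool" where
  "spectral_resolution G E \<longleftrightarrow>
     projection_valued_measure E \<and> G = spectral_integral E (\<lambda>s. s)"

text \<open>
  \<open>cos (t G\<^sup>1\<^sup>/\<^sup>2)\<close> for a positive self-adjoint \<open>G\<close> with spectral resolution \<open>E\<close>. As \<open>E\<close> is then
  concentrated on \<open>[0, \<infinity>)\<close>, the values of \<^const>\<open>sqrt\<close> at negative arguments are irrelevant.
\<close>

definition cos_sqrt_op ::
    "(real set \<Rightarrow> 'a::euclidean_space L2 \<Rightarrow> 'a L2) \<Rightarrow> real \<Rightarrow> 'a L2 \<Rightarrow> 'a L2" where
  "cos_sqrt_op E t = op_apply (spectral_integral E (\<lambda>s. cos (t * sqrt s)))"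


section \<open>Test functions and the Sobolev space\<close>

definition partial_deriv :: "'n::finite \<Rightarrow> (real^'n \<Rightarrow> real) \<Rightarrow> real^'n \<Rightarrow> real" where
  "partial_deriv i f x = frechet_derivative f (at x) (axis i 1)"

fun C_k :: "nat \<Rightarrow> (real^'n::finite \<Rightarrow> real) \<Rightarrow> bool" where
  "C_k 0 f \<longleftrightarrow> continuous_on UNIV f"
| "C_k (Suc k) f \<longleftrightarrow> (\<forall>x. f differentiable at x) \<and> (\<forall>i. C_k k (partial_deriv i f))"

definition test_functions :: "(real^'n::finite \<Rightarrow> real) set" where
  "test_functions = {f. (\<forall>k. C_k k f) \<and> compact (closure {x. f x \<noteq> 0})}"

definition weak_partial :: "'n::finite \<Rightarrow> (real^'n) L2 \<Rightarrow> (real^'n) L2 \<Rightarrow> bool" where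
  "weak_partial i u g \<longleftrightarrow> (\<forall>f \<in> test_functions.
     (LINT x|lebesgue. L2_fun u x * complex_of_real (partial_deriv i f x)) =
     - (LINT x|lebesgue. L2_fun g x * complex_of_real (f x)))"

definition W12 :: "(real^'n::finite) L2 set" where
  "W12 = {u. \<forall>i. \<exists>g. weak_partial i u g}"

definition wderiv :: "'n::finite \<Rightarrow> (real^'n) L2 \<Rightarrow> (real^'n) L2" where
  "wderiv i u = (THE g. weak_partial i u g)"


section \<open>The viscosity operator\<close>

definition Linfty :: "(real^'n::finite \<Rightarrow> real) \<Rightarrow> bool" where
  "Linfty f \<longleftrightarrow> f \<in> borel_measurable lebesgue \<and> (\<exists>K. AE x in lebesgue. \<bar>f x\<bar> \<le> K)"

definition coefficient_matrix :: "(real^'n::finite \<Rightarrow> real^'n^'n) \<Rightarrow> bool" where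
  "coefficient_matrix C \<longleftrightarrow>
     (\<forall>i j. Linfty (\<lambda>x. C x $ i $ j)) \<and>
     (AE x in lebesgue. transpose (C x) = C x \<and> (\<forall>v. 0 \<le> v \<bullet> (C x *v v)))"

text \<open>
  The sesquilinear forms (antilinear in the first argument) whose diagonals are \<open>h\<close> and \<open>l\<close>.
\<close>

definition h_form ::
    "(real^'n::finite \<Rightarrow> real^'n^'n) \<Rightarrow> (real^'n) L2 \<Rightarrow> (real^'n) L2 \<Rightarrow> complex" where
  "h_form C v u = (\<Sum>i\<in>UNIV. \<Sum>j\<in>UNIV. LINT x|lebesgue.
     cnj (L2_fun (wderiv i v) x) * (complex_of_real (C x $ i $ j) * L2_fun (wderiv j u) x))"

definition l_form :: "(real^'n::finite) L2 \<Rightarrow> (real^'n) L2 \<Rightarrow> complex" where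
  "l_form v u = (\<Sum>i\<in>UNIV. cinner (wderiv i v) (wderiv i u))"

definition H_eps :: "(real^'n::finite \<Rightarrow> real^'n^'n) \<Rightarrow> real \<Rightarrow> (real^'n) operator" where
  "H_eps C e = form_operator W12 (\<lambda>v u. h_form C v u + complex_of_real e * l_form v u)"

definition viscosity_operator ::
    "(real^'n::finite \<Rightarrow> real^'n^'n) \<Rightarrow> (real^'n) operator \<Rightarrow> bool" where
  "viscosity_operator C H0 \<longleftrightarrow>
     self_adjoint_op H0 \<and> positive_op H0 \<and> strong_resolvent_limit (H_eps C) H0 (at_right 0)"


section \<open>The pseudodistance\<close>

definition dist_functions :: "(real^'n::finite \<Rightarrow> real^'n^'n) \<Rightarrow> (real^'n \<Rightarrow> real) set" where
  "dist_functions C = {f \<in> test_functions. AE x in lebesgue.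
     \<bar>\<Sum>i\<in>UNIV. \<Sum>j\<in>UNIV. C x $ i $ j * partial_deriv i f x * partial_deriv j f x\<bar> \<le> 1}"

definition d_C :: "(real^'n::finite \<Rightarrow> real^'n^'n) \<Rightarrow> real^'n \<Rightarrow> real^'n \<Rightarrow> ereal" where
  "d_C C x y = (SUP f \<in> dist_functions C. ereal \<bar>f x - f y\<bar>)"

definition B_C :: "(real^'n::finite \<Rightarrow> real^'n^'n) \<Rightarrow> real^'n \<Rightarrow> real \<Rightarrow> (real^'n) set" where
  "B_C C x r = {y. d_C C x y < ereal r}"

text \<open>
  \<open>d_tilde C x1 r1 x2 r2\<close> is attached to the balls \<open>B_C C x1 r1\<close> and \<open>B_C C x2 r2\<close> through their
  centres and radii, not through the underlying sets.
\<close>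

definition d_tilde ::
    "(real^'n::finite \<Rightarrow> real^'n^'n) \<Rightarrow> real^'n \<Rightarrow> real \<Rightarrow> real^'n \<Rightarrow> real \<Rightarrow> ereal" where
  "d_tilde C x1 r1 x2 r2 = max (d_C C x1 x2 - ereal r1 - ereal r2) 0"

end

theory Submission
  imports Defs
begin

text \<open>
  For \<open>\<psi>\<close> in the set defining \<open>d_C\<close>, testing the equation \<open>(H\<^sub>\<epsilon> - z) u = \<phi>\<^sub>2\<close> with
  \<open>e\<^sup>2\<^sup>\<alpha>\<^sup>\<psi> u\<close> gives a bound on \<open>e\<^sup>\<alpha>\<^sup>\<psi> u\<close> in terms of \<open>e\<^sup>\<alpha>\<^sup>\<psi> \<phi>\<^sub>2\<close> that survives the limits
  \<open>\<epsilon> \<rightarrow> 0\<close> and \<open>z \<rightarrow> - l\<^sup>2\<close>, for every \<open>\<alpha> < l\<close>. If \<open>\<psi>\<close> separates the supports of \<open>\<phi>\<^sub>1\<close> and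
  \<open>\<phi>\<^sub>2\<close> by a gap \<open>T\<close>, it follows that \<open>(\<phi>\<^sub>1, (H\<^sub>0 + l\<^sup>2)\<inverse> \<phi>\<^sub>2)\<close> decays like \<open>e\<^sup>-\<^sup>l\<^sup>T\<close>. Up to the
  factor \<open>l\<close> this is the Laplace transform at \<open>l\<close> of \<open>t \<mapsto> (\<phi>\<^sub>1, cos (t H\<^sub>0\<^sup>1\<^sup>/\<^sup>2) \<phi>\<^sub>2)\<close>, so the
  latter function vanishes on \<open>(0, T)\<close>.
\<close>

section \<open>The Hilbert space \<open>L\<^sub>2\<close>\<close>

lemma L2_rel_L2_fun: "L2_rel (L2_fun u) (L2_fun u)"
  unfolding L2_fun_def by (rule Quotient3_rep_reflp[OF Quotient3_L2])

lemma square_integrable_L2_fun: "square_integrable (L2_fun u)"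
  using L2_rel_L2_fun by (auto simp: L2_rel_def)

lemma measurable_L2_fun [measurable]: "L2_fun u \<in> borel_measurable lebesgue"
  using square_integrable_L2_fun by (auto simp: square_integrable_def)

lemma abs_L2_L2_fun: "abs_L2 (L2_fun u) = u"
  unfolding L2_fun_def by (rule Quotient3_abs_rep[OF Quotient3_L2])

lemma L2_fun_abs_L2:
  assumes "square_integrable f"
  shows "AE x in lebesgue. L2_fun (abs_L2 f) x = f x"
proof -
  have "L2_rel f f" using assms by (simp add: L2_rel_def)
  then have "L2_rel (L2_fun (abs_L2 f)) f"
    unfolding L2_fun_def by (rule Quotient3_rep_abs[OF Quotient3_L2])
  then show ?thesis by (simp add: L2_rel_def)
qed

lemma L2_eqI:
  assumes "AE x in lebesgue. L2_fun u x = L2_fun v x"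
  shows "u = v"
proof -
  have "L2_rel (L2_fun u) (L2_fun v)"
    using assms by (simp add: L2_rel_def square_integrable_L2_fun)
  then show ?thesis
    by (metis L2_fun_def Quotient3_rel_rep Quotient3_L2)
qed

lemma L2_fun_plus: "AE x in lebesgue. L2_fun (u + v) x = L2_fun u x + L2_fun v x"
proof -
  have "u + v = abs_L2 (\<lambda>x. L2_fun u x + L2_fun v x)"
    using plus_L2.abs_eq[OF L2_rel_L2_fun L2_rel_L2_fun, of u v] by (simp add: abs_L2_L2_fun)
  then show ?thesis
    using L2_fun_abs_L2[OF square_integrable_add[OF square_integrable_L2_fun square_integrable_L2_fun]]
    by metis
qed

lemma L2_fun_scaleC: "AE x in lebesgue. L2_fun (c *\<^sub>C u) x = c * L2_fun u x"
proof -
  have "c *\<^sub>C u = abs_L2 (\<lambda>x. c * L2_fun u x)"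
    using scaleC.abs_eq[OF L2_rel_L2_fun, of c u] by (simp add: abs_L2_L2_fun)
  then show ?thesis
    using L2_fun_abs_L2[OF square_integrable_scale[OF square_integrable_L2_fun]] by metis
qed

lemma L2_fun_minus: "AE x in lebesgue. L2_fun (u - v) x = L2_fun u x - L2_fun v x"
  using L2_fun_plus[of u "- v"] L2_fun_scaleC[of "-1" v]
  by eventually_elim (simp add: uminus_L2_def minus_L2_def)

lemma L2_fun_scaleR: "AE x in lebesgue. L2_fun (r *\<^sub>R u) x = complex_of_real r * L2_fun u x"
  using L2_fun_scaleC[of "complex_of_real r" u] by (simp add: scaleR_L2_def)

lemma L2_fun_zero: "AE x in lebesgue. L2_fun 0 x = 0"
  using L2_fun_abs_L2[OF square_integrable_zero] by (simp add: zero_L2_def)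

lemma cinner_L2_fun: "cinner u v = (LINT x|lebesgue. cnj (L2_fun u x) * L2_fun v x)"
  using cinner.abs_eq[OF L2_rel_L2_fun L2_rel_L2_fun, of u v] by (simp add: abs_L2_L2_fun)

lemma scaleC_add_right: "c *\<^sub>C (u + v) = c *\<^sub>C u + c *\<^sub>C v"
proof (rule L2_eqI)
  show "AE x in lebesgue. L2_fun (c *\<^sub>C (u + v)) x = L2_fun (c *\<^sub>C u + c *\<^sub>C v) x"
    using L2_fun_scaleC[of c "u+v"] L2_fun_plus[of u v] L2_fun_scaleC[of c u]
      L2_fun_scaleC[of c v] L2_fun_plus[of "c *\<^sub>C u" "c *\<^sub>C v"]
    by eventually_elim (simp add: algebra_simps)
qed

lemma scaleC_add_left: "(c + d) *\<^sub>C u = c *\<^sub>C u + d *\<^sub>C u"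
proof (rule L2_eqI)
  show "AE x in lebesgue. L2_fun ((c + d) *\<^sub>C u) x = L2_fun (c *\<^sub>C u + d *\<^sub>C u) x"
    using L2_fun_scaleC[of "c+d" "u"] L2_fun_scaleC[of c u]
      L2_fun_scaleC[of d u] L2_fun_plus[of "c *\<^sub>C u" "d *\<^sub>C u"]
    by eventually_elim (simp add: algebra_simps)
qed

lemma scaleC_scaleC: "c *\<^sub>C d *\<^sub>C u = (c * d) *\<^sub>C u"
proof (rule L2_eqI)
  show "AE x in lebesgue. L2_fun (c *\<^sub>C d *\<^sub>C u) x = L2_fun ((c * d) *\<^sub>C u) x"
    using L2_fun_scaleC[of "c*d" "u"] L2_fun_scaleC[of c "d *\<^sub>C u"]
      L2_fun_scaleC[of d u]
    by eventually_elim (simp add: algebra_simps)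
qed

lemma scaleC_of_real: "complex_of_real r *\<^sub>C u = r *\<^sub>R u"
  by (simp add: scaleR_L2_def)

lemma scaleC_one [simp]: "1 *\<^sub>C u = u"
  using scaleC_of_real[of 1 u] by simp

lemma scaleC_minus_one: "(-1) *\<^sub>C u = - u"
  by (simp add: uminus_L2_def)

lemma scaleC_zero_right [simp]: "c *\<^sub>C 0 = (0 :: 'a::euclidean_space L2)"
  using scaleC_add_right[of c 0 "0::'a L2"] by simp

lemma scaleC_minus_right: "c *\<^sub>C (- u) = - (c *\<^sub>C u)"
  using scaleC_add_right[of c u "-u"] by (simp add: eq_neg_iff_add_eq_0 add.commute)

lemma scaleC_diff_right: "c *\<^sub>C (u - v) = c *\<^sub>C u - c *\<^sub>C v"
  using scaleC_add_right[of c u "-v"] by (simp add: scaleC_minus_right)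

lemma cinner_scaleR_right: "cinner u (r *\<^sub>R v) = complex_of_real r * cinner u v"
  by (simp add: scaleR_L2_def cinner_scaleC_right)

lemma cinner_zero_right [simp]: "cinner u 0 = 0"
  using cinner_scaleR_right[of u 0 0] by simp

lemma cinner_minus_right: "cinner u (- v) = - cinner u v"
  using cinner_scaleC_right[of u "-1" v] by (simp add: uminus_L2_def)

lemma cinner_diff_right: "cinner u (v - w) = cinner u v - cinner u w"
  using cinner_add_right[of u v "-w"] by (simp add: cinner_minus_right)

lemma cinner_add_left: "cinner (v + w) u = cinner v u + cinner w u"
  using cinner_cnj[of "v + w" u] cinner_cnj[of v u] cinner_cnj[of w u]
  by (simp add: cinner_add_right)

lemma cinner_scaleC_left: "cinner (c *\<^sub>C v) u = cnj c * cinner v u"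
  using cinner_cnj[of "c *\<^sub>C v" u] cinner_cnj[of v u] by (simp add: cinner_scaleC_right)

lemma cinner_scaleR_left: "cinner (r *\<^sub>R v) u = complex_of_real r * cinner v u"
  by (simp add: scaleR_L2_def cinner_scaleC_left)

lemma cinner_zero_left [simp]: "cinner 0 u = 0"
  using cinner_scaleR_left[of 0 0 u] by simp

lemma cinner_minus_left: "cinner (- v) u = - cinner v u"
  using cinner_scaleC_left[of "-1" v u] by (simp add: uminus_L2_def)

lemma cinner_diff_left: "cinner (v - w) u = cinner v u - cinner w u"
  using cinner_add_left[of v "-w" u] by (simp add: cinner_minus_left)

lemmas cinner_simps = cinner_add_left cinner_add_right cinner_diff_left cinner_diff_right
  cinner_minus_left cinner_minus_right cinner_scaleC_left cinner_scaleC_right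
  cinner_scaleR_left cinner_scaleR_right

lemma cinner_norm: "cinner u u = complex_of_real ((norm u)\<^sup>2)"
  using cinner_self[of u] by (simp add: norm_L2_def Re_cinner_self_nonneg)

lemma norm_scaleC: "norm (c *\<^sub>C u) = cmod c * norm u"
proof -
  have "complex_of_real ((norm (c *\<^sub>C u))\<^sup>2) = complex_of_real ((cmod c * norm u)\<^sup>2)"
    using complex_norm_square[of c] cinner_norm[of u]
    by (simp add: cinner_norm[symmetric] cinner_simps power_mult_distrib del: of_real_power)
  then show ?thesis
    unfolding of_real_eq_iff by (simp add: power2_eq_iff_nonneg)
qed

lemma cinner_inner: "cinner u v = Complex (u \<bullet> v) (- (u \<bullet> (\<i> *\<^sub>C v)))"
  by (simp add: complex_eq_iff inner_L2_def cinner_simps)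

text \<open>Rotating \<open>v\<close> by the phase of \<open>cinner u v\<close> reduces this to the real Cauchy--Schwarz inequality.\<close>

lemma norm_cinner_le: "cmod (cinner u v) \<le> norm u * norm v"
proof -
  define c where "c = cnj (sgn (cinner u v))"
  have "c * cinner u v = complex_of_real (cmod (cinner u v))"
    unfolding c_def using complex_norm_square[of "cinner u v"]
    by (cases "cinner u v = 0")
       (auto simp: sgn_div_norm divide_simps scaleR_conv_of_real power2_eq_square mult.commute)
  then have "cmod (cinner u v) = u \<bullet> (c *\<^sub>C v)"
    by (simp add: inner_L2_def cinner_simps)
  also have "\<dots> \<le> norm u * norm (c *\<^sub>C v)" by (rule norm_cauchy_schwarz)
  also have "\<dots> \<le> norm u * (1 * norm v)"
    unfolding norm_scaleC c_def by (intro mult_left_mono mult_right_mono) (auto simp: norm_sgn)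
  finally show ?thesis by simp
qed

lemma cinner_eqI: "(\<And>v. cinner v u = cinner v w) \<Longrightarrow> u = w"
  using Re_cinner_self_eq_0[of "u - w"] by (simp add: cinner_diff_right)

lemma bounded_linear_cinner_right: "bounded_linear (cinner u)"
  by (rule bounded_linear_intro[where K = "norm u"])
     (auto simp: cinner_simps scaleR_conv_of_real mult.commute intro: norm_cinner_le order_trans)

lemma tendsto_scaleC:
  assumes "(f \<longlongrightarrow> u) F" shows "((\<lambda>x. c *\<^sub>C f x) \<longlongrightarrow> c *\<^sub>C u) F"
proof -
  have "bounded_linear (\<lambda>u. c *\<^sub>C u)"
    by (rule bounded_linear_intro[where K = "cmod c"])
       (auto simp: scaleC_add_right norm_scaleC scaleC_scaleC scaleR_L2_def mult.commute)
  from bounded_linear.tendsto[OF this assms] show ?thesis .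
qed

lemma tendsto_cinner:
  assumes "(f \<longlongrightarrow> u) F" "(g \<longlongrightarrow> v) F"
  shows "((\<lambda>x. cinner (f x) (g x)) \<longlongrightarrow> cinner u v) F"
proof -
  have "((\<lambda>x. Complex (f x \<bullet> g x) (- (f x \<bullet> (\<i> *\<^sub>C g x)))) \<longlongrightarrow> Complex (u \<bullet> v) (- (u \<bullet> (\<i> *\<^sub>C v)))) F"
    by (intro tendsto_Complex tendsto_minus tendsto_inner tendsto_scaleC assms)
  then show ?thesis by (simp add: cinner_inner)
qed

lemma norm_L2_power2: "(norm u)\<^sup>2 = (LINT x|lebesgue. (cmod (L2_fun u x))\<^sup>2)"
proof -
  have "cnj z * z = complex_of_real ((cmod z)\<^sup>2)" for z
    using complex_norm_square[of z] by (simp add: mult.commute)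
  then have "complex_of_real ((norm u)\<^sup>2) = complex_of_real (LINT x|lebesgue. (cmod (L2_fun u x))\<^sup>2)"
    unfolding cinner_norm[symmetric] cinner_L2_fun by (simp only: integral_complex_of_real)
  then show ?thesis using of_real_eq_iff by blast
qed

lemma nn_integral_L2_fun:
  "(\<integral>\<^sup>+x. ennreal ((cmod (L2_fun u x))\<^sup>2) \<partial>lebesgue) = ennreal ((norm u)\<^sup>2)"
  unfolding norm_L2_power2
  using square_integrable_L2_fun[of u]
  by (intro nn_integral_eq_integral) (auto simp: square_integrable_def)

lemma square_integrableI_nn:
  assumes "f \<in> borel_measurable lebesgue" "(\<integral>\<^sup>+x. ennreal ((cmod (f x))\<^sup>2) \<partial>lebesgue) < \<infinity>"
  shows "square_integrable f"
  unfolding square_integrable_def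
proof (intro conjI assms(1) integrableI_bounded)
  show "(\<lambda>x. (cmod (f x))\<^sup>2) \<in> borel_measurable lebesgue" using assms(1) by measurable
qed (use assms in simp)

lemma summable_AE_of_fast:
  fixes d :: "nat \<Rightarrow> 'a::euclidean_space \<Rightarrow> complex"
  assumes [measurable]: "\<And>k. d k \<in> borel_measurable lebesgue"
    and le: "\<And>k. (\<integral>\<^sup>+x. ennreal ((cmod (d k x))\<^sup>2) \<partial>lebesgue) \<le> ennreal ((1/8)^k)"
  shows "AE x in lebesgue. summable (\<lambda>k. d k x)"
proof -
  have "(\<integral>\<^sup>+x. (\<Sum>k. ennreal (4^k) * ennreal ((cmod (d k x))\<^sup>2)) \<partial>lebesgue)
      = (\<Sum>k. \<integral>\<^sup>+x. ennreal (4^k) * ennreal ((cmod (d k x))\<^sup>2) \<partial>lebesgue)"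
    by (rule nn_integral_suminf) measurable
  also have "\<dots> = (\<Sum>k. ennreal (4^k) * (\<integral>\<^sup>+x. ennreal ((cmod (d k x))\<^sup>2) \<partial>lebesgue))"
    by (intro suminf_cong nn_integral_cmult) measurable
  also have "\<dots> \<le> (\<Sum>k. ennreal (4^k) * ennreal ((1/8)^k))"
    by (intro suminf_le mult_left_mono le) auto
  also have "\<dots> = (\<Sum>k. ennreal ((1/2)^k))"
    by (intro suminf_cong) (simp add: ennreal_mult[symmetric] power_mult_distrib[symmetric])
  also have "\<dots> = ennreal (\<Sum>k. (1/2)^k)"
    by (intro suminf_ennreal2) auto
  also have "\<dots> < \<infinity>" by simp
  finally have "AE x in lebesgue. (\<Sum>k. ennreal (4^k) * ennreal ((cmod (d k x))\<^sup>2)) \<noteq> \<infinity>"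
    by (intro nn_integral_PInf_AE) auto
  then show ?thesis
  proof eventually_elim
    case (elim x)
    then obtain S where S: "0 \<le> S" "(\<Sum>k. ennreal (4^k) * ennreal ((cmod (d k x))\<^sup>2)) = ennreal S"
      by (cases "\<Sum>k. ennreal (4^k) * ennreal ((cmod (d k x))\<^sup>2)") auto
    have "cmod (d k x) \<le> sqrt S * (1/2)^k" for k
    proof -
      have "ennreal (4^k * (cmod (d k x))\<^sup>2) = ennreal (4^k) * ennreal ((cmod (d k x))\<^sup>2)"
        by (simp add: ennreal_mult)
      also have "\<dots> = (\<Sum>j\<in>{k}. ennreal (4^j) * ennreal ((cmod (d j x))\<^sup>2))" by simp
      also have "\<dots> \<le> ennreal S" unfolding S(2)[symmetric] by (intro sum_le_suminf) auto
      finally have "4^k * (cmod (d k x))\<^sup>2 \<le> S" using S(1) by simp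
      then have "(2^k * cmod (d k x))\<^sup>2 \<le> S"
        by (simp add: power_mult_distrib power_mult[symmetric] mult.commute[of k 2])
           (simp add: power_mult)
      then have "2^k * cmod (d k x) \<le> sqrt S" by (rule real_le_rsqrt)
      then show ?thesis by (simp add: power_divide field_simps)
    qed
    moreover have "summable (\<lambda>k. sqrt S * (1/2::real)^k)" by (intro summable_mult summable_geometric) auto
    ultimately show ?case by (intro summable_comparison_test'[of "\<lambda>k. sqrt S * (1/2)^k" 0 "\<lambda>k. d k x"]) auto
  qed
qed

instance L2 :: (euclidean_space) complete_space
proof
  fix X :: "nat \<Rightarrow> 'a L2" assume X: "Cauchy X"
  have "\<exists>N. \<forall>m\<ge>N. \<forall>n\<ge>N. norm (X m - X n) < (1/3)^k" for k :: nat
    using X unfolding Cauchy_iff by (metis zero_less_divide_1_iff zero_less_numeral zero_less_power)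
  then obtain N where N: "\<And>k m n. m \<ge> N k \<Longrightarrow> n \<ge> N k \<Longrightarrow> norm (X m - X n) < (1/3)^k"
    by metis
  define r where "r k = (\<Sum>i\<le>k. N i) + k" for k
  have r_mono: "strict_mono r" unfolding strict_mono_Suc_iff r_def by simp
  have rN: "N k \<le> r m" if "k \<le> m" for k m
    unfolding r_def using that member_le_sum[of k "{..m}" N] by (simp add: trans_le_add1)
  define f where "f k = L2_fun (X (r k))" for k
  have [measurable]: "f k \<in> borel_measurable lebesgue" for k by (simp add: f_def)
  have dist: "(\<integral>\<^sup>+x. ennreal ((cmod (f m x - f n x))\<^sup>2) \<partial>lebesgue) = ennreal ((norm (X (r m) - X (r n)))\<^sup>2)" for m n
  proof -
    have "(\<integral>\<^sup>+x. ennreal ((cmod (f m x - f n x))\<^sup>2) \<partial>lebesgue)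
        = (\<integral>\<^sup>+x. ennreal ((cmod (L2_fun (X (r m) - X (r n)) x))\<^sup>2) \<partial>lebesgue)"
      using L2_fun_minus[of "X (r m)" "X (r n)"] by (intro nn_integral_cong_AE) (auto simp: f_def)
    then show ?thesis by (simp add: nn_integral_L2_fun)
  qed
  have small: "ennreal ((norm (X (r m) - X (r n)))\<^sup>2) \<le> ennreal ((1/8)^k)" if "m \<ge> k" "n \<ge> k" for m n k
  proof -
    have "norm (X (r m) - X (r n)) \<le> (1/3)^k" using N rN that by (simp add: less_imp_le)
    then have "(norm (X (r m) - X (r n)))\<^sup>2 \<le> ((1/3)^k)\<^sup>2" by (intro power_mono) auto
    also have "\<dots> = (1/9)^k" by (simp add: power2_eq_square power_mult_distrib[symmetric])
    also have "\<dots> \<le> (1/8)^k" by (intro power_mono) auto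
    finally show ?thesis by (intro ennreal_leI)
  qed
  define g where "g x = lim (\<lambda>k. f k x)" for x
  have [measurable]: "g \<in> borel_measurable lebesgue"
    unfolding g_def by (intro borel_measurable_lim_metric) measurable
  have "AE x in lebesgue. summable (\<lambda>k. f (Suc k) x - f k x)"
    by (intro summable_AE_of_fast) (measurable, simp only: dist, intro small, auto)
  then have conv: "AE x in lebesgue. (\<lambda>k. f k x) \<longlonglongrightarrow> g x"
  proof eventually_elim
    case (elim x)
    from summable_LIMSEQ[OF elim] have "convergent (\<lambda>n. \<Sum>k<n. f (Suc k) x - f k x)"
      by (auto simp: convergent_def)
    then have "convergent (\<lambda>n. f n x - f 0 x)" 
      by (simp only: sum_lessThan_telescope[of "\<lambda>k. f k x"])
    then have "convergent (\<lambda>n. f n x)"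
      using convergent_add[of "\<lambda>n. f n x - f 0 x" "\<lambda>_. f 0 x", OF _ convergent_const] by simp
    then show ?case unfolding g_def by (rule convergent_LIMSEQ_iff[THEN iffD1])
  qed
  have gf: "(\<integral>\<^sup>+x. ennreal ((cmod (g x - f n x))\<^sup>2) \<partial>lebesgue) \<le> ennreal ((1/8)^n)" for n
  proof -
    have "(\<integral>\<^sup>+x. ennreal ((cmod (g x - f n x))\<^sup>2) \<partial>lebesgue)
       = (\<integral>\<^sup>+x. liminf (\<lambda>m. ennreal ((cmod (f m x - f n x))\<^sup>2)) \<partial>lebesgue)"
    proof (rule nn_integral_cong_AE, use conv in eventually_elim)
      case (elim x)
      then have "(\<lambda>m. ennreal ((cmod (f m x - f n x))\<^sup>2)) \<longlonglongrightarrow> ennreal ((cmod (g x - f n x))\<^sup>2)"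
        by (intro tendsto_intros)
      then show ?case by (intro lim_imp_Liminf[symmetric]) auto
    qed
    also have "\<dots> \<le> liminf (\<lambda>m. \<integral>\<^sup>+x. ennreal ((cmod (f m x - f n x))\<^sup>2) \<partial>lebesgue)"
      by (intro nn_integral_liminf) measurable
    also have "\<dots> \<le> liminf (\<lambda>m. ennreal ((1/8)^n))"
      unfolding dist by (intro Liminf_mono eventually_sequentiallyI[of n] small) auto
    also have "\<dots> = ennreal ((1/8)^n)" by (simp add: Liminf_const)
    finally show ?thesis .
  qed
  have sq: "square_integrable (\<lambda>x. g x - f 0 x)"
    by (intro square_integrableI_nn) (measurable, use gf[of 0] in \<open>simp add: le_less_trans\<close>)
  have "square_integrable (\<lambda>x. (g x - f 0 x) + f 0 x)"
    by (intro square_integrable_add sq) (simp add: f_def square_integrable_L2_fun)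
  then have sg: "square_integrable g" by simp
  have "norm (X (r n) - abs_L2 g) \<le> sqrt ((1/8)^n)" for n
  proof -
    have "ennreal ((norm (X (r n) - abs_L2 g))\<^sup>2) = (\<integral>\<^sup>+x. ennreal ((cmod (g x - f n x))\<^sup>2) \<partial>lebesgue)"
      unfolding nn_integral_L2_fun[symmetric]
      by (rule nn_integral_cong_AE, use L2_fun_minus[of "X (r n)" "abs_L2 g"] L2_fun_abs_L2[OF sg] in eventually_elim)
         (simp add: f_def norm_minus_commute)
    with gf[of n] have "ennreal ((norm (X (r n) - abs_L2 g))\<^sup>2) \<le> ennreal ((1/8)^n)" by (simp only:)
    then have "(norm (X (r n) - abs_L2 g))\<^sup>2 \<le> (1/8)^n" by (subst (asm) ennreal_le_iff) auto
    then show ?thesis by (rule real_le_rsqrt)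
  qed
  moreover have "(\<lambda>n. sqrt ((1/8)^n)) \<longlonglongrightarrow> 0"
    using tendsto_real_sqrt[OF LIMSEQ_power_zero[of "1/8::real"]] by simp
  ultimately have "(\<lambda>n. X (r n) - abs_L2 g) \<longlonglongrightarrow> 0"
    by (intro Lim_null_comparison[of "\<lambda>n. X (r n) - abs_L2 g" "\<lambda>n. sqrt ((1/8)^n)"] always_eventually) auto
  then have "(X \<circ> r) \<longlonglongrightarrow> abs_L2 g" unfolding o_def by (rule LIM_zero_cancel)
  with X r_mono have "X \<longlonglongrightarrow> abs_L2 g" by (metis Cauchy_converges_subseq)
  then show "convergent X" by (auto simp: convergent_def)
qed

section \<open>Smooth functions\<close>

lemma has_derivative_imp_partial_deriv:
  "(f has_derivative f') (at x) \<Longrightarrow> partial_deriv i f x = f' (axis i 1)"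
  unfolding partial_deriv_def by (metis frechet_derivative_at)

lemma partial_deriv_const: "partial_deriv i (\<lambda>x. c) = (\<lambda>x. 0)"
  by (rule ext, rule has_derivative_imp_partial_deriv[THEN trans]) auto

lemma partial_deriv_add:
  assumes "\<And>x. f differentiable (at x)" "\<And>x. g differentiable (at x)"
  shows "partial_deriv i (\<lambda>x. f x + g x) = (\<lambda>x. partial_deriv i f x + partial_deriv i g x)"
proof
  fix x
  show "partial_deriv i (\<lambda>x. f x + g x) x = partial_deriv i f x + partial_deriv i g x"
    using has_derivative_imp_partial_deriv[OF has_derivative_add[OF
        assms(1)[of x, unfolded frechet_derivative_works] assms(2)[of x, unfolded frechet_derivative_works]]]
    by (simp add: partial_deriv_def)
qed

lemma partial_deriv_mult:
  assumes "\<And>x. f differentiable (at x)" "\<And>x. g differentiable (at x)"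
  shows "partial_deriv i (\<lambda>x. f x * g x) = (\<lambda>x. f x * partial_deriv i g x + partial_deriv i f x * g x)"
proof
  fix x
  show "partial_deriv i (\<lambda>x. f x * g x) x = f x * partial_deriv i g x + partial_deriv i f x * g x"
    using has_derivative_imp_partial_deriv[OF has_derivative_mult[OF
        assms(1)[of x, unfolded frechet_derivative_works] assms(2)[of x, unfolded frechet_derivative_works]]]
    by (simp add: partial_deriv_def)
qed

lemma has_derivative_chain_real:
  assumes "f differentiable (at x)" "(F has_real_derivative D) (at (f x))"
  shows "((\<lambda>x. F (f x)) has_derivative (\<lambda>h. D * frechet_derivative f (at x) h)) (at x)"
  using has_derivative_compose[OF assms(1)[unfolded frechet_derivative_works]
      assms(2)[unfolded has_field_derivative_def]] by simp

lemma partial_deriv_chain: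
  assumes "\<And>x. f differentiable (at x)" "\<And>y. (F has_real_derivative F' y) (at y)"
  shows "partial_deriv i (\<lambda>x. F (f x)) = (\<lambda>x. F' (f x) * partial_deriv i f x)"
proof
  fix x
  show "partial_deriv i (\<lambda>x. F (f x)) x = F' (f x) * partial_deriv i f x"
    using has_derivative_imp_partial_deriv[OF has_derivative_chain_real[OF assms]]
    by (simp add: partial_deriv_def)
qed

lemma C_k_Suc_imp: "C_k (Suc k) f \<Longrightarrow> C_k k f"
proof (induction k arbitrary: f)
  case 0
  then show ?case
    by (auto simp: continuous_on_eq_continuous_within intro: differentiable_imp_continuous_within)
qed auto

lemma C_k_const: "C_k k (\<lambda>x. c)"
  by (induction k arbitrary: c) (auto simp: partial_deriv_const)

lemma C_k_add: "C_k k f \<Longrightarrow> C_k k g \<Longrightarrow> C_k k (\<lambda>x. f x + g x)"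
  by (induction k arbitrary: f g)
     (auto simp: partial_deriv_add intro: continuous_on_add differentiable_add)

lemma C_k_mult: "C_k k f \<Longrightarrow> C_k k g \<Longrightarrow> C_k k (\<lambda>x. f x * g x)"
proof (induction k arbitrary: f g)
  case (Suc k)
  have "C_k k f" "C_k k g" using Suc.prems by (auto dest: C_k_Suc_imp simp del: C_k.simps)
  with Suc show ?case
    by (auto simp: partial_deriv_mult intro!: C_k_add intro: differentiable_mult)
qed (auto intro: continuous_on_mult)

lemma C_k_prod: "finite I \<Longrightarrow> (\<And>i. i \<in> I \<Longrightarrow> C_k k (f i)) \<Longrightarrow> C_k k (\<lambda>x. \<Prod>i\<in>I. f i x)"
  by (induction I rule: finite_induct) (auto intro!: C_k_const C_k_mult)

lemma C_k_exp: "C_k k f \<Longrightarrow> C_k k (\<lambda>x. exp (f x))"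
proof (induction k)
  case (Suc k)
  then have f: "C_k k f" by (auto dest: C_k_Suc_imp simp del: C_k.simps)
  have d: "f differentiable (at x)" for x using Suc.prems by simp
  have "(\<lambda>x. exp (f x)) differentiable (at x)" for x
    using has_derivative_chain_real[OF d DERIV_exp] by (rule differentiableI)
  moreover have "partial_deriv i (\<lambda>x. exp (f x)) = (\<lambda>x. exp (f x) * partial_deriv i f x)" for i
    by (rule partial_deriv_chain[OF d DERIV_exp])
  ultimately show ?case using Suc f by (auto intro: C_k_mult)
qed (auto intro: continuous_on_exp)

section \<open>Bump functions\<close>

definition bump :: "real poly \<Rightarrow> real \<Rightarrow> real" where
  "bump p s = (if s > 0 then poly p (1 / s) * exp (- (1 / s)) else 0)"

lemma tendsto_poly_exp: "((\<lambda>y. poly p y * exp (- y)) \<longlongrightarrow> (0::real)) at_top"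
proof -
  have "((\<lambda>y. \<Sum>i\<le>degree p. coeff p i * (y ^ i / exp y)) \<longlongrightarrow> (\<Sum>i\<le>degree p. coeff p i * 0)) at_top"
    by (intro tendsto_sum tendsto_mult tendsto_const tendsto_power_div_exp_0)
  then show ?thesis
    by (simp add: poly_altdef sum_distrib_right exp_minus divide_inverse mult.assoc)
qed

lemma tendsto_bump_0: "((\<lambda>s. bump p s) \<longlongrightarrow> 0) (at_right 0)"
proof -
  have "((\<lambda>s. poly p (inverse s) * exp (- inverse s)) \<longlongrightarrow> 0) (at_right (0::real))"
    by (rule filterlim_compose[OF tendsto_poly_exp filterlim_inverse_at_top_right])
  then show ?thesis
    by (rule Lim_transform_eventually)
       (simp add: bump_def inverse_eq_divide eventually_at_filter)
qed

lemma DERIV_bump: "(bump p has_real_derivative bump ([:0, 0, 1:] * (p - pderiv p)) s) (at s)"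
proof -
  consider "s < 0" | "s > 0" | "s = 0" by linarith
  then show ?thesis
  proof cases
    case 1
    have "(bump p has_real_derivative 0) (at s)"
      by (rule has_field_derivative_transform_within_open[of "\<lambda>_. 0" _ _ "{..<0}"])
         (use 1 in \<open>auto simp: bump_def\<close>)
    then show ?thesis using 1 by (simp add: bump_def)
  next
    case 2
    have "((\<lambda>s. poly p (1 / s) * exp (- (1 / s))) has_real_derivative
        bump ([:0, 0, 1:] * (p - pderiv p)) s) (at s)"
      using 2 by (auto intro!: derivative_eq_intros poly_DERIV[THEN DERIV_chain2]
          simp: bump_def power2_eq_square field_simps)
    then show ?thesis
      by (rule has_field_derivative_transform_within_open[of _ _ _ "{0<..}"])
         (use 2 in \<open>auto simp: bump_def\<close>)
  next
    case 3
    have "((\<lambda>h. (bump p (0 + h) - bump p 0) / h) \<longlongrightarrow> 0) (at 0)"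
    proof (rule filterlim_split_at)
      have "((\<lambda>_. 0) \<longlongrightarrow> (0::real)) (at_left (0::real))" by simp
      then show "((\<lambda>h. (bump p (0 + h) - bump p 0) / h) \<longlongrightarrow> 0) (at_left 0)"
        by (rule Lim_transform_eventually) (simp add: bump_def eventually_at_filter)
      show "((\<lambda>h. (bump p (0 + h) - bump p 0) / h) \<longlongrightarrow> 0) (at_right 0)"
        by (rule Lim_transform_eventually[OF tendsto_bump_0[of "pCons 0 p"]])
           (simp add: bump_def eventually_at_filter)
    qed
    then show ?thesis using 3 by (simp add: has_field_derivative_iff bump_def)
  qed
qed

lemma C_k_bump: "C_k k (\<lambda>x::real^'n. bump p (a * x $ i + b))"
proof (induction k arbitrary: p)
  case 0
  have "continuous_on UNIV (bump p)"
    by (rule DERIV_continuous_on) (use DERIV_bump in \<open>auto intro: DERIV_subset\<close>)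
  then show ?case
    unfolding C_k.simps
    by (rule continuous_on_compose2) (auto intro!: continuous_intros)
next
  case (Suc k)
  have lin: "((\<lambda>x::real^'n. a * x $ i + b) has_derivative (\<lambda>h. a * h $ i)) (at x)" for x
    by (auto intro!: derivative_eq_intros bounded_linear_imp_has_derivative bounded_linear_vec_nth)
  have d: "(\<lambda>x::real^'n. a * x $ i + b) differentiable (at x)" for x
    using lin by (rule differentiableI)
  have "(\<lambda>x::real^'n. bump p (a * x $ i + b)) differentiable (at x)" for x
    using has_derivative_chain_real[OF d DERIV_bump] by (rule differentiableI)
  moreover have "C_k k (partial_deriv j (\<lambda>x::real^'n. bump p (a * x $ i + b)))" for j
  proof -
    have "partial_deriv j (\<lambda>x::real^'n. a * x $ i + b) = (\<lambda>x. a * axis j 1 $ i)"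
      by (rule ext) (rule has_derivative_imp_partial_deriv[OF lin])
    with partial_deriv_chain[OF d DERIV_bump]
    show ?thesis by (auto intro!: C_k_mult Suc.IH C_k_const)
  qed
  ultimately show ?case by simp
qed

lemma bump_one_bounds: "0 \<le> bump 1 s" "bump 1 s \<le> 1"
  by (auto simp: bump_def)

lemma tendsto_bump_one:
  "(\<lambda>n. bump 1 (real (Suc n) * s)) \<longlonglongrightarrow> (if s > 0 then 1 else 0)"
proof (cases "s > 0")
  case True
  have "(\<lambda>n. exp (- (inverse (real (Suc n)) * inverse s))) \<longlonglongrightarrow> exp (- (0 * inverse s))"
    by (intro tendsto_intros LIMSEQ_inverse_real_of_nat)
  moreover have "bump 1 (real (Suc n) * s) = exp (- (inverse (real (Suc n)) * inverse s))" for n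
    using True by (simp add: bump_def inverse_eq_divide zero_less_mult_iff del: of_nat_Suc)
  ultimately show ?thesis using True by simp
next
  case False
  then show ?thesis by (simp add: bump_def mult_le_0_iff not_less zero_less_mult_iff)
qed

definition box_bump :: "nat \<Rightarrow> real^'n::finite \<Rightarrow> real^'n \<Rightarrow> real^'n \<Rightarrow> real" where
  "box_bump n a b x = (\<Prod>i\<in>UNIV. bump 1 (real (Suc n) * (x $ i - a $ i)) *
     bump 1 (real (Suc n) * (b $ i - x $ i)))"

lemma box_bump_bounds: "0 \<le> box_bump n a b x" "box_bump n a b x \<le> 1"
  unfolding box_bump_def
  by (auto intro!: prod_nonneg prod_le_1 mult_nonneg_nonneg mult_le_one bump_one_bounds)

lemma box_bump_nonzeroD: "box_bump n a b x \<noteq> 0 \<Longrightarrow> x \<in> box a b"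
proof -
  assume "box_bump n a b x \<noteq> 0"
  then have "\<And>i. bump 1 (real (Suc n) * (x $ i - a $ i)) \<noteq> 0 \<and> bump 1 (real (Suc n) * (b $ i - x $ i)) \<noteq> 0"
    by (auto simp: box_bump_def)
  then have "\<And>i. 0 < real (Suc n) * (x $ i - a $ i) \<and> 0 < real (Suc n) * (b $ i - x $ i)"
    unfolding bump_def by metis
  then show ?thesis by (auto simp: mem_box_cart zero_less_mult_iff)
qed

lemma tendsto_box_bump: "(\<lambda>n. box_bump n a b x) \<longlonglongrightarrow> indicator (box a b) x"
proof -
  have "(\<lambda>n. box_bump n a b x) \<longlonglongrightarrow>
    (\<Prod>i\<in>UNIV. (if x $ i - a $ i > 0 then 1 else 0) * (if b $ i - x $ i > 0 then 1 else 0))"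
    unfolding box_bump_def by (intro tendsto_prod tendsto_mult tendsto_bump_one)
  also have "(\<Prod>i\<in>UNIV. (if x $ i - a $ i > 0 then 1 else 0) * (if b $ i - x $ i > 0 then 1 else (0::real)))
     = indicator (box a b) x"
    by (auto simp: indicator_def mem_box_cart intro!: prod.neutral prod_zero)
  finally show ?thesis .
qed

section \<open>Test functions\<close>

lemma C_k_box_bump: "C_k k (box_bump n a b)"
proof -
  have "C_k k (\<lambda>x. bump 1 (real (Suc n) * (x $ i - a $ i)))" for i
    using C_k_bump[of k 1 "real (Suc n)" i "- (real (Suc n) * a $ i)"] by (simp add: algebra_simps)
  moreover have "C_k k (\<lambda>x. bump 1 (real (Suc n) * (b $ i - x $ i)))" for i
    using C_k_bump[of k 1 "- real (Suc n)" i "real (Suc n) * b $ i"] by (simp add: algebra_simps)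
  ultimately show ?thesis
    unfolding box_bump_def by (intro C_k_prod C_k_mult) auto
qed

lemma test_functionsI:
  assumes "\<And>k. C_k k f" "bounded S" "\<And>x. f x \<noteq> 0 \<Longrightarrow> x \<in> S"
  shows "f \<in> test_functions"
proof -
  have "bounded {x. f x \<noteq> 0}" by (rule bounded_subset[OF assms(2)]) (use assms(3) in auto)
  then show ?thesis using assms(1) by (auto simp: test_functions_def compact_closure)
qed

lemma test_functionsD:
  assumes "f \<in> test_functions"
  shows "C_k k f" "bounded {x. f x \<noteq> 0}" "f differentiable (at x)" "continuous_on UNIV f"
proof -
  show *: "C_k k f" for k using assms by (auto simp: test_functions_def)
  show "bounded {x. f x \<noteq> 0}" using assms by (auto simp: test_functions_def compact_closure)
  show "f differentiable (at x)" using *[of "Suc 0"] by simp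
  show "continuous_on UNIV f" using *[of 0] by simp
qed

lemma box_bump_test: "box_bump n a b \<in> test_functions"
  by (rule test_functionsI[OF C_k_box_bump bounded_box box_bump_nonzeroD])

lemma test_functions_mult:
  assumes "f \<in> test_functions" "\<And>k. C_k k h"
  shows "(\<lambda>x. h x * f x) \<in> test_functions"
  by (rule test_functionsI[of _ "{x. f x \<noteq> 0}"])
     (use assms test_functionsD[OF assms(1)] in \<open>auto intro: C_k_mult\<close>)

lemma test_functions_cmult: "f \<in> test_functions \<Longrightarrow> (\<lambda>x. c * f x) \<in> test_functions"
  by (rule test_functions_mult) (auto intro: C_k_const)

lemma test_functions_exp: "f \<in> test_functions \<Longrightarrow> (\<lambda>x. exp (f x) - 1) \<in> test_functions"
  by (rule test_functionsI[of _ "{x. f x \<noteq> 0}"])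
     (use C_k_add[OF C_k_exp[OF test_functionsD(1)] C_k_const[of _ "-1"], of f]
        test_functionsD(2)[of f] in auto)

lemma test_functions_partial_deriv:
  assumes "f \<in> test_functions" shows "partial_deriv i f \<in> test_functions"
proof (rule test_functionsI[of _ "closure {x. f x \<noteq> 0}"])
  show "C_k k (partial_deriv i f)" for k using test_functionsD(1)[OF assms, of "Suc k"] by simp
  show "bounded (closure {x. f x \<noteq> 0})" using test_functionsD(2)[OF assms] by (rule bounded_closure)
  fix x assume "partial_deriv i f x \<noteq> 0"
  show "x \<in> closure {x. f x \<noteq> 0}"
  proof (rule ccontr)
    assume x: "x \<notin> closure {x. f x \<noteq> 0}"
    have "(f has_derivative (\<lambda>_. 0)) (at x)"
      by (rule has_derivative_transform_within_open[of "\<lambda>_. 0" _ _ _ "- closure {x. f x \<noteq> 0}"])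
         (use x closure_subset[of "{x. f x \<noteq> 0}"] in \<open>auto simp: open_Compl\<close>)
    then have "partial_deriv i f x = 0" by (rule has_derivative_imp_partial_deriv)
    with \<open>partial_deriv i f x \<noteq> 0\<close> show False by simp
  qed
qed

lemma continuous_imp_lebesgue_measurable:
  fixes f :: "'a::euclidean_space \<Rightarrow> 'b::topological_space"
  shows "continuous_on UNIV f \<Longrightarrow> f \<in> borel_measurable lebesgue"
  using borel_measurable_continuous_onI[of f] by (auto intro: measurable_completion)

lemma test_functions_bounded: "f \<in> test_functions \<Longrightarrow> \<exists>K. \<forall>x. \<bar>f x\<bar> \<le> K"
proof -
  assume f: "f \<in> test_functions"
  let ?S = "closure {x. f x \<noteq> 0}"
  have "compact (f ` ?S)"
    using f test_functionsD(4)[OF f]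
    by (intro compact_continuous_image) (auto simp: test_functions_def intro: continuous_on_subset)
  then obtain K where "\<forall>y\<in>f ` ?S. norm y \<le> K"
    using compact_imp_bounded bounded_iff by metis
  then have K: "\<And>x. x \<in> ?S \<Longrightarrow> \<bar>f x\<bar> \<le> K" by auto
  have "\<bar>f x\<bar> \<le> max K 0" for x
    using K[of x] closure_subset[of "{x. f x \<noteq> 0}"] by (cases "f x = 0") auto
  then show ?thesis by blast
qed

lemma test_functions_measurable: "f \<in> test_functions \<Longrightarrow> f \<in> borel_measurable lebesgue"
  by (intro continuous_imp_lebesgue_measurable test_functionsD)

lemma test_functions_Linfty: "f \<in> test_functions \<Longrightarrow> Linfty f"
  using test_functions_bounded[of f] test_functions_measurable[of f] by (auto simp: Linfty_def)

lemma square_integrable_indicator_box: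
  "square_integrable (indicator (cbox a b) :: 'a::euclidean_space \<Rightarrow> complex)"
proof -
  have "(cmod (indicator (cbox a b) x))\<^sup>2 = indicator (cbox a b) x" for x
    by (auto simp: indicator_def)
  moreover have "(indicator (cbox a b) :: 'a \<Rightarrow> complex) \<in> borel_measurable lebesgue"
    by (intro borel_measurable_indicator) auto
  moreover have "integrable lebesgue (indicat_real (cbox a b))"
    using lmeasurable_cbox by (simp add: lmeasurable_iff_integrable)
  ultimately show ?thesis unfolding square_integrable_def by simp
qed

lemma square_integrable_test:
  assumes f: "f \<in> test_functions"
  shows "square_integrable (\<lambda>x. complex_of_real (f x))"
proof -
  obtain K where K: "\<And>x. \<bar>f x\<bar> \<le> K" using test_functions_bounded[OF f] by auto
  obtain a b where ab: "{x. f x \<noteq> 0} \<subseteq> cbox a b"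
    using bounded_subset_cbox_symmetric[OF test_functionsD(2)[OF f]] by metis
  have "integrable lebesgue (\<lambda>x. (f x)\<^sup>2)"
  proof (rule Bochner_Integration.integrable_bound)
    show "integrable lebesgue (\<lambda>x. K\<^sup>2 * indicator (cbox a b) x :: real)"
      using lmeasurable_cbox[of a b] by (simp add: lmeasurable_iff_integrable)
    show "(\<lambda>x. (f x)\<^sup>2) \<in> borel_measurable lebesgue" using test_functions_measurable[OF f] by measurable
    show "AE x in lebesgue. norm ((f x)\<^sup>2) \<le> norm (K\<^sup>2 * indicator (cbox a b) x :: real)"
    proof (rule AE_I2)
      fix x
      have "(f x)\<^sup>2 \<le> K\<^sup>2" using power_mono[OF K[of x], of 2] by simp
      then show "norm ((f x)\<^sup>2) \<le> norm (K\<^sup>2 * indicator (cbox a b) x :: real)"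
        using ab by (cases "f x = 0") (auto simp: indicator_def)
    qed
  qed
  then show ?thesis
    using test_functions_measurable[OF f] by (simp add: square_integrable_def)
qed

lemma cnj_indicator: "cnj (indicator A x) = indicator A x"
  by (simp add: indicator_def)

lemma sigma_finite_lebesgue: "sigma_finite_measure (lebesgue :: 'a::euclidean_space measure)"
proof
  obtain A :: "'a set set" where A: "countable A" "A \<subseteq> sets lborel" "\<Union>A = space lborel"
    "\<forall>a\<in>A. emeasure lborel a \<noteq> \<infinity>"
    using lborel.sigma_finite_countable by auto
  then show "\<exists>A::'a set set. countable A \<and> A \<subseteq> sets lebesgue \<and> \<Union>A = space lebesgue \<and>
      (\<forall>a\<in>A. emeasure lebesgue a \<noteq> \<infinity>)"
    by (intro exI[of _ A]) (auto simp: subset_iff)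
qed

lemma AE_zero_if_box_integrals_zero:
  fixes g :: "'a::euclidean_space \<Rightarrow> complex"
  assumes g: "integrable lebesgue g" and z: "\<And>a b. (LINT x|lebesgue. indicator (box a b) x * g x) = 0"
    and ab: "\<And>x. g x \<noteq> 0 \<Longrightarrow> x \<in> box c d"
  shows "AE x in lebesgue. g x = 0"
proof (rule sigma_finite_measure.density_zero[OF sigma_finite_lebesgue g])
  have int: "integrable lebesgue (\<lambda>x. indicator A x *\<^sub>R g x)" if "A \<in> sets lebesgue" for A
    using that g by (rule integrable_mult_indicator)
  have z': "(LINT x|lebesgue. indicator (box a b) x *\<^sub>R g x) = 0" for a b
  proof -
    have "indicator (box a b) x *\<^sub>R g x = indicator (box a b) x * g x" for x
      by (auto simp: indicator_def)
    then show ?thesis using z by simp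
  qed
  have "(\<lambda>x. indicator (box c d) x *\<^sub>R g x) = g" using ab by (auto simp: indicator_def fun_eq_iff)
  with z'[of c d] have tot: "(LINT x|lebesgue. g x) = 0" by simp
  have borel: "(LINT x|lebesgue. indicator A x *\<^sub>R g x) = 0" if "A \<in> sets borel" for A
  proof -
    let ?G = "range (\<lambda>(a, b). box a b :: 'a set)"
    have sb: "sigma_sets UNIV ?G = sets borel" by (simp add: borel_eq_box)
    have stable: "Int_stable ?G" by (auto simp: Int_stable_def box_Int_box intro!: image_eqI)
    from that have "A \<in> sigma_sets UNIV ?G" using sb by simp
    from stable subset_UNIV[of ?G, folded Pow_UNIV] this show ?thesis
    proof (induction rule: sigma_sets_induct_disjoint)
      case (basic A)
      then show ?case using z' by auto
    next
      case (compl A)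
      then have A: "A \<in> sets lebesgue" using sb by auto
      have "(LINT x|lebesgue. indicator (UNIV - A) x *\<^sub>R g x)
          = (LINT x|lebesgue. g x - indicator A x *\<^sub>R g x)"
        by (intro Bochner_Integration.integral_cong) (auto simp: indicator_def)
      also have "\<dots> = 0" using compl tot g int[OF A] by simp
      finally show ?case .
    next
      case (union A)
      then have A: "A i \<in> sets lebesgue" for i using sb by auto
      have "(LINT x:(\<Union>i. A i)|lebesgue. g x) = (\<Sum>i. LINT x:A i|lebesgue. g x)"
        using A union.hyps(1)
        by (intro lebesgue_integral_countable_add)
           (auto simp: disjoint_family_on_def set_integrable_def intro!: int sets.countable_UN)
      then show ?case using union by (simp add: set_lebesgue_integral_def)
    qed auto
  qed
  fix A :: "'a set" assume "A \<in> sets lebesgue"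
  then obtain S N N' where A: "A = S \<union> N" "N \<subseteq> N'" "N' \<in> null_sets lborel" "S \<in> sets lborel"
    by (auto elim: sets_completionE)
  have "AE x in lebesgue. x \<notin> N'"
    using A(3) by (intro AE_not_in) (auto intro: null_sets_completionI)
  then have "AE x in lebesgue. indicator A x *\<^sub>R g x = indicator S x *\<^sub>R g x"
    by eventually_elim (use A in \<open>auto simp: indicator_def\<close>)
  then have "(LINT x|lebesgue. indicator A x *\<^sub>R g x) = (LINT x|lebesgue. indicator S x *\<^sub>R g x)"
    using \<open>A \<in> sets lebesgue\<close> A(4) int[of A] int[of S]
    by (intro integral_cong_AE) auto
  then show "(LINT x:A|lebesgue. g x) = 0"
    using borel[of S] A(4) by (simp add: set_lebesgue_integral_def)
qed

lemma L2_eq_zero_if_orthogonal_test: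
  fixes g :: "(real^'n::finite) L2"
  assumes z: "\<And>f. f \<in> test_functions \<Longrightarrow> (LINT x|lebesgue. L2_fun g x * complex_of_real (f x)) = 0"
  shows "g = 0"
proof -
  define G where "G = L2_fun g"
  have [measurable]: "G \<in> borel_measurable lebesgue" by (simp add: G_def)
  have int: "integrable lebesgue (\<lambda>x. indicator (cbox a b) x * G x)" for a b
    using integrable_cnj_mult[OF square_integrable_indicator_box square_integrable_L2_fun[of g], of a b]
    by (simp add: G_def cnj_indicator)
  have int': "integrable lebesgue (\<lambda>x. indicator (box a b) x * G x)" for a b
  proof (rule Bochner_Integration.integrable_bound[OF int[of a b]])
    show "(\<lambda>x. indicator (box a b) x * G x) \<in> borel_measurable lebesgue"
      by (intro borel_measurable_times borel_measurable_indicator) auto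
  qed (auto simp: indicator_def box_subset_cbox[THEN subsetD])
  have box: "(LINT x|lebesgue. indicator (box a b) x * G x) = 0" for a b
  proof -
    have "(\<lambda>n. LINT x|lebesgue. G x * complex_of_real (box_bump n a b x)) \<longlonglongrightarrow>
        (LINT x|lebesgue. G x * complex_of_real (indicator (box a b) x))"
    proof (rule integral_dominated_convergence[where w = "\<lambda>x. cmod (indicator (cbox a b) x * G x)"])
      show "(\<lambda>x. G x * complex_of_real (box_bump n a b x)) \<in> borel_measurable lebesgue" for n
        using test_functions_measurable[OF box_bump_test] by measurable
      show "integrable lebesgue (\<lambda>x. cmod (indicator (cbox a b) x * G x))" using int by auto
      show "AE x in lebesgue. (\<lambda>n. G x * complex_of_real (box_bump n a b x)) \<longlonglongrightarrow>
          G x * complex_of_real (indicator (box a b) x)"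
        by (intro AE_I2 tendsto_intros tendsto_box_bump)
      show "AE x in lebesgue. norm (G x * complex_of_real (box_bump n a b x))
          \<le> cmod (indicator (cbox a b) x * G x)" for n
      proof (rule AE_I2)
        fix x
        have "box_bump n a b x = 0 \<or> x \<in> cbox a b"
          using box_bump_nonzeroD box_subset_cbox by blast
        then show "norm (G x * complex_of_real (box_bump n a b x)) \<le> cmod (indicator (cbox a b) x * G x)"
          using box_bump_bounds[of n a b x] by (auto simp: norm_mult mult_left_le)
      qed
      have "indicat_real (box a b) \<in> borel_measurable lebesgue"
        by (intro borel_measurable_indicator) auto
      then show "(\<lambda>x. G x * complex_of_real (indicator (box a b) x)) \<in> borel_measurable lebesgue"
        by measurable
    qed
    then have "(\<lambda>n. 0::complex) \<longlonglongrightarrow> (LINT x|lebesgue. G x * complex_of_real (indicator (box a b) x))"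
      using z[OF box_bump_test] by (simp add: G_def)
    then have "(LINT x|lebesgue. G x * complex_of_real (indicator (box a b) x)) = 0"
      using LIMSEQ_unique tendsto_const by blast
    moreover have "G x * complex_of_real (indicator (box a b) x) = indicator (box a b) x * G x" for x
      by (auto simp: indicator_def)
    ultimately show ?thesis by simp
  qed
  have "AE x in lebesgue. \<forall>n::nat. indicator (box (\<chi> i. - real n) (\<chi> i. real n)) x * G x = 0"
    unfolding AE_all_countable
  proof (intro allI AE_zero_if_box_integrals_zero)
    fix n :: nat and a b :: "real^'n"
    obtain a' b' where ab: "box a b \<inter> box (\<chi> i. - real n) (\<chi> i. real n) = box a' b'"
      unfolding box_Int_box by blast
    have "(\<lambda>x. indicator (box a b) x * (indicator (box (\<chi> i. - real n) (\<chi> i. real n)) x * G x))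
      = (\<lambda>x. indicator (box a' b') x * G x)"
      unfolding ab[symmetric] by (auto simp: indicator_def)
    then show "(LINT x|lebesgue. indicator (box a b) x * (indicator (box (\<chi> i. - real n) (\<chi> i. real n)) x * G x)) = 0"
      using box by (simp only:)
    show "x \<in> box (\<chi> i. - real n) (\<chi> i. real n)"
      if "indicator (box (\<chi> i. - real n) (\<chi> i. real n)) x * G x \<noteq> 0" for x
      using that by (simp add: indicator_def split: if_splits)
  qed (rule int')
  then have G: "AE x in lebesgue. G x = 0"
  proof eventually_elim
    case (elim x)
    obtain n :: nat where n: "norm x < real n" using reals_Archimedean2 by blast
    have "\<bar>x $ i\<bar> < real n" for i using component_le_norm_cart[of x i] n by linarith
    then have "x \<in> box (\<chi> i. - real n) (\<chi> i. real n)" by (auto simp: mem_box_cart abs_less_iff minus_less_iff)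
    with elim[rule_format, of n] show ?case by simp
  qed
  show ?thesis
    by (intro L2_eqI, use G L2_fun_zero[where 'a = "real^'n"] in eventually_elim) (simp add: G_def)
qed

section \<open>Multiplication operators\<close>

definition mulL :: "(real^'n::finite \<Rightarrow> real) \<Rightarrow> (real^'n) L2 \<Rightarrow> (real^'n) L2" where
  "mulL m u = abs_L2 (\<lambda>x. complex_of_real (m x) * L2_fun u x)"

lemma LinftyD [measurable_dest]: "Linfty m \<Longrightarrow> m \<in> borel_measurable lebesgue"
  by (simp add: Linfty_def)

lemma Linfty_bound:
  assumes "Linfty m"
  obtains K where "0 \<le> K" "AE x in lebesgue. \<bar>m x\<bar> \<le> K"
proof -
  from assms obtain K where "AE x in lebesgue. \<bar>m x\<bar> \<le> K" by (auto simp: Linfty_def)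
  then have "AE x in lebesgue. \<bar>m x\<bar> \<le> max K 0" by eventually_elim auto
  then show ?thesis using that[of "max K 0"] by auto
qed

lemma Linfty_const: "Linfty (\<lambda>x. c)"
  by (auto simp: Linfty_def)

lemma Linfty_add:
  assumes "Linfty f" "Linfty g" shows "Linfty (\<lambda>x. f x + g x)"
proof -
  obtain K L where "AE x in lebesgue. \<bar>f x\<bar> \<le> K" "AE x in lebesgue. \<bar>g x\<bar> \<le> L"
    using assms by (auto simp: Linfty_def)
  then have "AE x in lebesgue. \<bar>f x + g x\<bar> \<le> K + L" by eventually_elim linarith
  then show ?thesis using assms by (auto simp: Linfty_def)
qed

lemma Linfty_mult:
  assumes "Linfty f" "Linfty g" shows "Linfty (\<lambda>x. f x * g x)"
proof -
  obtain K where K: "0 \<le> K" "AE x in lebesgue. \<bar>f x\<bar> \<le> K" using assms(1) by (rule Linfty_bound)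
  obtain L where L: "AE x in lebesgue. \<bar>g x\<bar> \<le> L" using assms(2) by (rule Linfty_bound)
  from K(2) L have "AE x in lebesgue. \<bar>f x * g x\<bar> \<le> K * L"
    by eventually_elim (simp add: abs_mult mult_mono K(1))
  then show ?thesis using assms by (auto simp: Linfty_def)
qed

lemma square_integrable_mult_Linfty:
  assumes m: "Linfty m" and f: "square_integrable f"
  shows "square_integrable (\<lambda>x. complex_of_real (m x) * f x)"
proof -
  obtain K where K: "0 \<le> K" "AE x in lebesgue. \<bar>m x\<bar> \<le> K" using m by (rule Linfty_bound)
  have [measurable]: "f \<in> borel_measurable lebesgue" "m \<in> borel_measurable lebesgue"
    using m f by (auto simp: square_integrable_def Linfty_def)
  have "integrable lebesgue (\<lambda>x. (cmod (complex_of_real (m x) * f x))\<^sup>2)"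
  proof (rule Bochner_Integration.integrable_bound)
    show "integrable lebesgue (\<lambda>x. K\<^sup>2 * (cmod (f x))\<^sup>2)" using f by (simp add: square_integrable_def)
    show "AE x in lebesgue. norm ((cmod (complex_of_real (m x) * f x))\<^sup>2) \<le> norm (K\<^sup>2 * (cmod (f x))\<^sup>2)"
      using K(2)
    proof eventually_elim
      case (elim x)
      then have "(m x)\<^sup>2 \<le> K\<^sup>2" using power_mono[OF elim, of 2] by simp
      then show ?case by (simp add: norm_mult power_mult_distrib mult_right_mono)
    qed
  qed measurable
  then show ?thesis by (simp add: square_integrable_def)
qed

lemma L2_fun_mulL:
  "Linfty m \<Longrightarrow> AE x in lebesgue. L2_fun (mulL m u) x = complex_of_real (m x) * L2_fun u x"
  unfolding mulL_def by (intro L2_fun_abs_L2 square_integrable_mult_Linfty square_integrable_L2_fun)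

lemma cinner_eq_integralI:
  assumes "AE x in lebesgue. L2_fun u x = f x" "AE x in lebesgue. L2_fun v x = g x"
    and "f \<in> borel_measurable lebesgue" "g \<in> borel_measurable lebesgue"
  shows "cinner u v = (LINT x|lebesgue. cnj (f x) * g x)"
  unfolding cinner_L2_fun
proof (rule integral_cong_AE)
  show "AE x in lebesgue. cnj (L2_fun u x) * L2_fun v x = cnj (f x) * g x"
    using assms(1,2) by eventually_elim simp
qed (use assms(3,4) in \<open>auto intro!: borel_measurable_times measurable_cnj_lebesgue\<close>)

lemma cinner_mulL_right:
  assumes [measurable]: "Linfty m"
  shows "cinner v (mulL m u) = (LINT x|lebesgue. cnj (L2_fun v x) * (complex_of_real (m x) * L2_fun u x))"
  by (rule cinner_eq_integralI[OF _ L2_fun_mulL[OF assms]]) (simp_all, measurable)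

lemma cinner_mulL_commute:
  assumes [measurable]: "Linfty m"
  shows "cinner (mulL m v) u = cinner v (mulL m u)"
proof -
  have "cinner (mulL m v) u = (LINT x|lebesgue. cnj (complex_of_real (m x) * L2_fun v x) * L2_fun u x)"
    by (rule cinner_eq_integralI[OF L2_fun_mulL[OF assms]]) (simp_all, measurable)
  then show ?thesis by (simp add: cinner_mulL_right[OF assms] mult.left_commute mult.commute)
qed

lemma norm_L2_le:
  assumes K: "0 \<le> K" "AE x in lebesgue. cmod (L2_fun u x) \<le> K * cmod (L2_fun v x)"
  shows "norm u \<le> K * norm v"
proof -
  have "(norm u)\<^sup>2 \<le> (LINT x|lebesgue. K\<^sup>2 * (cmod (L2_fun v x))\<^sup>2)"
    unfolding norm_L2_power2
  proof (rule integral_mono_AE)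
    show "integrable lebesgue (\<lambda>x. (cmod (L2_fun u x))\<^sup>2)"
      using square_integrable_L2_fun[of u] by (simp add: square_integrable_def)
    show "integrable lebesgue (\<lambda>x. K\<^sup>2 * (cmod (L2_fun v x))\<^sup>2)"
      using square_integrable_L2_fun[of v] by (simp add: square_integrable_def)
    show "AE x in lebesgue. (cmod (L2_fun u x))\<^sup>2 \<le> K\<^sup>2 * (cmod (L2_fun v x))\<^sup>2"
      using K(2)
    proof eventually_elim
      case (elim x)
      from power_mono[OF this, of 2] show ?case by (simp add: power_mult_distrib)
    qed
  qed
  also have "\<dots> = (K * norm v)\<^sup>2"
    by (simp add: norm_L2_power2 power_mult_distrib)
  finally show ?thesis by (rule power2_le_imp_le) (simp add: K(1))
qed

lemma norm_mulL_le:
  assumes "Linfty m" "0 \<le> K" "AE x in lebesgue. \<bar>m x\<bar> \<le> K"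
  shows "norm (mulL m u) \<le> K * norm u"
  by (rule norm_L2_le[OF assms(2)], use L2_fun_mulL[OF assms(1), of u] assms(3) in eventually_elim)
     (auto simp: norm_mult mult_right_mono)

lemma mulL_add:
  assumes "Linfty m" shows "mulL m (u + v) = mulL m u + mulL m v"
  by (rule L2_eqI, use L2_fun_mulL[OF assms, of u] L2_fun_mulL[OF assms, of v]
      L2_fun_mulL[OF assms, of "u + v"] L2_fun_plus[of u v] L2_fun_plus[of "mulL m u" "mulL m v"]
      in eventually_elim) (simp add: algebra_simps)

lemma mulL_scaleC:
  assumes "Linfty m" shows "mulL m (c *\<^sub>C u) = c *\<^sub>C mulL m u"
  by (rule L2_eqI, use L2_fun_mulL[OF assms, of u] L2_fun_mulL[OF assms, of "c *\<^sub>C u"]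
      L2_fun_scaleC[of c u] L2_fun_scaleC[of c "mulL m u"]
      in eventually_elim) (simp add: algebra_simps)

lemma mulL_mulL:
  assumes "Linfty m" "Linfty m'" shows "mulL m (mulL m' u) = mulL (\<lambda>x. m x * m' x) u"
  by (rule L2_eqI, use L2_fun_mulL[OF assms(1), of "mulL m' u"] L2_fun_mulL[OF assms(2), of u]
      L2_fun_mulL[OF Linfty_mult[OF assms], of u] in eventually_elim) (simp add: algebra_simps)

lemma tendsto_mulL:
  assumes m: "Linfty m" and u: "(u \<longlongrightarrow> l) F" shows "((\<lambda>x. mulL m (u x)) \<longlongrightarrow> mulL m l) F"
proof -
  obtain K where K: "0 \<le> K" "AE x in lebesgue. \<bar>m x\<bar> \<le> K" using m by (rule Linfty_bound)
  have "bounded_linear (mulL m)"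
    by (rule bounded_linear_intro[where K = K])
       (auto simp: mulL_add[OF m] scaleR_L2_def mulL_scaleC[OF m] mult.commute[of _ K]
         intro: norm_mulL_le[OF m K])
  from bounded_linear.tendsto[OF this u] show ?thesis .
qed

section \<open>Weak derivatives\<close>

definition test_L2 :: "(real^'n::finite \<Rightarrow> real) \<Rightarrow> (real^'n) L2" where
  "test_L2 f = abs_L2 (\<lambda>x. complex_of_real (f x))"

lemma cinner_test_L2:
  assumes "f \<in> test_functions"
  shows "cinner (test_L2 f) u = (LINT x|lebesgue. L2_fun u x * complex_of_real (f x))"
proof -
  have [measurable]: "f \<in> borel_measurable lebesgue" by (rule test_functions_measurable[OF assms])
  show ?thesis unfolding test_L2_def
    by (subst cinner_eq_integralI[OF L2_fun_abs_L2[OF square_integrable_test[OF assms]], of u "L2_fun u"])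
       (simp_all add: mult.commute)
qed

lemma weak_partial_iff:
  "weak_partial i u g \<longleftrightarrow>
    (\<forall>f\<in>test_functions. cinner (test_L2 (partial_deriv i f)) u = - cinner (test_L2 f) g)"
  unfolding weak_partial_def
  by (auto simp: cinner_test_L2 test_functions_partial_deriv)

lemma weak_partial_unique:
  fixes u :: "(real^'n::finite) L2"
  assumes "weak_partial i u g" "weak_partial i u g'" shows "g = g'"
proof -
  have "g - g' = 0"
  proof (rule L2_eq_zero_if_orthogonal_test)
    fix f :: "real^'n \<Rightarrow> real" assume f: "f \<in> test_functions"
    have "cinner (test_L2 f) (g - g') = 0"
      using assms f by (auto simp: weak_partial_iff cinner_diff_right)
    then show "(LINT x|lebesgue. L2_fun (g - g') x * complex_of_real (f x)) = 0"
      using f by (simp add: cinner_test_L2)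
  qed
  then show ?thesis by simp
qed

lemma wderiv_eq: "weak_partial i u g \<Longrightarrow> wderiv i u = g"
  unfolding wderiv_def using weak_partial_unique by blast

lemma weak_partial_wderiv: "u \<in> W12 \<Longrightarrow> weak_partial i u (wderiv i u)"
  unfolding W12_def using wderiv_eq by auto

lemma W12I: "(\<And>i. weak_partial i u (g i)) \<Longrightarrow> u \<in> W12"
  unfolding W12_def by blast

lemma weak_partial_add:
  "weak_partial i u g \<Longrightarrow> weak_partial i v h \<Longrightarrow> weak_partial i (u + v) (g + h)"
  by (auto simp: weak_partial_iff cinner_simps)

lemma weak_partial_scaleC:
  "weak_partial i u g \<Longrightarrow> weak_partial i (c *\<^sub>C u) (c *\<^sub>C g)"
  by (auto simp: weak_partial_iff cinner_simps)

lemma W12_add: "u \<in> W12 \<Longrightarrow> v \<in> W12 \<Longrightarrow> u + v \<in> W12"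
  by (rule W12I[of _ "\<lambda>i. wderiv i u + wderiv i v"]) (intro weak_partial_add weak_partial_wderiv)

lemma W12_scaleC: "u \<in> W12 \<Longrightarrow> c *\<^sub>C u \<in> W12"
  by (rule W12I[of _ "\<lambda>i. c *\<^sub>C wderiv i u"]) (intro weak_partial_scaleC weak_partial_wderiv)

lemma W12_scaleR: "u \<in> W12 \<Longrightarrow> c *\<^sub>R u \<in> W12"
  by (simp add: scaleR_L2_def W12_scaleC)

lemma W12_zero: "0 \<in> W12"
  by (rule W12I[of _ "\<lambda>_. 0"]) (simp add: weak_partial_iff)

lemma wderiv_add: "u \<in> W12 \<Longrightarrow> v \<in> W12 \<Longrightarrow> wderiv i (u + v) = wderiv i u + wderiv i v"
  by (intro wderiv_eq weak_partial_add weak_partial_wderiv)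

lemma wderiv_scaleC: "u \<in> W12 \<Longrightarrow> wderiv i (c *\<^sub>C u) = c *\<^sub>C wderiv i u"
  by (intro wderiv_eq weak_partial_scaleC weak_partial_wderiv)

lemma wderiv_scaleR: "u \<in> W12 \<Longrightarrow> wderiv i (c *\<^sub>R u) = c *\<^sub>R wderiv i u"
  by (simp add: scaleR_L2_def wderiv_scaleC)

lemma wderiv_diff: "u \<in> W12 \<Longrightarrow> v \<in> W12 \<Longrightarrow> wderiv i (u - v) = wderiv i u - wderiv i v"
  using wderiv_add[OF _ W12_scaleR, of u v i "-1"] wderiv_scaleR[of v i "-1"] by simp

lemma weak_partial_closed:
  fixes u :: "(real^'n::finite) L2"
  assumes "F \<noteq> bot" "(X \<longlongrightarrow> u) F" "(G \<longlongrightarrow> g) F" "\<forall>\<^sub>F n in F. weak_partial i (X n) (G n)"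
  shows "weak_partial i u g"
  unfolding weak_partial_iff
proof
  fix f :: "real^'n \<Rightarrow> real" assume f: "f \<in> test_functions"
  have "((\<lambda>n. cinner (test_L2 (partial_deriv i f)) (X n)) \<longlongrightarrow> cinner (test_L2 (partial_deriv i f)) u) F"
    by (intro tendsto_cinner tendsto_const assms)
  moreover have "((\<lambda>n. cinner (test_L2 (partial_deriv i f)) (X n)) \<longlongrightarrow> - cinner (test_L2 f) g) F"
  proof (rule Lim_transform_eventually)
    show "((\<lambda>n. - cinner (test_L2 f) (G n)) \<longlongrightarrow> - cinner (test_L2 f) g) F"
      by (intro tendsto_cinner tendsto_minus tendsto_const assms)
    show "\<forall>\<^sub>F n in F. - cinner (test_L2 f) (G n) = cinner (test_L2 (partial_deriv i f)) (X n)"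
      using assms(4) by eventually_elim (use f in \<open>auto simp: weak_partial_iff\<close>)
  qed
  ultimately show "cinner (test_L2 (partial_deriv i f)) u = - cinner (test_L2 f) g"
    by (rule tendsto_unique[OF assms(1)])
qed

lemma cinner_test_L2_mulL:
  assumes f: "f \<in> test_functions" and h: "\<And>k. C_k k h" "Linfty h"
  shows "cinner (test_L2 f) (mulL h u) = cinner (test_L2 (\<lambda>x. h x * f x)) u"
proof -
  have [measurable]: "f \<in> borel_measurable lebesgue" "h \<in> borel_measurable lebesgue"
    using test_functions_measurable[OF f] h(2) by auto
  have hf: "(\<lambda>x. h x * f x) \<in> test_functions" by (rule test_functions_mult[OF f h(1)])
  show ?thesis
    unfolding cinner_test_L2[OF f] cinner_test_L2[OF hf]
    by (intro integral_cong_AE, measurable, use L2_fun_mulL[OF h(2), of u] in eventually_elim) simp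
qed

lemma test_L2_add:
  assumes "f \<in> test_functions" "g \<in> test_functions" "(\<lambda>x. f x + g x) \<in> test_functions"
  shows "cinner (test_L2 (\<lambda>x. f x + g x)) u = cinner (test_L2 f) u + cinner (test_L2 g) u"
proof -
  have int: "integrable lebesgue (\<lambda>x. L2_fun u x * complex_of_real (f x))" if "f \<in> test_functions" for f
    using integrable_cnj_mult[OF square_integrable_test[OF that] square_integrable_L2_fun[of u]]
    by (simp add: mult.commute)
  show ?thesis
    unfolding cinner_test_L2[OF assms(1)] cinner_test_L2[OF assms(2)] cinner_test_L2[OF assms(3)]
    using int[OF assms(1)] int[OF assms(2)] by (simp add: distrib_left)
qed

lemma weak_partial_mulL:
  fixes u :: "(real^'n::finite) L2"
  assumes u: "weak_partial i u g" and h: "\<And>k. C_k k h" "Linfty h" "Linfty (partial_deriv i h)"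
  shows "weak_partial i (mulL h u) (mulL h g + mulL (partial_deriv i h) u)"
  unfolding weak_partial_iff
proof
  fix f :: "real^'n \<Rightarrow> real" assume f: "f \<in> test_functions"
  have dh: "C_k k (partial_deriv i h)" for k using h(1)[of "Suc k"] by simp
  have hdiff: "h differentiable (at x)" for x using h(1)[of "Suc 0"] by simp
  have df: "partial_deriv i f \<in> test_functions" by (rule test_functions_partial_deriv[OF f])
  have hf: "(\<lambda>x. h x * f x) \<in> test_functions" by (rule test_functions_mult[OF f h(1)])
  have t1: "(\<lambda>x. h x * partial_deriv i f x) \<in> test_functions" by (rule test_functions_mult[OF df h(1)])
  have t2: "(\<lambda>x. partial_deriv i h x * f x) \<in> test_functions" by (rule test_functions_mult[OF f dh])
  have eq: "partial_deriv i (\<lambda>x. h x * f x) = (\<lambda>x. h x * partial_deriv i f x + partial_deriv i h x * f x)"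
    by (rule partial_deriv_mult[OF hdiff test_functionsD(3)[OF f]])
  have "cinner (test_L2 (\<lambda>x. h x * partial_deriv i f x)) u + cinner (test_L2 (\<lambda>x. partial_deriv i h x * f x)) u
      = cinner (test_L2 (partial_deriv i (\<lambda>x. h x * f x))) u"
    unfolding eq by (rule test_L2_add[symmetric, OF t1 t2])
      (use test_functions_partial_deriv[OF hf, of i] in \<open>simp add: eq\<close>)
  also have "\<dots> = - cinner (test_L2 (\<lambda>x. h x * f x)) g"
    using u hf by (simp add: weak_partial_iff)
  finally show "cinner (test_L2 (partial_deriv i f)) (mulL h u)
      = - cinner (test_L2 f) (mulL h g + mulL (partial_deriv i h) u)"
    by (simp add: cinner_test_L2_mulL[OF df h(1,2)] cinner_test_L2_mulL[OF f h(1,2)]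
        cinner_test_L2_mulL[OF f dh h(3)] cinner_add_right algebra_simps eq_neg_iff_add_eq_0)
qed

lemma exp_test:
  assumes w: "w \<in> test_functions"
  shows "C_k k (\<lambda>x. exp (w x))" "Linfty (\<lambda>x. exp (w x))"
    "partial_deriv i (\<lambda>x. exp (w x)) = (\<lambda>x. exp (w x) * partial_deriv i w x)"
proof -
  show "C_k k (\<lambda>x. exp (w x))" by (rule C_k_exp[OF test_functionsD(1)[OF w]])
  show "Linfty (\<lambda>x. exp (w x))"
    using Linfty_add[OF test_functions_Linfty[OF test_functions_exp[OF w]] Linfty_const[of 1]] by simp
  show "partial_deriv i (\<lambda>x. exp (w x)) = (\<lambda>x. exp (w x) * partial_deriv i w x)"
    by (rule partial_deriv_chain[OF test_functionsD(3)[OF w] DERIV_exp])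
qed

lemma weak_partial_exp:
  assumes w: "w \<in> test_functions" and u: "u \<in> W12"
  shows "weak_partial i (mulL (\<lambda>x. exp (w x)) u)
    (mulL (\<lambda>x. exp (w x)) (wderiv i u + mulL (partial_deriv i w) u))"
proof -
  have L: "Linfty (partial_deriv i w)"
    by (intro test_functions_Linfty test_functions_partial_deriv w)
  have "weak_partial i (mulL (\<lambda>x. exp (w x)) u)
    (mulL (\<lambda>x. exp (w x)) (wderiv i u) + mulL (partial_deriv i (\<lambda>x. exp (w x))) u)"
    by (rule weak_partial_mulL[OF weak_partial_wderiv[OF u] exp_test(1,2)[OF w]])
       (simp add: exp_test(3)[OF w] Linfty_mult exp_test(2)[OF w] L)
  then show ?thesis
    by (simp add: mulL_add[OF exp_test(2)[OF w]] mulL_mulL[OF exp_test(2)[OF w] L] exp_test(3)[OF w])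
qed

section \<open>Riesz representation for a closed form\<close>

lemma nonneg_quadratic_imp_discriminant:
  fixes a b c :: real
  assumes "\<And>s. 0 \<le> a + 2 * s * b + s\<^sup>2 * c" "0 \<le> c"
  shows "b\<^sup>2 \<le> a * c"
proof (cases "c = 0")
  case True
  have "b = 0"
  proof (rule ccontr)
    assume "b \<noteq> 0"
    then show False using assms(1)[of "- (a + 1) / (2 * b)"] True by (simp add: field_simps)
  qed
  then show ?thesis using True by simp
next
  case False
  then have "c > 0" using assms(2) by simp
  have "0 \<le> c * (a + 2 * (- b / c) * b + (- b / c)\<^sup>2 * c)"
    using assms(1)[of "- b / c"] assms(2) by (intro mult_nonneg_nonneg) auto
  also have "\<dots> = a * c - b\<^sup>2" using \<open>c > 0\<close> by (simp add: field_simps power2_eq_square)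
  finally show ?thesis by simp
qed

lemma tendsto_zero_if_power2:
  fixes f :: "'a \<Rightarrow> real"
  assumes "((\<lambda>x. (f x)\<^sup>2) \<longlongrightarrow> 0) F" shows "(f \<longlongrightarrow> 0) F"
  using tendsto_real_sqrt[OF assms] by (simp add: tendsto_rabs_zero_iff)

locale closed_real_form =
  fixes D :: "'v::real_vector set" and B :: "'v \<Rightarrow> 'v \<Rightarrow> real"
  assumes zero_mem: "0 \<in> D"
    and add_mem: "\<And>u v. u \<in> D \<Longrightarrow> v \<in> D \<Longrightarrow> u + v \<in> D"
    and scaleR_mem: "\<And>u c. u \<in> D \<Longrightarrow> c *\<^sub>R u \<in> D"
    and sym: "\<And>u v. u \<in> D \<Longrightarrow> v \<in> D \<Longrightarrow> B u v = B v u"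
    and add_right: "\<And>u v w. u \<in> D \<Longrightarrow> v \<in> D \<Longrightarrow> w \<in> D \<Longrightarrow> B u (v + w) = B u v + B u w"
    and scaleR_right: "\<And>u v c. u \<in> D \<Longrightarrow> v \<in> D \<Longrightarrow> B u (c *\<^sub>R v) = c * B u v"
    and nonneg: "\<And>u. u \<in> D \<Longrightarrow> 0 \<le> B u u"
    and complete: "\<And>X :: nat \<Rightarrow> 'v. (\<And>n. X n \<in> D) \<Longrightarrow>
      (\<And>e. e > 0 \<Longrightarrow> \<exists>N. \<forall>m\<ge>N. \<forall>n\<ge>N. B (X m - X n) (X m - X n) < e) \<Longrightarrow>
      \<exists>u\<in>D. (\<lambda>n. B (X n - u) (X n - u)) \<longlonglongrightarrow> 0"
begin

lemma diff_mem: "u \<in> D \<Longrightarrow> v \<in> D \<Longrightarrow> u - v \<in> D"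
  using add_mem[OF _ scaleR_mem, of u v "-1"] by simp

lemma diff_right: "u \<in> D \<Longrightarrow> v \<in> D \<Longrightarrow> w \<in> D \<Longrightarrow> B u (v - w) = B u v - B u w"
  using add_right[OF _ _ scaleR_mem, of u v w "-1"] scaleR_right[of u w "-1"] by simp

lemma add_left: "u \<in> D \<Longrightarrow> v \<in> D \<Longrightarrow> w \<in> D \<Longrightarrow> B (v + w) u = B v u + B w u"
  using add_right[of u v w] sym add_mem by metis

lemma scaleR_left: "u \<in> D \<Longrightarrow> v \<in> D \<Longrightarrow> B (c *\<^sub>R v) u = c * B v u"
  using scaleR_right[of u v c] sym scaleR_mem by metis

lemma square_add: "u \<in> D \<Longrightarrow> v \<in> D \<Longrightarrow>
  B (u + s *\<^sub>R v) (u + s *\<^sub>R v) = B u u + 2 * s * B u v + s\<^sup>2 * B v v"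
  using sym[of u v]
  by (simp add: add_left add_right scaleR_left scaleR_right add_mem scaleR_mem power2_eq_square algebra_simps)

lemma cauchy_schwarz:
  assumes "u \<in> D" "v \<in> D" shows "(B u v)\<^sup>2 \<le> B u u * B v v"
proof (rule nonneg_quadratic_imp_discriminant[OF _ nonneg[OF assms(2)]])
  fix s show "0 \<le> B u u + 2 * s * B u v + s\<^sup>2 * B v v"
    unfolding square_add[OF assms, symmetric] using assms by (intro nonneg add_mem scaleR_mem)
qed

text \<open>The representing vector minimises \<open>B v v - 2 F v\<close>.\<close>

lemma riesz:
  assumes F_add: "\<And>u v. u \<in> D \<Longrightarrow> v \<in> D \<Longrightarrow> F (u + v) = F u + F v"
    and F_scaleR: "\<And>u c. u \<in> D \<Longrightarrow> F (c *\<^sub>R u) = c * F u"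
    and F_bound: "\<And>u. u \<in> D \<Longrightarrow> \<bar>F u\<bar> \<le> M * sqrt (B u u)"
  shows "\<exists>u\<in>D. \<forall>v\<in>D. B v u = F v"
proof -
  define J where "J v = B v v - 2 * F v" for v
  have J_lower: "- M\<^sup>2 \<le> J v" if "v \<in> D" for v
  proof -
    have "0 \<le> (sqrt (B v v) - M)\<^sup>2" by simp
    also have "\<dots> = B v v - 2 * (M * sqrt (B v v)) + M\<^sup>2"
      using nonneg[OF that] by (simp add: power2_diff)
    finally show ?thesis using F_bound[OF that] by (simp add: J_def)
  qed
  define m where "m = (INF v\<in>D. J v)"
  have bdd: "bdd_below (J ` D)" using J_lower by (auto intro!: bdd_belowI[of _ "- M\<^sup>2"])
  have m_le: "m \<le> J v" if "v \<in> D" for v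
    unfolding m_def using bdd that by (rule cINF_lower)
  have "\<exists>v\<in>D. J v < m + 1 / real (Suc n)" for n
    using cInf_lessD[of "J ` D" "m + 1 / real (Suc n)"] zero_mem by (auto simp: m_def)
  then obtain X where X: "\<And>n. X n \<in> D" "\<And>n. J (X n) < m + 1 / real (Suc n)" by metis
  have small: "B (X k - X n) (X k - X n) < 2 / real (Suc k) + 2 / real (Suc n)" for k n
  proof -
    let ?x = "X k" and ?y = "X n"
    let ?z = "(1/2) *\<^sub>R (?x + ?y)"
    have z: "?z \<in> D" by (intro scaleR_mem add_mem X)
    have "B (?x - ?y) (?x - ?y) = 2 * J ?x + 2 * J ?y - 4 * J ?z"
      using X(1)[of k] X(1)[of n] sym[of ?x ?y] square_add[of ?x ?y "-1"]
      by (simp add: J_def F_add F_scaleR add_mem scaleR_mem add_left add_right scaleR_left scaleR_right field_simps)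
    also have "\<dots> \<le> 2 * J ?x + 2 * J ?y - 4 * m" using m_le[OF z] by simp
    also have "\<dots> < 2 / real (Suc k) + 2 / real (Suc n)" using X(2)[of k] X(2)[of n] by simp
    finally show ?thesis .
  qed
  have "\<exists>N. \<forall>k\<ge>N. \<forall>n\<ge>N. B (X k - X n) (X k - X n) < e" if "e > 0" for e
  proof -
    obtain N where N: "4 / e < real N" using reals_Archimedean2 by blast
    have "B (X k - X n) (X k - X n) < e" if "N \<le> k" "N \<le> n" for k n
    proof -
      have "2 / real (Suc j) < e / 2" if "N \<le> j" for j
      proof -
        have "4 / e < real (Suc j)" using N that by simp
        then show ?thesis using \<open>e > 0\<close> by (simp add: field_simps)
      qed
      from this[OF that(1)] this[OF that(2)] small[of k n] show ?thesis by linarith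
    qed
    then show ?thesis by blast
  qed
  then obtain u where u: "u \<in> D" "(\<lambda>n. B (X n - u) (X n - u)) \<longlonglongrightarrow> 0"
    using complete[of X] X(1) by blast
  have "B v u = F v" if v: "v \<in> D" for v
  proof -
    have "(B v (X n) - F v)\<^sup>2 \<le> 1 / real (Suc n) * B v v" for n
    proof (rule nonneg_quadratic_imp_discriminant[OF _ nonneg[OF v]])
      fix s
      have "m \<le> J (X n + s *\<^sub>R v)" using X v by (intro m_le add_mem scaleR_mem)
      also have "\<dots> = J (X n) + 2 * s * (B v (X n) - F v) + s\<^sup>2 * B v v"
        using X(1)[of n] v sym[of v "X n"]
        by (simp add: J_def square_add F_add F_scaleR scaleR_mem algebra_simps)
      finally show "0 \<le> 1 / real (Suc n) + 2 * s * (B v (X n) - F v) + s\<^sup>2 * B v v"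
        using X(2)[of n] by linarith
    qed
    moreover have "(\<lambda>n. 1 / real (Suc n) * B v v) \<longlonglongrightarrow> 0 * B v v"
      using LIMSEQ_inverse_real_of_nat by (intro tendsto_mult tendsto_const) (simp add: inverse_eq_divide)
    ultimately have "(\<lambda>n. (B v (X n) - F v)\<^sup>2) \<longlonglongrightarrow> 0"
      by (intro Lim_null_comparison[of "\<lambda>n. (B v (X n) - F v)\<^sup>2" "\<lambda>n. 1 / real (Suc n) * B v v"]) auto
    then have 1: "(\<lambda>n. B v (X n) - F v) \<longlonglongrightarrow> 0" by (rule tendsto_zero_if_power2)
    have "(\<lambda>n. (B v (X n - u))\<^sup>2) \<longlonglongrightarrow> 0"
    proof (rule Lim_null_comparison)
      show "\<forall>\<^sub>F n in sequentially. norm ((B v (X n - u))\<^sup>2) \<le> B v v * B (X n - u) (X n - u)"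
        using cauchy_schwarz[OF v diff_mem[OF X(1) u(1)]] by (intro always_eventually) simp
      show "(\<lambda>n. B v v * B (X n - u) (X n - u)) \<longlonglongrightarrow> 0"
        using tendsto_mult[OF tendsto_const u(2)] by simp
    qed
    then have 2: "(\<lambda>n. B v (X n - u)) \<longlonglongrightarrow> 0" by (rule tendsto_zero_if_power2)
    from tendsto_diff[OF 1 2] have "(\<lambda>n. B v u - F v) \<longlonglongrightarrow> 0"
      using v X(1) u(1) by (simp add: diff_right)
    then show ?thesis using LIMSEQ_unique[OF tendsto_const] by fastforce
  qed
  then show ?thesis using u(1) by blast
qed

end

lemma closed_real_form_inner:
  fixes R :: "'a::{real_inner, complete_space} set"
  assumes "0 \<in> R" "\<And>u v. u \<in> R \<Longrightarrow> v \<in> R \<Longrightarrow> u + v \<in> R" "\<And>c u. u \<in> R \<Longrightarrow> c *\<^sub>R u \<in> R"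
    and "closed R"
  shows "closed_real_form R (\<bullet>)"
proof
  fix X :: "nat \<Rightarrow> 'a"
  assume X: "\<And>n. X n \<in> R"
    and cauchy: "\<And>e. e > 0 \<Longrightarrow> \<exists>N. \<forall>m\<ge>N. \<forall>n\<ge>N. (X m - X n) \<bullet> (X m - X n) < e"
  have "Cauchy X"
  proof (rule CauchyI)
    fix \<delta> :: real assume "0 < \<delta>"
    then obtain N where "\<forall>m\<ge>N. \<forall>n\<ge>N. (X m - X n) \<bullet> (X m - X n) < \<delta>\<^sup>2"
      using cauchy[of "\<delta>\<^sup>2"] by auto
    then have "\<forall>m\<ge>N. \<forall>n\<ge>N. norm (X m - X n) < \<delta>"
      using \<open>0 < \<delta>\<close> by (auto simp: power2_norm_eq_inner[symmetric] intro: power2_less_imp_less)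
    then show "\<exists>M. \<forall>m\<ge>M. \<forall>n\<ge>M. norm (X m - X n) < \<delta>" by blast
  qed
  then obtain f where f: "X \<longlonglongrightarrow> f" using Cauchy_convergent convergent_def by blast
  then have "f \<in> R" by (rule closed_sequentially[OF assms(4) X])
  moreover have "(\<lambda>n. (X n - f) \<bullet> (X n - f)) \<longlonglongrightarrow> 0"
    using tendsto_inner[OF LIM_zero[OF f] LIM_zero[OF f]] by simp
  ultimately show "\<exists>f\<in>R. (\<lambda>n. (X n - f) \<bullet> (X n - f)) \<longlonglongrightarrow> 0" by blast
qed (simp_all add: assms inner_add_right, rule inner_commute)

text \<open>If the form represents every bounded functional, then \<open>K = (H + \<kappa>)\<inverse>\<close> has norm at most
  \<open>1/\<kappa>\<close>, and \<open>(H + \<kappa> - \<i> \<mu>) u = f\<close> is the fixed point equation of the contraction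
  \<open>u \<mapsto> K (f + \<i> \<mu> u)\<close>.\<close>

lemma shifted_equation_solvable:
  fixes f :: "'a::euclidean_space L2"
  assumes K: "\<And>g. K g \<in> D \<and> (\<forall>v\<in>D. B v (K g) = Re (cinner v g))"
    and contr: "\<And>g h. norm (K g - K h) \<le> norm (g - h) / \<kappa>"
    and \<mu>: "\<bar>\<mu>\<bar> < \<kappa>"
  shows "\<exists>u\<in>D. \<forall>v\<in>D. B v u = Re (cinner v (f + (\<i> * complex_of_real \<mu>) *\<^sub>C u))"
proof -
  let ?T = "\<lambda>u. K (f + (\<i> * complex_of_real \<mu>) *\<^sub>C u)"
  have "dist (?T u) (?T v) \<le> \<bar>\<mu>\<bar> / \<kappa> * dist u v" for u v
    using contr[of "f + (\<i> * complex_of_real \<mu>) *\<^sub>C u" "f + (\<i> * complex_of_real \<mu>) *\<^sub>C v"]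
    by (simp add: dist_norm scaleC_diff_right[symmetric] norm_scaleC norm_mult)
  moreover have "0 \<le> \<bar>\<mu>\<bar> / \<kappa>" "\<bar>\<mu>\<bar> / \<kappa> < 1" using \<mu> by auto
  ultimately obtain u where "?T u = u" using banach_fix_type[of "\<bar>\<mu>\<bar> / \<kappa>" ?T] by blast
  then show ?thesis using K by metis
qed

section \<open>Sesquilinear forms with bounded coefficients\<close>

lemma coefficient_matrix_Linfty: "coefficient_matrix A \<Longrightarrow> Linfty (\<lambda>x. A x $ i $ j)"
  by (simp add: coefficient_matrix_def)

lemma h_form_cinner:
  assumes "coefficient_matrix A"
  shows "h_form A v u = (\<Sum>i\<in>UNIV. \<Sum>j\<in>UNIV. cinner (wderiv i v) (mulL (\<lambda>x. A x $ i $ j) (wderiv j u)))"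
  unfolding h_form_def cinner_mulL_right[OF coefficient_matrix_Linfty[OF assms]] ..

lemma h_form_hermitian:
  assumes A: "coefficient_matrix A"
  shows "h_form A v u = cnj (h_form A u v)"
proof -
  have sym: "mulL (\<lambda>x. A x $ i $ j) g = mulL (\<lambda>x. A x $ j $ i) g" for i j g
  proof (rule L2_eqI)
    have "AE x in lebesgue. transpose (A x) = A x" using A by (auto simp: coefficient_matrix_def)
    then have "AE x in lebesgue. A x $ i $ j = A x $ j $ i"
      by eventually_elim (metis transpose_def vec_lambda_beta)
    with L2_fun_mulL[OF coefficient_matrix_Linfty[OF A], of i j g]
      L2_fun_mulL[OF coefficient_matrix_Linfty[OF A], of j i g]
    show "AE x in lebesgue. L2_fun (mulL (\<lambda>x. A x $ i $ j) g) x = L2_fun (mulL (\<lambda>x. A x $ j $ i) g) x"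
      by eventually_elim simp
  qed
  have "cinner (wderiv i v) (mulL (\<lambda>x. A x $ i $ j) (wderiv j u))
      = cnj (cinner (wderiv j u) (mulL (\<lambda>x. A x $ j $ i) (wderiv i v)))" for i j
  proof -
    have "cinner (wderiv i v) (mulL (\<lambda>x. A x $ i $ j) (wderiv j u))
        = cinner (mulL (\<lambda>x. A x $ i $ j) (wderiv i v)) (wderiv j u)"
      by (rule cinner_mulL_commute[symmetric]) (rule coefficient_matrix_Linfty[OF A])
    also have "\<dots> = cinner (mulL (\<lambda>x. A x $ j $ i) (wderiv i v)) (wderiv j u)"
      using sym[of i j "wderiv i v"] by (rule arg_cong)
    also have "\<dots> = cnj (cinner (wderiv j u) (mulL (\<lambda>x. A x $ j $ i) (wderiv i v)))"
      by (rule cinner_cnj)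
    finally show ?thesis .
  qed
  then show ?thesis
    unfolding h_form_cinner[OF A] by (subst sum.swap) simp
qed

lemma h_form_linear:
  assumes A: "coefficient_matrix A" and "v \<in> W12" "u \<in> W12" "u' \<in> W12"
  shows "h_form A v (u + u') = h_form A v u + h_form A v u'"
    and "h_form A v (c *\<^sub>C u) = c * h_form A v u"
    and "h_form A (c *\<^sub>C v) u = cnj c * h_form A v u"
  using assms
  by (simp_all add: h_form_cinner[OF A] wderiv_add wderiv_scaleC mulL_add mulL_scaleC
      coefficient_matrix_Linfty cinner_simps sum.distrib sum_distrib_left)

lemma h_form_eq_integral:
  assumes A: "coefficient_matrix A"
  shows "integrable lebesgue (\<lambda>x. \<Sum>i\<in>UNIV. \<Sum>j\<in>UNIV.
      cnj (L2_fun (wderiv i v) x) * (complex_of_real (A x $ i $ j) * L2_fun (wderiv j u) x))"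
    and "h_form A v u = (LINT x|lebesgue. (\<Sum>i\<in>UNIV. \<Sum>j\<in>UNIV.
      cnj (L2_fun (wderiv i v) x) * (complex_of_real (A x $ i $ j) * L2_fun (wderiv j u) x)))"
proof -
  have int: "integrable lebesgue
      (\<lambda>x. cnj (L2_fun (wderiv i v) x) * (complex_of_real (A x $ i $ j) * L2_fun (wderiv j u) x))" for i j
    by (intro integrable_cnj_mult square_integrable_mult_Linfty coefficient_matrix_Linfty A square_integrable_L2_fun)
  show "integrable lebesgue (\<lambda>x. \<Sum>i\<in>UNIV. \<Sum>j\<in>UNIV.
      cnj (L2_fun (wderiv i v) x) * (complex_of_real (A x $ i $ j) * L2_fun (wderiv j u) x))"
    by (intro Bochner_Integration.integrable_sum int)
  show "h_form A v u = (LINT x|lebesgue. (\<Sum>i\<in>UNIV. \<Sum>j\<in>UNIV.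
      cnj (L2_fun (wderiv i v) x) * (complex_of_real (A x $ i $ j) * L2_fun (wderiv j u) x)))"
    unfolding h_form_def
    by (subst Bochner_Integration.integral_sum, intro Bochner_Integration.integrable_sum int,
        subst Bochner_Integration.integral_sum, intro int, rule refl)
qed

lemma inner_matrix_vector:
  fixes a b :: "real^'n"
  shows "a \<bullet> (M *v b) = (\<Sum>i\<in>UNIV. \<Sum>j\<in>UNIV. a $ i * (M $ i $ j * b $ j))"
  by (simp add: inner_vec_def matrix_vector_mult_def sum_distrib_left)

text \<open>The terms that are linear in \<open>w\<close> cancel by the symmetry of \<open>M\<close>, up to an imaginary remainder.\<close>

lemma Re_twisted_form_ge:
  fixes M :: "real^'n^'n" and p :: "'n \<Rightarrow> complex" and w :: "'n \<Rightarrow> real"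
  assumes "transpose M = M" and psd: "\<And>v. 0 \<le> v \<bullet> (M *v v)"
  shows "- ((cmod z)\<^sup>2 * (\<Sum>i\<in>UNIV. \<Sum>j\<in>UNIV. M $ i $ j * w i * w j)) \<le>
    Re (\<Sum>i\<in>UNIV. \<Sum>j\<in>UNIV. cnj (p i + complex_of_real (w i) * z) *
      (complex_of_real (M $ i $ j) * (p j - complex_of_real (w j) * z)))"
proof -
  define W where "W = (\<chi> i. w i)"
  define a where "a = (\<chi> i. Re (p i))"
  define b where "b = (\<chi> i. Im (p i))"
  have quad: "(a + s *\<^sub>R W) \<bullet> (M *v (a - s *\<^sub>R W)) = a \<bullet> (M *v a) - s\<^sup>2 * (W \<bullet> (M *v W))" for a s
  proof -
    have "W \<bullet> (M *v a) = a \<bullet> (M *v W)"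
      using assms(1) by (metis dot_lmul_matrix inner_commute transpose_matrix_vector)
    then show ?thesis
      by (simp add: matrix_vector_mult_diff_distrib matrix_vector_mult_scaleR inner_add_left
          inner_diff_right power2_eq_square algebra_simps)
  qed
  have "Re (cnj (p i + complex_of_real (w i) * z) * (complex_of_real (M $ i $ j) * (p j - complex_of_real (w j) * z)))
     = (a + Re z *\<^sub>R W) $ i * (M $ i $ j * (a - Re z *\<^sub>R W) $ j)
     + (b + Im z *\<^sub>R W) $ i * (M $ i $ j * (b - Im z *\<^sub>R W) $ j)" for i j
    by (simp add: a_def b_def W_def algebra_simps)
  then have "Re (\<Sum>i\<in>UNIV. \<Sum>j\<in>UNIV. cnj (p i + complex_of_real (w i) * z) *
      (complex_of_real (M $ i $ j) * (p j - complex_of_real (w j) * z)))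
    = (a + Re z *\<^sub>R W) \<bullet> (M *v (a - Re z *\<^sub>R W)) + (b + Im z *\<^sub>R W) \<bullet> (M *v (b - Im z *\<^sub>R W))"
    unfolding inner_matrix_vector Re_sum by (simp add: sum.distrib)
  also have "\<dots> = a \<bullet> (M *v a) - (Re z)\<^sup>2 * (W \<bullet> (M *v W)) + (b \<bullet> (M *v b) - (Im z)\<^sup>2 * (W \<bullet> (M *v W)))"
    by (simp only: quad)
  also have "W \<bullet> (M *v W) = (\<Sum>i\<in>UNIV. \<Sum>j\<in>UNIV. M $ i $ j * w i * w j)"
    unfolding inner_matrix_vector by (simp add: W_def mult_ac)
  finally show ?thesis using psd[of a] psd[of b] by (simp add: cmod_power2 algebra_simps)
qed

lemma h_form_exp_weight_ge:
  assumes A: "coefficient_matrix A" and w: "w \<in> test_functions" and u: "u \<in> W12"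
    and q: "AE x in lebesgue. (\<Sum>i\<in>UNIV. \<Sum>j\<in>UNIV. A x $ i $ j * partial_deriv i w x * partial_deriv j w x) \<le> q"
  shows "- (q * (norm (mulL (\<lambda>x. exp (w x)) u))\<^sup>2)
    \<le> Re (h_form A (mulL (\<lambda>x. exp (w x)) (mulL (\<lambda>x. exp (w x)) u)) u)"
proof -
  let ?e = "\<lambda>x. exp (w x)"
  define U where "U = mulL ?e u"
  define v where "v = mulL ?e U"
  have dw: "Linfty (partial_deriv i w)" for i
    by (intro test_functions_Linfty test_functions_partial_deriv w)
  have U: "U \<in> W12" unfolding U_def by (rule W12I) (rule weak_partial_exp[OF w u])
  have dU: "wderiv i U = mulL ?e (wderiv i u + mulL (partial_deriv i w) u)" for i
    unfolding U_def by (intro wderiv_eq weak_partial_exp w u)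
  have dv: "wderiv i v = mulL ?e (wderiv i U + mulL (partial_deriv i w) U)" for i
    unfolding v_def by (intro wderiv_eq weak_partial_exp w U)
  have expand: "AE x in lebesgue. L2_fun (mulL ?e (wderiv i y + mulL (partial_deriv i w) y)) x
      = exp (w x) * (L2_fun (wderiv i y) x + partial_deriv i w x * L2_fun y x)" for i y
    using L2_fun_mulL[OF exp_test(2)[OF w], of "wderiv i y + mulL (partial_deriv i w) y"]
      L2_fun_plus[of "wderiv i y" "mulL (partial_deriv i w) y"] L2_fun_mulL[OF dw, of i y]
    by eventually_elim simp
  have "AE x in lebesgue. \<forall>i. L2_fun (wderiv i U) x = exp (w x) * (L2_fun (wderiv i u) x + partial_deriv i w x * L2_fun u x)"
    unfolding dU by (rule eventually_all_finite) (rule expand)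
  moreover have "AE x in lebesgue. \<forall>i. L2_fun (wderiv i v) x = exp (w x) * (L2_fun (wderiv i U) x + partial_deriv i w x * L2_fun U x)"
    unfolding dv by (rule eventually_all_finite) (rule expand)
  moreover have "AE x in lebesgue. L2_fun U x = exp (w x) * L2_fun u x"
    unfolding U_def by (rule L2_fun_mulL[OF exp_test(2)[OF w]])
  moreover have "AE x in lebesgue. transpose (A x) = A x \<and> (\<forall>v. 0 \<le> v \<bullet> (A x *v v))"
    using A by (simp add: coefficient_matrix_def)
  ultimately have pw: "AE x in lebesgue. - (q * (cmod (L2_fun U x))\<^sup>2) \<le> Re (\<Sum>i\<in>UNIV. \<Sum>j\<in>UNIV.
      cnj (L2_fun (wderiv i v) x) * (complex_of_real (A x $ i $ j) * L2_fun (wderiv j u) x))"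
    using q
  proof eventually_elim
    case (elim x)
    define p where "p i = L2_fun (wderiv i U) x" for i
    define d where "d i = partial_deriv i w x" for i
    define z where "z = L2_fun U x"
    have 1: "cnj (L2_fun (wderiv i v) x) * (complex_of_real (A x $ i $ j) * L2_fun (wderiv j u) x)
      = cnj (p i + complex_of_real (d i) * z) * (complex_of_real (A x $ i $ j) * (p j - complex_of_real (d j) * z))" for i j
    proof -
      have "p j - complex_of_real (d j) * z = exp (w x) * L2_fun (wderiv j u) x"
        using elim(1,3) by (simp add: p_def d_def z_def algebra_simps)
      moreover have "L2_fun (wderiv i v) x = exp (w x) * (p i + complex_of_real (d i) * z)"
        using elim(2) by (simp add: p_def d_def z_def)
      ultimately show ?thesis by simp
    qed
    have "- (q * (cmod z)\<^sup>2) \<le> - ((cmod z)\<^sup>2 * (\<Sum>i\<in>UNIV. \<Sum>j\<in>UNIV. A x $ i $ j * d i * d j))"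
      using mult_left_mono[OF elim(5), of "(cmod z)\<^sup>2"] by (simp add: d_def mult.commute)
    also have "\<dots> \<le> Re (\<Sum>i\<in>UNIV. \<Sum>j\<in>UNIV. cnj (p i + complex_of_real (d i) * z) *
      (complex_of_real (A x $ i $ j) * (p j - complex_of_real (d j) * z)))"
      by (rule Re_twisted_form_ge) (use elim(4) in auto)
    finally show ?case unfolding 1 z_def .
  qed
  have "- (q * (norm U)\<^sup>2) = (LINT x|lebesgue. - (q * (cmod (L2_fun U x))\<^sup>2))"
    by (simp add: norm_L2_power2)
  also have "\<dots> \<le> (LINT x|lebesgue. Re (\<Sum>i\<in>UNIV. \<Sum>j\<in>UNIV.
      cnj (L2_fun (wderiv i v) x) * (complex_of_real (A x $ i $ j) * L2_fun (wderiv j u) x)))"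
    using pw h_form_eq_integral(1)[OF A, of v u] square_integrable_L2_fun[of U]
    by (intro integral_mono_AE) (auto simp: square_integrable_def simp del: Re_sum)
  also have "\<dots> = Re (h_form A v u)"
    unfolding h_form_eq_integral(2)[OF A] using h_form_eq_integral(1)[OF A]
    by (rule integral_Re)
  finally show ?thesis by (simp add: U_def v_def)
qed

lemma Re_h_form_nonneg:
  assumes A: "coefficient_matrix A"
  shows "0 \<le> Re (h_form A u u)"
proof -
  have "0 \<le> (LINT x|lebesgue. Re (\<Sum>i\<in>UNIV. \<Sum>j\<in>UNIV.
      cnj (L2_fun (wderiv i u) x) * (complex_of_real (A x $ i $ j) * L2_fun (wderiv j u) x)))"
  proof (rule integral_nonneg_AE)
    have "AE x in lebesgue. transpose (A x) = A x \<and> (\<forall>v. 0 \<le> v \<bullet> (A x *v v))"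
      using A by (simp add: coefficient_matrix_def)
    then show "AE x in lebesgue. 0 \<le> Re (\<Sum>i\<in>UNIV. \<Sum>j\<in>UNIV.
      cnj (L2_fun (wderiv i u) x) * (complex_of_real (A x $ i $ j) * L2_fun (wderiv j u) x))"
    proof eventually_elim
      case (elim x)
      then show ?case
        using Re_twisted_form_ge[of "A x" 0 "\<lambda>_. 0" "\<lambda>i. L2_fun (wderiv i u) x"] by simp
    qed
  qed
  also have "\<dots> = Re (h_form A u u)"
    unfolding h_form_eq_integral(2)[OF A] using h_form_eq_integral(1)[OF A]
    by (rule integral_Re)
  finally show ?thesis .
qed

section \<open>The regularised operators\<close>

definition reg_matrix :: "(real^'n::finite \<Rightarrow> real^'n^'n) \<Rightarrow> real \<Rightarrow> real^'n \<Rightarrow> real^'n^'n" where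
  "reg_matrix C e x = C x + e *\<^sub>R mat 1"

lemma reg_matrix_nth: "reg_matrix C e x $ i $ j = C x $ i $ j + (if i = j then e else 0)"
  by (simp add: reg_matrix_def mat_def)

lemma reg_matrix_vector: "reg_matrix C e x *v v = C x *v v + e *\<^sub>R v"
  by (simp add: reg_matrix_def matrix_vector_mult_add_rdistrib scaleR_matrix_vector_assoc[symmetric])

lemma coefficient_matrix_reg:
  assumes C: "coefficient_matrix C" and e: "0 \<le> e"
  shows "coefficient_matrix (reg_matrix C e)"
  unfolding coefficient_matrix_def
proof (intro conjI allI)
  show "Linfty (\<lambda>x. reg_matrix C e x $ i $ j)" for i j
    unfolding reg_matrix_nth by (intro Linfty_add Linfty_const coefficient_matrix_Linfty C)
  have "AE x in lebesgue. transpose (C x) = C x \<and> (\<forall>v. 0 \<le> v \<bullet> (C x *v v))"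
    using C by (simp add: coefficient_matrix_def)
  then show "AE x in lebesgue. transpose (reg_matrix C e x) = reg_matrix C e x
      \<and> (\<forall>v. 0 \<le> v \<bullet> (reg_matrix C e x *v v))"
  proof eventually_elim
    case (elim x)
    then have "\<And>i j. C x $ i $ j = C x $ j $ i" by (metis transpose_def vec_lambda_beta)
    then have "transpose (reg_matrix C e x) = reg_matrix C e x"
      by (auto simp: vec_eq_iff transpose_def reg_matrix_nth)
    then show ?case using elim e by (auto simp: reg_matrix_vector inner_add_right)
  qed
qed

lemma h_form_reg:
  assumes C: "coefficient_matrix C" and e: "0 \<le> e"
  shows "h_form (reg_matrix C e) v u = h_form C v u + complex_of_real e * l_form v u"
proof -
  have "mulL (\<lambda>x. reg_matrix C e x $ i $ j) g = mulL (\<lambda>x. C x $ i $ j) g + (if i = j then e else 0) *\<^sub>R g" for i j g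
  proof (rule L2_eqI)
    show "AE x in lebesgue. L2_fun (mulL (\<lambda>x. reg_matrix C e x $ i $ j) g) x
      = L2_fun (mulL (\<lambda>x. C x $ i $ j) g + (if i = j then e else 0) *\<^sub>R g) x"
      using L2_fun_mulL[OF coefficient_matrix_Linfty[OF coefficient_matrix_reg[OF C e]], of i j g]
        L2_fun_mulL[OF coefficient_matrix_Linfty[OF C], of i j g]
        L2_fun_plus[of "mulL (\<lambda>x. C x $ i $ j) g" "(if i = j then e else 0) *\<^sub>R g"]
        L2_fun_scaleR[of "if i = j then e else 0" g]
      by eventually_elim (simp add: reg_matrix_nth algebra_simps)
  qed
  then have "cinner (wderiv i v) (mulL (\<lambda>x. reg_matrix C e x $ i $ j) (wderiv j u))
      = cinner (wderiv i v) (mulL (\<lambda>x. C x $ i $ j) (wderiv j u))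
        + (if i = j then complex_of_real e * cinner (wderiv i v) (wderiv j u) else 0)" for i j
    by (simp only: cinner_simps) auto
  then show ?thesis
    unfolding h_form_cinner[OF coefficient_matrix_reg[OF C e]] h_form_cinner[OF C] l_form_def
    by (simp add: sum.distrib sum_distrib_left sum.delta)
qed

lemma H_eps_eq:
  assumes "coefficient_matrix C" "0 \<le> e"
  shows "H_eps C e = form_operator W12 (h_form (reg_matrix C e))"
proof -
  have "h_form (reg_matrix C e) = (\<lambda>v u. h_form C v u + complex_of_real e * l_form v u)"
    by (intro ext h_form_reg assms)
  then show ?thesis by (simp add: H_eps_def)
qed

lemma Re_l_form: "Re (l_form u u) = (\<Sum>i\<in>UNIV. (norm (wderiv i u))\<^sup>2)"
  by (simp add: l_form_def cinner_norm)

lemma Re_h_form_reg_ge: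
  assumes "coefficient_matrix C" "0 \<le> e"
  shows "e * (norm (wderiv i u))\<^sup>2 \<le> Re (h_form (reg_matrix C e) u u)"
proof -
  have "(norm (wderiv i u))\<^sup>2 \<le> (\<Sum>i\<in>UNIV. (norm (wderiv i u))\<^sup>2)"
    by (rule member_le_sum) auto
  then have "e * (norm (wderiv i u))\<^sup>2 \<le> e * Re (l_form u u)"
    unfolding Re_l_form using assms(2) by (rule mult_left_mono)
  then show ?thesis using Re_h_form_nonneg[OF assms(1), of u] by (simp add: h_form_reg[OF assms])
qed

lemma W12_form_complete:
  fixes C :: "real^'n::finite \<Rightarrow> real^'n^'n"
  assumes C: "coefficient_matrix C" and e: "0 < e" and k: "0 < \<kappa>"
  shows "closed_real_form W12 (\<lambda>v u. Re (h_form (reg_matrix C e) v u) + \<kappa> * Re (cinner v u))"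
proof -
  define A where "A = reg_matrix C e"
  have A: "coefficient_matrix A" unfolding A_def using C e by (simp add: coefficient_matrix_reg)
  define B where "B v u = Re (h_form A v u) + \<kappa> * Re (cinner v u)" for v u
  have B_norm: "\<kappa> * (norm u)\<^sup>2 \<le> B u u" for u
    using Re_h_form_nonneg[OF A, of u] by (simp add: B_def cinner_norm)
  have B_wderiv: "e * (norm (wderiv i u))\<^sup>2 \<le> B u u" for u i
    using Re_h_form_reg_ge[OF C, of e i u] e mult_nonneg_nonneg[OF less_imp_le[OF k] zero_le_power2[of "norm u"]]
    by (simp add: B_def cinner_norm A_def)
  have "closed_real_form W12 B"
  proof
    fix u v :: "(real^'n) L2" assume uv: "u \<in> W12" "v \<in> W12"
    show "B u v = B v u"
      using h_form_hermitian[OF A, of u v] cinner_cnj[of u v] by (simp add: B_def)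
    show "B u (c *\<^sub>R v) = c * B u v" for c
      using h_form_linear(2)[OF A uv(1,2) uv(2), of "complex_of_real c"]
      by (simp add: B_def cinner_simps algebra_simps scaleC_of_real)
    show "B u (v + w) = B u v + B u w" if "w \<in> W12" for w
      using h_form_linear(1)[OF A uv(1,2) that]
      by (simp add: B_def cinner_simps algebra_simps)
  next
    fix u :: "(real^'n) L2" show "0 \<le> B u u"
      using Re_h_form_nonneg[OF A, of u] k by (simp add: B_def cinner_norm)
  next
    fix X :: "nat \<Rightarrow> (real^'n) L2"
    assume X: "\<And>n. X n \<in> W12" and cauchy: "\<And>e. e > 0 \<Longrightarrow> \<exists>N. \<forall>m\<ge>N. \<forall>n\<ge>N. B (X m - X n) (X m - X n) < e"
    have conv: "convergent Y" if Y: "\<And>m n. c * (norm (Y m - Y n))\<^sup>2 \<le> B (X m - X n) (X m - X n)" and c: "0 < c"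
      for Y :: "nat \<Rightarrow> (real^'n) L2" and c
    proof -
      have "Cauchy Y"
      proof (rule CauchyI)
        fix \<delta> :: real assume "0 < \<delta>"
        then obtain N where N: "\<forall>m\<ge>N. \<forall>n\<ge>N. B (X m - X n) (X m - X n) < c * \<delta>\<^sup>2"
          using cauchy[of "c * \<delta>\<^sup>2"] c by auto
        have "norm (Y m - Y n) < \<delta>" if "m \<ge> N" "n \<ge> N" for m n
        proof -
          have "c * (norm (Y m - Y n))\<^sup>2 < c * \<delta>\<^sup>2" using Y[of m n] N that by (meson le_less_trans)
          then show ?thesis using c \<open>0 < \<delta>\<close> by (simp add: power2_less_imp_less)
        qed
        then show "\<exists>M. \<forall>m\<ge>M. \<forall>n\<ge>M. norm (Y m - Y n) < \<delta>" by blast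
      qed
      then show ?thesis by (rule Cauchy_convergent)
    qed
    have "convergent X" by (rule conv[OF B_norm k])
    then obtain u where u: "X \<longlonglongrightarrow> u" by (auto simp: convergent_def)
    have "convergent (\<lambda>n. wderiv i (X n))" for i
      by (rule conv[of e]) (use B_wderiv[of i "X _ - X _"] X e in \<open>auto simp: wderiv_diff\<close>)
    then obtain g where g: "\<And>i. (\<lambda>n. wderiv i (X n)) \<longlonglongrightarrow> g i" unfolding convergent_def by metis
    have wp: "weak_partial i u (g i)" for i
      by (rule weak_partial_closed[OF _ u g])
         (auto intro!: always_eventually weak_partial_wderiv X)
    then have uW: "u \<in> W12" by (rule W12I)
    have null: "(\<lambda>n. X n - u) \<longlonglongrightarrow> 0" using u by (rule LIM_zero)
    have dnull: "(\<lambda>n. wderiv i (X n - u)) \<longlonglongrightarrow> 0" for i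
      using LIM_zero[OF g[of i]] wderiv_eq[OF wp[of i]] by (simp add: wderiv_diff X uW)
    have "(\<lambda>n. B (X n - u) (X n - u)) \<longlonglongrightarrow> Re (\<Sum>i\<in>UNIV. \<Sum>j\<in>UNIV. cinner 0 (mulL (\<lambda>x. A x $ i $ j) 0)) + \<kappa> * Re (cinner 0 (0 :: (real^'n) L2))"
      unfolding B_def h_form_cinner[OF A]
      by (intro tendsto_intros tendsto_sum tendsto_cinner tendsto_mulL coefficient_matrix_Linfty A null dnull)
    then have "(\<lambda>n. B (X n - u) (X n - u)) \<longlonglongrightarrow> 0" by simp
    then show "\<exists>u\<in>W12. (\<lambda>n. B (X n - u) (X n - u)) \<longlonglongrightarrow> 0" using uW by blast
  qed (auto intro: W12_zero W12_add W12_scaleR)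
  then show ?thesis by (simp add: B_def[abs_def] A_def)
qed

lemma H_eps_resolvent_exists:
  fixes f :: "(real^'n::finite) L2"
  assumes C: "coefficient_matrix C" and e: "0 < e" and z: "\<bar>Im z\<bar> < - Re z"
  shows "\<exists>u\<in>W12. \<forall>v\<in>W12. h_form (reg_matrix C e) v u = cinner v (f + z *\<^sub>C u)"
proof -
  define A where "A = reg_matrix C e"
  have A: "coefficient_matrix A" unfolding A_def using C e by (simp add: coefficient_matrix_reg)
  define \<kappa> where "\<kappa> = - Re z"
  have k: "0 < \<kappa>" using z by (simp add: \<kappa>_def)
  define B where "B v u = Re (h_form A v u) + \<kappa> * Re (cinner v u)" for v u
  interpret closed_real_form W12 B
    using W12_form_complete[OF C e k] by (simp add: B_def[abs_def] A_def)
  have B_norm: "\<kappa> * (norm u)\<^sup>2 \<le> B u u" for u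
    using Re_h_form_nonneg[OF A, of u] by (simp add: B_def cinner_norm)
  have "\<exists>u\<in>W12. \<forall>v\<in>W12. B v u = Re (cinner v g)" for g :: "(real^'n) L2"
  proof (rule riesz)
    fix u :: "(real^'n) L2" assume u: "u \<in> W12"
    show "Re (cinner (c *\<^sub>R u) g) = c * Re (cinner u g)" for c by (simp add: cinner_simps)
    show "Re (cinner (u + v) g) = Re (cinner u g) + Re (cinner v g)" for v by (simp add: cinner_simps)
    have "sqrt \<kappa> * norm u \<le> sqrt (B u u)"
      using real_sqrt_le_mono[OF B_norm[of u]] k by (simp add: real_sqrt_mult)
    then have "norm u \<le> sqrt (B u u) / sqrt \<kappa>" using k by (simp add: field_simps)
    then have "norm u * norm g \<le> norm g / sqrt \<kappa> * sqrt (B u u)"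
      using mult_left_mono[of "norm u" "sqrt (B u u) / sqrt \<kappa>" "norm g"] by (simp add: mult.commute)
    then show "\<bar>Re (cinner u g)\<bar> \<le> norm g / sqrt \<kappa> * sqrt (B u u)"
      using abs_Re_le_cmod[of "cinner u g"] norm_cinner_le[of u g] by linarith
  qed
  then obtain K where K: "\<And>g. K g \<in> W12 \<and> (\<forall>v\<in>W12. B v (K g) = Re (cinner v g))" by metis
  have contr: "norm (K g - K h) \<le> norm (g - h) / \<kappa>" for g h
  proof -
    let ?d = "K g - K h"
    have d: "?d \<in> W12" using K by (intro diff_mem) auto
    have "\<kappa> * (norm ?d)\<^sup>2 \<le> B ?d ?d" by (rule B_norm)
    also have "\<dots> = Re (cinner ?d (g - h))"
      using K d by (simp add: diff_right cinner_simps)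
    also have "\<dots> \<le> norm ?d * norm (g - h)"
      using abs_Re_le_cmod[of "cinner ?d (g - h)"] norm_cinner_le[of ?d "g - h"] by linarith
    finally have "norm ?d * (\<kappa> * norm ?d) \<le> norm ?d * norm (g - h)" by (simp add: power2_eq_square mult_ac)
    then have "\<kappa> * norm ?d \<le> norm (g - h)"
      by (cases "norm ?d = 0") (auto simp: mult_le_cancel_left)
    then show ?thesis using k by (simp add: field_simps)
  qed
  obtain u where u: "u \<in> W12" "\<And>v. v \<in> W12 \<Longrightarrow> B v u = Re (cinner v (f + (\<i> * complex_of_real (Im z)) *\<^sub>C u))"
    using shifted_equation_solvable[OF K contr, of "Im z" f] z by (auto simp: \<kappa>_def)
  have zk: "z = - complex_of_real \<kappa> + \<i> * complex_of_real (Im z)" by (simp add: complex_eq_iff \<kappa>_def)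
  have Re: "Re (h_form A v u) = Re (cinner v (f + z *\<^sub>C u))" if "v \<in> W12" for v
    using u(2)[OF that] by (subst zk) (simp add: B_def cinner_simps algebra_simps)
  have "h_form A v u = cinner v (f + z *\<^sub>C u)" if v: "v \<in> W12" for v
  proof -
    have "Im (h_form A v u) = Im (cinner v (f + z *\<^sub>C u))"
      using Re[OF W12_scaleC[OF v, of \<i>]] h_form_linear(3)[OF A v u(1) u(1), of \<i>]
      by (simp add: cinner_scaleC_left)
    with Re[OF v] show ?thesis by (simp add: complex_eq_iff)
  qed
  then show ?thesis using u(1) by (auto simp: A_def)
qed

lemma H_eps_resolvent:
  fixes f :: "(real^'n::finite) L2"
  assumes C: "coefficient_matrix C" and e: "0 < e" and z: "\<bar>Im z\<bar> < - Re z"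
  defines "u \<equiv> resolvent (H_eps C e) z f"
  shows "u \<in> W12" and "\<And>v. v \<in> W12 \<Longrightarrow> h_form (reg_matrix C e) v u = cinner v (f + z *\<^sub>C u)"
proof -
  have A: "coefficient_matrix (reg_matrix C e)" using C e by (simp add: coefficient_matrix_reg)
  let ?P = "\<lambda>u. u \<in> W12 \<and> (\<forall>v\<in>W12. h_form (reg_matrix C e) v u = cinner v (f + z *\<^sub>C u))"
  have "\<exists>!u. ?P u"
  proof (rule ex_ex1I)
    show "\<exists>u. ?P u" using H_eps_resolvent_exists[OF C e z] by blast
    fix u v assume uv: "?P u" "?P v"
    define d where "d = u + (-1) *\<^sub>C v"
    have d: "d \<in> W12" unfolding d_def using uv by (auto intro: W12_add W12_scaleC)
    have "h_form (reg_matrix C e) d d = z * cinner d d"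
      unfolding d_def using uv d[unfolded d_def]
        h_form_linear(1)[OF A _ _ W12_scaleC, of "u + (-1) *\<^sub>C v" u v "-1"]
        h_form_linear(2)[OF A d[unfolded d_def], of v v "-1"]
      by (simp add: cinner_simps algebra_simps)
    then have "Re z * (norm d)\<^sup>2 \<ge> 0" using Re_h_form_nonneg[OF A, of d] by (simp add: cinner_norm)
    moreover have "Re z * (norm d)\<^sup>2 < 0" if "d \<noteq> 0" using z that by (intro mult_neg_pos) auto
    ultimately have "d = 0" by force
    then show "u = v" by (simp add: d_def scaleC_minus_one)
  qed
  moreover have "u = (THE u. ?P u)"
    unfolding u_def resolvent_def using C e by (simp add: H_eps_eq form_operator_def)
  ultimately have "?P u" using theI'[of ?P] by simp
  then show "u \<in> W12" and "\<And>v. v \<in> W12 \<Longrightarrow> h_form (reg_matrix C e) v u = cinner v (f + z *\<^sub>C u)" by auto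
qed

text \<open>Agmon's method: test the resolvent equation with \<open>e\<^sup>2\<^sup>w u\<close>.\<close>

lemma H_eps_resolvent_weighted:
  assumes C: "coefficient_matrix C" and e: "0 < e" and z: "\<bar>Im z\<bar> < - Re z" and w: "w \<in> test_functions"
    and q: "AE x in lebesgue. (\<Sum>i\<in>UNIV. \<Sum>j\<in>UNIV. reg_matrix C e x $ i $ j * partial_deriv i w x * partial_deriv j w x) \<le> q"
  shows "(- Re z - q) * norm (mulL (\<lambda>x. exp (w x)) (resolvent (H_eps C e) z f)) \<le> norm (mulL (\<lambda>x. exp (w x)) f)"
proof -
  have A: "coefficient_matrix (reg_matrix C e)" using C e by (simp add: coefficient_matrix_reg)
  define u where "u = resolvent (H_eps C e) z f"
  note u = H_eps_resolvent[OF C e z, where f = f, folded u_def]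
  let ?m = "mulL (\<lambda>x. exp (w x))"
  define U where "U = ?m u"
  have L: "Linfty (\<lambda>x. exp (w x))" by (rule exp_test(2)[OF w])
  have "?m U \<in> W12" unfolding U_def
    by (rule W12I, rule weak_partial_exp[OF w], rule W12I, rule weak_partial_exp[OF w u(1)])
  then have "Re (h_form (reg_matrix C e) (?m U) u) = Re (cinner (?m U) f) + Re (z * cinner (?m U) u)"
    using u(2) by (simp add: cinner_simps)
  moreover have "cinner (?m U) u = complex_of_real ((norm U)\<^sup>2)"
    unfolding cinner_mulL_commute[OF L] by (simp add: U_def[symmetric] cinner_norm)
  moreover have "Re (cinner (?m U) f) \<le> norm U * norm (?m f)"
    unfolding cinner_mulL_commute[OF L]
    using abs_Re_le_cmod[of "cinner U (?m f)"] norm_cinner_le[of U "?m f"] by linarith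
  moreover have "- (q * (norm U)\<^sup>2) \<le> Re (h_form (reg_matrix C e) (?m U) u)"
    using h_form_exp_weight_ge[OF A w u(1) q] by (simp add: U_def)
  ultimately have "(- Re z - q) * (norm U)\<^sup>2 \<le> norm U * norm (?m f)"
    by (simp add: algebra_simps)
  then have "norm U * ((- Re z - q) * norm U) \<le> norm U * norm (?m f)"
    by (simp add: power2_eq_square mult_ac)
  then show ?thesis
    by (cases "norm U = 0") (auto simp: mult_le_cancel_left U_def u_def)
qed

section \<open>Positive self-adjoint operators\<close>

lemma self_adjoint_op_iff:
  "self_adjoint_op G \<Longrightarrow> (v, w) \<in> G \<longleftrightarrow> (\<forall>(u, f) \<in> G. cinner v f = cinner w u)"
  unfolding self_adjoint_op_def adjoint_op_def by blast

lemma self_adjoint_op_symmetric: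
  "self_adjoint_op G \<Longrightarrow> (v, w) \<in> G \<Longrightarrow> (u, f) \<in> G \<Longrightarrow> cinner v f = cinner w u"
  using self_adjoint_op_iff[of G v w] by blast

lemma self_adjoint_op_add:
  assumes "self_adjoint_op G" "(u, f) \<in> G" "(v, g) \<in> G" shows "(u + v, f + g) \<in> G"
  unfolding self_adjoint_op_iff[OF assms(1)]
  using self_adjoint_op_symmetric[OF assms(1,2)] self_adjoint_op_symmetric[OF assms(1,3)]
  by (auto simp: cinner_simps)

lemma self_adjoint_op_scaleC:
  assumes "self_adjoint_op G" "(u, f) \<in> G" shows "(c *\<^sub>C u, c *\<^sub>C f) \<in> G"
  unfolding self_adjoint_op_iff[OF assms(1)]
  using self_adjoint_op_symmetric[OF assms] by (auto simp: cinner_simps)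

lemma self_adjoint_op_diff:
  "self_adjoint_op G \<Longrightarrow> (u, f) \<in> G \<Longrightarrow> (v, g) \<in> G \<Longrightarrow> (u - v, f - g) \<in> G"
  using self_adjoint_op_add[of G u f "- v" "- g"] self_adjoint_op_scaleC[of G v g "-1"]
  by (simp add: scaleC_minus_one)

lemma self_adjoint_op_zero: "self_adjoint_op G \<Longrightarrow> (0, 0) \<in> G"
  by (subst self_adjoint_op_iff) auto

lemma self_adjoint_op_closed:
  assumes G: "self_adjoint_op G" and X: "X \<longlonglongrightarrow> u" "Y \<longlonglongrightarrow> f" "\<And>n::nat. (X n, Y n) \<in> G"
  shows "(u, f) \<in> G"
  unfolding self_adjoint_op_iff[OF G]
proof safe
  fix v g assume vg: "(v, g) \<in> G"
  have "(\<lambda>n. cinner (X n) g) \<longlonglongrightarrow> cinner u g" by (intro tendsto_cinner X tendsto_const)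
  moreover have "(\<lambda>n. cinner (X n) g) \<longlonglongrightarrow> cinner f v"
  proof -
    have "cinner (X n) g = cinner (Y n) v" for n
      using X(3)[of n] vg unfolding self_adjoint_op_iff[OF G, of "X n" "Y n"] by auto
    then show ?thesis by (simp add: tendsto_cinner X tendsto_const)
  qed
  ultimately show "cinner u g = cinner f v" by (rule LIMSEQ_unique)
qed

lemma positive_op_bound:
  assumes "positive_op G" "(u, f + z *\<^sub>C u) \<in> G"
  shows "- Re z * norm u \<le> norm f"
proof -
  have "0 \<le> Re (cinner u (f + z *\<^sub>C u))" using assms by (auto simp: positive_op_def)
  then have "- Re z * (norm u)\<^sup>2 \<le> Re (cinner u f)" by (simp add: cinner_simps cinner_norm)
  also have "\<dots> \<le> norm u * norm f"
    using abs_Re_le_cmod[of "cinner u f"] norm_cinner_le[of u f] by linarith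
  finally have "norm u * (- Re z * norm u) \<le> norm u * norm f" by (simp add: power2_eq_square mult_ac)
  then show ?thesis
    using mult_left_le_imp_le[of "norm u" "- Re z * norm u" "norm f"] by (cases "u = 0") auto
qed

text \<open>The range of \<open>G - z\<close> is closed, and a vector \<open>y\<close> orthogonal to it satisfies \<open>G y = cnj z y\<close>,
  which contradicts positivity unless \<open>y = 0\<close>.\<close>

lemma self_adjoint_resolvent_exists:
  fixes f :: "'a::euclidean_space L2"
  assumes G: "self_adjoint_op G" and pos: "positive_op G" and z: "Re z < 0"
  shows "\<exists>u. (u, f + z *\<^sub>C u) \<in> G"
proof -
  define R where "R = {f. \<exists>u. (u, f + z *\<^sub>C u) \<in> G}"
  have R_add: "f + g \<in> R" if "f \<in> R" "g \<in> R" for f g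
  proof -
    from that obtain u v where "(u, f + z *\<^sub>C u) \<in> G" "(v, g + z *\<^sub>C v) \<in> G" by (auto simp: R_def)
    from self_adjoint_op_add[OF G this] show ?thesis
      unfolding R_def by (auto simp: scaleC_add_right algebra_simps intro!: exI[of _ "u + v"])
  qed
  have R_scaleC: "c *\<^sub>C f \<in> R" if "f \<in> R" for f c
  proof -
    from that obtain u where "(u, f + z *\<^sub>C u) \<in> G" by (auto simp: R_def)
    from self_adjoint_op_scaleC[OF G this, of c] show ?thesis
      unfolding R_def by (auto simp: scaleC_add_right scaleC_scaleC mult.commute intro!: exI[of _ "c *\<^sub>C u"])
  qed
  have R_scaleR: "c *\<^sub>R f \<in> R" if "f \<in> R" for f c
    using R_scaleC[OF that] by (simp add: scaleR_L2_def)
  have "closed R"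
    unfolding closed_sequential_limits
  proof (intro allI impI, elim conjE)
    fix X g assume "\<forall>n. X n \<in> R" and g: "X \<longlonglongrightarrow> g"
    then obtain U where U: "\<And>n. (U n, X n + z *\<^sub>C U n) \<in> G" unfolding R_def mem_Collect_eq by metis
    have UX: "- Re z * norm (U m - U n) \<le> norm (X m - X n)" for m n
    proof -
      have "(U m - U n, (X m - X n) + z *\<^sub>C (U m - U n)) \<in> G"
        using self_adjoint_op_diff[OF G U[of m] U[of n]] by (simp add: scaleC_diff_right algebra_simps)
      then show ?thesis by (rule positive_op_bound[OF pos])
    qed
    have "Cauchy U"
    proof (rule CauchyI)
      fix \<delta> :: real assume "0 < \<delta>"
      then obtain N where N: "\<And>m n. m \<ge> N \<Longrightarrow> n \<ge> N \<Longrightarrow> norm (X m - X n) < - Re z * \<delta>"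
        using LIMSEQ_imp_Cauchy[OF g, unfolded Cauchy_iff, rule_format, of "- Re z * \<delta>"] z
        by (auto simp: mult_neg_pos)
      have "norm (U m - U n) < \<delta>" if "m \<ge> N" "n \<ge> N" for m n
      proof -
        have "- Re z * norm (U m - U n) < - Re z * \<delta>" using UX[of m n] N[OF that] by linarith
        then show ?thesis using z by simp
      qed
      then show "\<exists>M. \<forall>m\<ge>M. \<forall>n\<ge>M. norm (U m - U n) < \<delta>" by blast
    qed
    then obtain u where u: "U \<longlonglongrightarrow> u" using Cauchy_convergent convergent_def by blast
    have "(u, g + z *\<^sub>C u) \<in> G"
      by (rule self_adjoint_op_closed[OF G u _ U]) (intro tendsto_intros g tendsto_scaleC u)
    then show "g \<in> R" by (auto simp: R_def)
  qed
  moreover have "0 \<in> R" using self_adjoint_op_zero[OF G] by (auto simp: R_def intro!: exI[of _ 0])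
  ultimately interpret closed_real_form R "(\<bullet>)"
    by (intro closed_real_form_inner R_add R_scaleR)
  have "\<exists>r\<in>R. \<forall>v\<in>R. v \<bullet> r = v \<bullet> f"
  proof (rule riesz[of "\<lambda>v. v \<bullet> f" "norm f"])
    fix v show "\<bar>v \<bullet> f\<bar> \<le> norm f * sqrt (v \<bullet> v)"
      using Cauchy_Schwarz_ineq2[of v f] by (simp add: norm_eq_sqrt_inner mult.commute)
  qed (auto simp: inner_add_left)
  then obtain r where r: "r \<in> R" "\<And>v. v \<in> R \<Longrightarrow> v \<bullet> r = v \<bullet> f" by blast
  define y where "y = f - r"
  have orth: "cinner v y = 0" if "v \<in> R" for v
  proof -
    have *: "Re (cinner v y) = 0" if "v \<in> R" for v
      using r(2)[OF that] by (simp add: y_def inner_L2_def cinner_diff_right)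
    show ?thesis
      using *[OF that] *[OF R_scaleC[OF that, of \<i>]] by (simp add: complex_eq_iff cinner_scaleC_left)
  qed
  have "(y, cnj z *\<^sub>C y) \<in> G"
    unfolding self_adjoint_op_iff[OF G]
  proof safe
    fix u g assume ug: "(u, g) \<in> G"
    then have "g - z *\<^sub>C u \<in> R" unfolding R_def by (auto intro!: exI[of _ u])
    then have "cinner y (g - z *\<^sub>C u) = 0" using orth[of "g - z *\<^sub>C u"] cinner_cnj[of y "g - z *\<^sub>C u"] by simp
    then show "cinner y g = cinner (cnj z *\<^sub>C y) u" by (simp add: cinner_simps)
  qed
  then have "0 \<le> Re (cinner y (cnj z *\<^sub>C y))" using pos by (auto simp: positive_op_def)
  then have "0 \<le> Re z * (norm y)\<^sup>2" by (simp add: cinner_simps cinner_norm)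
  moreover have "Re z * (norm y)\<^sup>2 < 0" if "y \<noteq> 0" using z that by (intro mult_neg_pos) auto
  ultimately have "y = 0" by force
  then have "f \<in> R" using r(1) by (simp add: y_def)
  then show ?thesis by (simp add: R_def)
qed

lemma self_adjoint_resolvent:
  assumes G: "self_adjoint_op G" and pos: "positive_op G" and z: "Re z < 0"
  shows "(resolvent G z f, f + z *\<^sub>C resolvent G z f) \<in> G"
proof -
  have "\<exists>!u. (u, f + z *\<^sub>C u) \<in> G"
  proof (rule ex_ex1I)
    show "\<exists>u. (u, f + z *\<^sub>C u) \<in> G" by (rule self_adjoint_resolvent_exists[OF assms])
    fix u v assume "(u, f + z *\<^sub>C u) \<in> G" "(v, f + z *\<^sub>C v) \<in> G"
    from self_adjoint_op_diff[OF G this] have "(u - v, 0 + z *\<^sub>C (u - v)) \<in> G"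
      by (simp add: scaleC_diff_right)
    from positive_op_bound[OF pos this] have "- Re z * norm (u - v) \<le> 0" by simp
    moreover have "0 < - Re z * norm (u - v)" if "u \<noteq> v" using z that by (intro mult_pos_pos) auto
    ultimately show "u = v" by force
  qed
  then show ?thesis unfolding resolvent_def by (rule theI')
qed

lemma resolvent_tendsto_real:
  assumes G: "self_adjoint_op G" and pos: "positive_op G" and k: "0 < \<kappa>"
  shows "((\<lambda>\<mu>. resolvent G (Complex (- \<kappa>) \<mu>) f) \<longlongrightarrow> resolvent G (complex_of_real (- \<kappa>)) f) (at_right 0)"
proof -
  define w where "w = resolvent G (complex_of_real (- \<kappa>)) f"
  have w: "(w, f + complex_of_real (- \<kappa>) *\<^sub>C w) \<in> G"
    unfolding w_def using k by (intro self_adjoint_resolvent G pos) simp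
  have bound: "norm (resolvent G (Complex (- \<kappa>) \<mu>) f - w) \<le> \<bar>\<mu>\<bar> * (norm w / \<kappa>)" for \<mu>
  proof -
    define u where "u = resolvent G (Complex (- \<kappa>) \<mu>) f"
    have u: "(u, f + Complex (- \<kappa>) \<mu> *\<^sub>C u) \<in> G"
      unfolding u_def using k by (intro self_adjoint_resolvent G pos) simp
    have z: "Complex (- \<kappa>) \<mu> = complex_of_real (- \<kappa>) + \<i> * complex_of_real \<mu>" by (simp add: complex_eq_iff)
    have "(u - w, (\<i> * complex_of_real \<mu>) *\<^sub>C w + Complex (- \<kappa>) \<mu> *\<^sub>C (u - w)) \<in> G"
    proof -
      have "(f + Complex (- \<kappa>) \<mu> *\<^sub>C u) - (f + complex_of_real (- \<kappa>) *\<^sub>C w)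
          = (\<i> * complex_of_real \<mu>) *\<^sub>C w + Complex (- \<kappa>) \<mu> *\<^sub>C (u - w)"
        unfolding z scaleC_add_left scaleC_diff_right by simp
      with self_adjoint_op_diff[OF G u w] show ?thesis by (simp only:)
    qed
    from positive_op_bound[OF pos this] have "\<kappa> * norm (u - w) \<le> \<bar>\<mu>\<bar> * norm w"
      by (simp add: norm_scaleC norm_mult)
    then show ?thesis using k by (simp add: u_def field_simps)
  qed
  have "((\<lambda>\<mu>. \<bar>\<mu>\<bar> * (norm w / \<kappa>)) \<longlongrightarrow> \<bar>0\<bar> * (norm w / \<kappa>)) (at_right 0)"
    by (intro tendsto_intros)
  then have lim: "((\<lambda>\<mu>. \<bar>\<mu>\<bar> * (norm w / \<kappa>)) \<longlongrightarrow> 0) (at_right 0)" by simp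
  have "((\<lambda>\<mu>. resolvent G (Complex (- \<kappa>) \<mu>) f - w) \<longlongrightarrow> 0) (at_right 0)"
    by (rule Lim_null_comparison[OF always_eventually lim]) (intro allI bound)
  then show ?thesis unfolding w_def by (rule LIM_zero_cancel)
qed

section \<open>Off-diagonal decay of the resolvent\<close>

lemma partial_deriv_cmult:
  assumes "\<And>x. f differentiable (at x)"
  shows "partial_deriv i (\<lambda>x. c * f x) = (\<lambda>x. c * partial_deriv i f x)"
  using partial_deriv_mult[of "\<lambda>_. c" f i] assms by (simp add: partial_deriv_const)

lemma viscosity_resolvent_weighted:
  assumes C: "coefficient_matrix C" and H: "viscosity_operator C H0"
    and \<psi>: "\<psi> \<in> dist_functions C" and a: "0 \<le> \<alpha>" and al: "\<alpha> < l"
  shows "(l\<^sup>2 - \<alpha>\<^sup>2) * norm (mulL (\<lambda>x. exp (\<alpha> * \<psi> x)) (resolvent H0 (complex_of_real (- l\<^sup>2)) f))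
    \<le> norm (mulL (\<lambda>x. exp (\<alpha> * \<psi> x)) f)"
proof -
  have \<psi>t: "\<psi> \<in> test_functions" using \<psi> by (simp add: dist_functions_def)
  define w where "w = (\<lambda>x. \<alpha> * \<psi> x)"
  have w: "w \<in> test_functions" unfolding w_def by (rule test_functions_cmult[OF \<psi>t])
  let ?m = "mulL (\<lambda>x. exp (w x))"
  have dw: "partial_deriv i w = (\<lambda>x. \<alpha> * partial_deriv i \<psi> x)" for i
    unfolding w_def by (rule partial_deriv_cmult[OF test_functionsD(3)[OF \<psi>t]])
  have "\<exists>K. \<forall>x. \<bar>partial_deriv i \<psi> x\<bar> \<le> K" for i
    by (intro test_functions_bounded test_functions_partial_deriv \<psi>t)
  then obtain L where L: "\<And>i x. \<bar>partial_deriv i \<psi> x\<bar> \<le> L i" by metis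
  define K where "K = (\<Sum>i\<in>UNIV. (L i)\<^sup>2)"
  have K: "(\<Sum>i\<in>UNIV. (partial_deriv i \<psi> x)\<^sup>2) \<le> K" for x
    unfolding K_def by (intro sum_mono) (metis L abs_ge_zero power2_abs power_mono)
  have q: "AE x in lebesgue. (\<Sum>i\<in>UNIV. \<Sum>j\<in>UNIV. reg_matrix C e x $ i $ j * partial_deriv i w x * partial_deriv j w x)
      \<le> \<alpha>\<^sup>2 * (1 + e * K)" if e: "0 < e" for e
  proof -
    have "AE x in lebesgue. \<bar>\<Sum>i\<in>UNIV. \<Sum>j\<in>UNIV. C x $ i $ j * partial_deriv i \<psi> x * partial_deriv j \<psi> x\<bar> \<le> 1"
      using \<psi> by (simp add: dist_functions_def)
    then show ?thesis
    proof eventually_elim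
      case (elim x)
      have "reg_matrix C e x $ i $ j * partial_deriv i w x * partial_deriv j w x
        = \<alpha>\<^sup>2 * (C x $ i $ j * partial_deriv i \<psi> x * partial_deriv j \<psi> x)
          + (if i = j then \<alpha>\<^sup>2 * e * (partial_deriv i \<psi> x)\<^sup>2 else 0)" for i j
        by (simp add: reg_matrix_nth dw power2_eq_square algebra_simps)
      then have "(\<Sum>i\<in>UNIV. \<Sum>j\<in>UNIV. reg_matrix C e x $ i $ j * partial_deriv i w x * partial_deriv j w x)
        = \<alpha>\<^sup>2 * ((\<Sum>i\<in>UNIV. \<Sum>j\<in>UNIV. C x $ i $ j * partial_deriv i \<psi> x * partial_deriv j \<psi> x)
          + e * (\<Sum>i\<in>UNIV. (partial_deriv i \<psi> x)\<^sup>2))"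
        by (simp add: sum.distrib sum_distrib_left sum.delta algebra_simps)
      also have "\<dots> \<le> \<alpha>\<^sup>2 * (1 + e * K)"
        using elim K[of x] e by (intro mult_left_mono add_mono) auto
      finally show ?case .
    qed
  qed
  have sa: "self_adjoint_op H0" and pos: "positive_op H0"
    and lim: "strong_resolvent_limit (H_eps C) H0 (at_right 0)"
    using H by (auto simp: viscosity_operator_def)
  have Lw: "Linfty (\<lambda>x. exp (w x))" by (rule exp_test(2)[OF w])
  have step: "(l\<^sup>2 - \<alpha>\<^sup>2) * norm (?m (resolvent H0 (Complex (- l\<^sup>2) \<mu>) f)) \<le> norm (?m f)"
    if \<mu>: "0 < \<mu>" "\<mu> < l\<^sup>2" for \<mu>
  proof -
    let ?z = "Complex (- l\<^sup>2) \<mu>"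
    have R: "((\<lambda>e. resolvent (H_eps C e) ?z f) \<longlongrightarrow> resolvent H0 ?z f) (at_right 0)"
      using lim \<mu> by (simp add: strong_resolvent_limit_def)
    have "((\<lambda>e. (l\<^sup>2 - \<alpha>\<^sup>2 * (1 + e * K)) * norm (?m (resolvent (H_eps C e) ?z f)))
        \<longlongrightarrow> (l\<^sup>2 - \<alpha>\<^sup>2 * (1 + 0 * K)) * norm (?m (resolvent H0 ?z f))) (at_right 0)"
      by (intro tendsto_intros tendsto_mulL Lw R)
    moreover have "\<forall>\<^sub>F e in at_right 0. (l\<^sup>2 - \<alpha>\<^sup>2 * (1 + e * K)) * norm (?m (resolvent (H_eps C e) ?z f)) \<le> norm (?m f)"
      using eventually_at_right_less[of 0]
    proof eventually_elim
      case (elim e)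
      show ?case
        using H_eps_resolvent_weighted[OF C elim _ w q[OF elim], of ?z f] \<mu> by simp
    qed
    ultimately show ?thesis
      using tendsto_upperbound[of _ _ "at_right (0::real)"] by force
  qed
  have "((\<lambda>\<mu>. (l\<^sup>2 - \<alpha>\<^sup>2) * norm (?m (resolvent H0 (Complex (- l\<^sup>2) \<mu>) f)))
      \<longlongrightarrow> (l\<^sup>2 - \<alpha>\<^sup>2) * norm (?m (resolvent H0 (complex_of_real (- l\<^sup>2)) f))) (at_right 0)"
    using a al by (intro tendsto_intros tendsto_mulL Lw resolvent_tendsto_real sa pos) simp
  moreover have "\<forall>\<^sub>F \<mu> in at_right 0. (l\<^sup>2 - \<alpha>\<^sup>2) * norm (?m (resolvent H0 (Complex (- l\<^sup>2) \<mu>) f)) \<le> norm (?m f)"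
    unfolding eventually_at_right_field using step a al by (intro exI[of _ "l\<^sup>2"]) auto
  ultimately have "(l\<^sup>2 - \<alpha>\<^sup>2) * norm (?m (resolvent H0 (complex_of_real (- l\<^sup>2)) f)) \<le> norm (?m f)"
    by (rule tendsto_upperbound) simp
  then show ?thesis by (simp add: w_def)
qed

lemma norm_mulL_on_le:
  assumes m: "Linfty m" and u: "u \<in> L2_on V" and K: "0 \<le> K" "\<And>x. x \<in> V \<Longrightarrow> \<bar>m x\<bar> \<le> K"
  shows "norm (mulL m u) \<le> K * norm u"
proof (rule norm_L2_le[OF K(1)])
  have "AE x in lebesgue. x \<notin> V \<longrightarrow> L2_fun u x = 0" using u by (simp add: L2_on_def)
  with L2_fun_mulL[OF m, of u] show "AE x in lebesgue. cmod (L2_fun (mulL m u) x) \<le> K * cmod (L2_fun u x)"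
  proof eventually_elim
    case (elim x)
    then show ?case using K(2)[of x] by (cases "x \<in> V") (auto simp: norm_mult mult_right_mono)
  qed
qed

lemma viscosity_resolvent_decay:
  assumes C: "coefficient_matrix C" and H: "viscosity_operator C H0"
    and \<psi>: "\<psi> \<in> dist_functions C" and al: "0 \<le> \<alpha>" "\<alpha> < l"
    and \<phi>1: "\<phi>1 \<in> L2_on V1" "\<And>x. x \<in> V1 \<Longrightarrow> b \<le> \<psi> x"
    and \<phi>2: "\<phi>2 \<in> L2_on V2" "\<And>x. x \<in> V2 \<Longrightarrow> \<psi> x \<le> a"
  shows "(l\<^sup>2 - \<alpha>\<^sup>2) * cmod (cinner \<phi>1 (resolvent H0 (complex_of_real (- l\<^sup>2)) \<phi>2))
    \<le> exp (- (\<alpha> * (b - a))) * (norm \<phi>1 * norm \<phi>2)"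
proof -
  have \<psi>t: "\<psi> \<in> test_functions" using \<psi> by (simp add: dist_functions_def)
  define u where "u = resolvent H0 (complex_of_real (- l\<^sup>2)) \<phi>2"
  define m where "m s = mulL (\<lambda>x. exp (s * \<psi> x))" for s
  have L: "Linfty (\<lambda>x. exp (s * \<psi> x))" for s
    by (rule exp_test(2)[OF test_functions_cmult[OF \<psi>t]])
  have "cinner (m (- \<alpha>) \<phi>1) (m \<alpha> u) = cinner \<phi>1 (m (- \<alpha>) (m \<alpha> u))"
    unfolding m_def by (rule cinner_mulL_commute[OF L])
  also have "m (- \<alpha>) (m \<alpha> u) = mulL (\<lambda>x. 1) u"
    unfolding m_def by (subst mulL_mulL[OF L L]) (simp add: exp_minus)
  also have "mulL (\<lambda>x. 1) u = u" by (simp add: mulL_def abs_L2_L2_fun)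
  finally have "cmod (cinner \<phi>1 u) \<le> norm (m (- \<alpha>) \<phi>1) * norm (m \<alpha> u)"
    using norm_cinner_le by metis
  moreover have pos: "0 \<le> l\<^sup>2 - \<alpha>\<^sup>2" using al by (simp add: power_mono)
  ultimately have "(l\<^sup>2 - \<alpha>\<^sup>2) * cmod (cinner \<phi>1 u) \<le> (l\<^sup>2 - \<alpha>\<^sup>2) * (norm (m (- \<alpha>) \<phi>1) * norm (m \<alpha> u))"
    by (intro mult_left_mono)
  also have "\<dots> = norm (m (- \<alpha>) \<phi>1) * ((l\<^sup>2 - \<alpha>\<^sup>2) * norm (m \<alpha> u))" by simp
  also have "\<dots> \<le> (exp (- (\<alpha> * b)) * norm \<phi>1) * norm (m \<alpha> \<phi>2)"
  proof (intro mult_mono)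
    show "norm (m (- \<alpha>) \<phi>1) \<le> exp (- (\<alpha> * b)) * norm \<phi>1"
      unfolding m_def using al by (intro norm_mulL_on_le[OF L \<phi>1(1)]) (auto simp: \<phi>1(2) mult_left_mono)
    show "(l\<^sup>2 - \<alpha>\<^sup>2) * norm (m \<alpha> u) \<le> norm (m \<alpha> \<phi>2)"
      unfolding m_def u_def by (rule viscosity_resolvent_weighted[OF C H \<psi> al])
  qed (use pos in auto)
  also have "\<dots> \<le> (exp (- (\<alpha> * b)) * norm \<phi>1) * (exp (\<alpha> * a) * norm \<phi>2)"
    unfolding m_def using al
    by (intro mult_left_mono norm_mulL_on_le[OF L \<phi>2(1)]) (auto simp: \<phi>2(2) mult_left_mono)
  also have "\<dots> = exp (- (\<alpha> * (b - a))) * (norm \<phi>1 * norm \<phi>2)"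
    by (simp add: exp_add[symmetric] exp_diff exp_minus algebra_simps field_simps)
  finally show ?thesis by (simp add: u_def)
qed

section \<open>Bounded functional calculus\<close>

definition bborel :: "(real \<Rightarrow> real) \<Rightarrow> bool" where
  "bborel f \<longleftrightarrow> f \<in> borel_measurable borel \<and> (\<exists>K. \<forall>s. \<bar>f s\<bar> \<le> K)"

lemma bborelI: "f \<in> borel_measurable borel \<Longrightarrow> (\<And>s. \<bar>f s\<bar> \<le> K) \<Longrightarrow> bborel f"
  by (auto simp: bborel_def)

lemma bborelD [measurable_dest]: "bborel f \<Longrightarrow> f \<in> borel_measurable borel"
  by (simp add: bborel_def)

lemma bborel_bound:
  assumes "bborel f" obtains K where "0 \<le> K" "\<And>s. \<bar>f s\<bar> \<le> K"
  using assms unfolding bborel_def by (meson abs_ge_zero order_trans)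

lemma bborel_indicator: "A \<in> sets borel \<Longrightarrow> bborel (indicator A)"
  by (rule bborelI[of _ 1]) (auto simp: indicator_def)

lemma bborel_mult:
  assumes "bborel f" "bborel g" shows "bborel (\<lambda>s. f s * g s)"
proof -
  obtain K where K: "0 \<le> K" "\<And>s. \<bar>f s\<bar> \<le> K" using assms(1) by (rule bborel_bound) blast
  obtain L where L: "0 \<le> L" "\<And>s. \<bar>g s\<bar> \<le> L" using assms(2) by (rule bborel_bound) blast
  show ?thesis
    by (rule bborelI[of _ "K * L"]) (use assms K L in \<open>auto simp: abs_mult intro!: mult_mono dest: bborelD\<close>)
qed

lemma bborel_const: "bborel (\<lambda>s. c)"
  by (rule bborelI[of _ "\<bar>c\<bar>"]) auto

lemma bborel_add:
  assumes "bborel f" "bborel g" shows "bborel (\<lambda>s. f s + g s)"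
proof -
  obtain K where K: "\<And>s. \<bar>f s\<bar> \<le> K" using assms(1) by (rule bborel_bound) blast
  obtain L where L: "\<And>s. \<bar>g s\<bar> \<le> L" using assms(2) by (rule bborel_bound) blast
  show ?thesis
    by (rule bborelI[of _ "K + L"])
       (use assms K L in \<open>auto intro: order_trans[OF abs_triangle_ineq] add_mono dest: bborelD\<close>)
qed

lemma bborel_induct [consumes 1, case_names indicator mult add seq]:
  assumes f: "bborel f"
    and ind: "\<And>A. A \<in> sets borel \<Longrightarrow> Q (indicator A)"
    and mult: "\<And>f c. bborel f \<Longrightarrow> Q f \<Longrightarrow> Q (\<lambda>s. c * f s)"
    and add: "\<And>f g. bborel f \<Longrightarrow> bborel g \<Longrightarrow> Q f \<Longrightarrow> Q g \<Longrightarrow> Q (\<lambda>s. f s + g s)"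
    and seq: "\<And>U f K. (\<And>i::nat. U i \<in> borel_measurable borel) \<Longrightarrow> (\<And>i s. \<bar>U i s\<bar> \<le> K) \<Longrightarrow> bborel f \<Longrightarrow>
      (\<And>i. Q (U i)) \<Longrightarrow> (\<And>s. (\<lambda>i. U i s) \<longlonglongrightarrow> f s) \<Longrightarrow> Q f"
  shows "Q f"
proof -
  have "(indicator {} :: real \<Rightarrow> real) = (\<lambda>s. 0)" by (simp add: fun_eq_iff)
  then have zero: "Q (\<lambda>s. 0)" using ind[of "{}"] by simp
  have nonneg: "(\<forall>s. f s \<le> K) \<longrightarrow> Q f" if "f \<in> borel_measurable borel" "\<And>s. 0 \<le> f s" for f K
    using that
  proof (induction arbitrary: K rule: borel_measurable_induct_real)
    case (set A) then show ?case using ind by simp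
  next
    case (mult u c)
    show ?case
    proof
      assume b: "\<forall>s. c * u s \<le> K"
      show "Q (\<lambda>s. c * u s)"
      proof (cases "c = 0")
        case False
        then have "\<forall>s. u s \<le> K / c" using b mult by (simp add: field_simps)
        moreover have "bborel u"
          using calculation mult by (intro bborelI[of _ "K / c"]) auto
        ultimately show ?thesis using mult assms(3) by blast
      qed (simp add: zero)
    qed
  next
    case (add u v)
    show ?case
    proof
      assume b: "\<forall>s. v s + u s \<le> K"
      have u: "u s \<le> K" and v: "v s \<le> K" for s
        using b[rule_format, of s] add.hyps(2)[of s] add.hyps(4)[of s] by linarith+
      then have "bborel u" "bborel v" using add by (auto intro!: bborelI[of _ K])
      then show "Q (\<lambda>s. v s + u s)" using add u v assms(4) by blast
    qed
  next
    case (seq U)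
    show ?case
    proof
      assume b: "\<forall>s. f s \<le> K"
      have le: "U i s \<le> f s" for i s
        using seq.hyps(4)[of s] by (intro incseq_le[of "\<lambda>i. U i s"]) (use seq.hyps(3) in \<open>auto simp: incseq_def le_fun_def\<close>)
      show "Q f"
      proof (rule assms(5))
        show "U i \<in> borel_measurable borel" for i by (rule seq(1))
        show "\<bar>U i s\<bar> \<le> K" for i s using seq.hyps(2)[of i s] le[of i s] spec[OF b, of s] by linarith
        show "bborel f" using that b by (intro bborelI[of _ K]) auto
        show "Q (U i)" for i using seq.IH[of i K] le b order_trans by blast
        show "(\<lambda>i. U i s) \<longlonglongrightarrow> f s" for s using seq.hyps(4)[of s] by simp
      qed
    qed
  qed
  obtain K where K: "0 \<le> K" "\<And>s. \<bar>f s\<bar> \<le> K" using f by (rule bborel_bound) blast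
  have [measurable]: "f \<in> borel_measurable borel" using f by (rule bborelD)
  have p: "max (f s) 0 \<le> K" "max (- f s) 0 \<le> K" for s using K(1) K(2)[of s] by auto
  have "Q (\<lambda>s. max (f s) 0)" "Q (\<lambda>s. max (- f s) 0)"
    using nonneg[of "\<lambda>s. max (f s) 0" K] nonneg[of "\<lambda>s. max (- f s) 0" K] p by auto
  moreover have bb: "bborel (\<lambda>s. max (f s) 0)" "bborel (\<lambda>s. max (- f s) 0)"
    using p by (auto intro!: bborelI[of _ K])
  ultimately have "Q (\<lambda>s. max (f s) 0 + (-1) * max (- f s) 0)"
    by (intro add mult bborel_mult bborel_const)
  moreover have "(\<lambda>s. max (f s) 0 + (-1) * max (- f s) 0) = f" by (auto simp: max_def)
  ultimately show ?thesis by simp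
qed

locale pvm =
  fixes E :: "real set \<Rightarrow> 'a::euclidean_space L2 \<Rightarrow> 'a L2"
  assumes pvm: "projection_valued_measure E"
begin

abbreviation M :: "'a L2 \<Rightarrow> real measure" where "M \<equiv> diagonal_measure E"
abbreviation P :: "(real \<Rightarrow> real) \<Rightarrow> 'a L2 \<Rightarrow> 'a L2 \<Rightarrow> complex" where "P \<equiv> polarized_integral E"

lemma E_idem: "A \<in> sets borel \<Longrightarrow> E A (E A u) = E A u"
  and E_sym: "A \<in> sets borel \<Longrightarrow> cinner (E A u) v = cinner u (E A v)"
  and E_empty: "E {} u = 0"
  and E_UNIV: "E UNIV u = u"
  and E_Int: "A \<in> sets borel \<Longrightarrow> B \<in> sets borel \<Longrightarrow> E (A \<inter> B) u = E A (E B u)"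
  and E_sums: "range S \<subseteq> sets borel \<Longrightarrow> disjoint_family S \<Longrightarrow> (\<lambda>n::nat. E (S n) u) sums E (\<Union>n. S n) u"
  using pvm by (auto simp: projection_valued_measure_def orthogonal_projection_def)

lemma E_add:
  assumes "A \<in> sets borel" shows "E A (u + v) = E A u + E A v"
  by (rule cinner_eqI) (simp add: E_sym[OF assms, symmetric] cinner_add_right)

lemma E_scaleC:
  assumes "A \<in> sets borel" shows "E A (c *\<^sub>C u) = c *\<^sub>C E A u"
  by (rule cinner_eqI) (simp add: E_sym[OF assms, symmetric] cinner_scaleC_right)

lemma cinner_E_self: "A \<in> sets borel \<Longrightarrow> cinner u (E A u) = complex_of_real ((norm (E A u))\<^sup>2)"
  using E_sym[of A u "E A u"] E_idem[of A u] by (simp add: cinner_norm)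

lemma sets_M [simp, measurable_cong]: "sets (M u) = sets borel"
  unfolding diagonal_measure_def using sets.sets_measure_of_eq[of borel] by simp

lemma space_M [simp]: "space (M u) = UNIV"
  using sets_eq_imp_space_eq[OF sets_M[of u]] by simp

lemma emeasure_M:
  assumes A: "A \<in> sets borel" shows "emeasure (M u) A = ennreal ((norm (E A u))\<^sup>2)"
proof -
  let ?\<mu> = "\<lambda>A. ennreal (Re (cinner u (E A u)))"
  have "emeasure (M u) A = ?\<mu> A"
  proof (rule emeasure_measure_of[OF diagonal_measure_def])
    show "positive (sets (M u)) ?\<mu>" by (simp add: positive_def E_empty)
    show "countably_additive (sets (M u)) ?\<mu>"
    proof (rule countably_additiveI)
      fix B :: "nat \<Rightarrow> real set" assume B: "range B \<subseteq> sets (M u)" "disjoint_family B"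
      have "(\<lambda>n. Re (cinner u (E (B n) u))) sums Re (cinner u (E (\<Union>n. B n) u))"
        using B by (intro bounded_linear.sums[OF bounded_linear_Re]
            bounded_linear.sums[OF bounded_linear_cinner_right] E_sums) auto
      then show "(\<Sum>i. ?\<mu> (B i)) = ?\<mu> (\<Union>i. B i)"
        using B by (intro suminf_ennreal_eq) (auto simp: cinner_E_self)
    qed
  qed (use A in auto)
  then show ?thesis using A by (simp add: cinner_E_self)
qed

lemma finite_measure_M: "finite_measure (M u)"
  by (rule finite_measureI) (simp add: emeasure_M)

lemma measure_M: "A \<in> sets borel \<Longrightarrow> measure (M u) A = (norm (E A u))\<^sup>2"
  by (simp add: measure_def emeasure_M)

lemma integrable_M:
  assumes f: "bborel f" shows "integrable (M u) f"
proof -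
  obtain K where "\<And>s. \<bar>f s\<bar> \<le> K" using f by (rule bborel_bound) blast
  then show ?thesis
    using f by (intro finite_measure.integrable_const_bound[OF finite_measure_M, of _ K])
      (auto dest: bborelD)
qed

lemma abs_integral_M_le:
  assumes f: "bborel f" and K: "\<And>s. \<bar>f s\<bar> \<le> K" shows "\<bar>LINT s|M u. f s\<bar> \<le> K * (norm u)\<^sup>2"
proof -
  have "\<bar>LINT s|M u. f s\<bar> \<le> (LINT s|M u. \<bar>f s\<bar>)"
    using integral_norm_bound[of "M u" f] by simp
  also have "\<dots> \<le> (LINT s|M u. K)"
    using K integrable_M[OF f] integrable_M[OF bborel_const]
    by (intro integral_mono) auto
  also have "\<dots> = K * (norm u)\<^sup>2" using measure_M[of UNIV u] by (simp add: E_UNIV mult.commute)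
  finally show ?thesis .
qed

lemma P_indicator:
  assumes A: "A \<in> sets borel" shows "P (indicator A) v u = cinner v (E A u)"
proof -
  have "complex_of_real (LINT s|M x. indicator A s) = cinner x (E A x)" for x
    using A by (simp add: measure_M cinner_E_self)
  then show ?thesis
    unfolding polarized_integral_def
    by (simp add: E_add[OF A] E_scaleC[OF A] cinner_simps eval_nat_numeral algebra_simps)
qed

lemma P_mult: "P (\<lambda>s. c * f s) v u = complex_of_real c * P f v u"
  unfolding polarized_integral_def by (simp add: sum_distrib_left mult_ac)

lemma P_add: "bborel f \<Longrightarrow> bborel g \<Longrightarrow> P (\<lambda>s. f s + g s) v u = P f v u + P g v u"
  unfolding polarized_integral_def
  by (simp add: integrable_M distrib_left sum.distrib add_divide_distrib)

lemma tendsto_P: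
  assumes "\<And>i::nat. U i \<in> borel_measurable borel" "\<And>x i. AE s in M x. \<bar>U i s\<bar> \<le> b s"
    and "\<And>k. integrable (M (u + \<i> ^ k *\<^sub>C v)) b" "f \<in> borel_measurable borel" "\<And>s. (\<lambda>i. U i s) \<longlonglongrightarrow> f s"
  shows "(\<lambda>i. P (U i) v u) \<longlonglongrightarrow> P f v u"
  unfolding polarized_integral_def
  by (intro tendsto_intros integral_dominated_convergence[where w = b])
     (use assms in auto)

lemma tendsto_P_bounded:
  assumes "\<And>i::nat. U i \<in> borel_measurable borel" "\<And>i s. \<bar>U i s\<bar> \<le> K" "f \<in> borel_measurable borel"
    "\<And>s. (\<lambda>i. U i s) \<longlonglongrightarrow> f s"
  shows "(\<lambda>i. P (U i) v u) \<longlonglongrightarrow> P f v u"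
  by (rule tendsto_P[where b = "\<lambda>_. K"]) (use assms integrable_M[OF bborel_const] in auto)

lemma norm_P_le:
  assumes f: "bborel f" and K: "\<And>s. \<bar>f s\<bar> \<le> K" shows "cmod (P f v u) \<le> K * (norm u + norm v)\<^sup>2"
proof -
  have "0 \<le> K" using K[of 0] by linarith
  have "cmod (\<i> ^ k * complex_of_real (LINT s|M (u + \<i> ^ k *\<^sub>C v). f s)) \<le> K * (norm u + norm v)\<^sup>2" for k
  proof -
    have "norm (u + \<i> ^ k *\<^sub>C v) \<le> norm u + norm v"
      using norm_triangle_ineq[of u "\<i> ^ k *\<^sub>C v"] by (simp add: norm_scaleC norm_power)
    then have "(norm (u + \<i> ^ k *\<^sub>C v))\<^sup>2 \<le> (norm u + norm v)\<^sup>2" by (intro power_mono) auto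
    then show ?thesis
      using abs_integral_M_le[OF f K, of "u + \<i> ^ k *\<^sub>C v"]
        mult_left_mono[OF _ \<open>0 \<le> K\<close>, of "(norm (u + \<i> ^ k *\<^sub>C v))\<^sup>2" "(norm u + norm v)\<^sup>2"]
      by (simp add: norm_mult norm_power)
  qed
  then have "cmod (\<Sum>k<4. \<i> ^ k * complex_of_real (LINT s|M (u + \<i> ^ k *\<^sub>C v). f s)) \<le> (\<Sum>k<4::nat. K * (norm u + norm v)\<^sup>2)"
    by (intro order_trans[OF norm_sum] sum_mono)
  then show ?thesis by (simp add: polarized_integral_def norm_divide)
qed

end

lemma riesz_L2:
  fixes F :: "'a::euclidean_space L2 \<Rightarrow> complex"
  assumes add: "\<And>u v. F (u + v) = F u + F v" and scaleC: "\<And>c u. F (c *\<^sub>C u) = cnj c * F u"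
    and bound: "\<And>u. norm u = 1 \<Longrightarrow> cmod (F u) \<le> K"
  shows "\<exists>w. \<forall>v. F v = cinner v w"
proof -
  interpret closed_real_form UNIV "(\<bullet>) :: 'a L2 \<Rightarrow> 'a L2 \<Rightarrow> real" by (rule closed_real_form_inner) auto
  have scaleR: "F (c *\<^sub>R u) = complex_of_real c * F u" for c u
    using scaleC[of "complex_of_real c" u] by (simp add: scaleC_of_real)
  have "\<exists>w\<in>UNIV. \<forall>v\<in>UNIV. v \<bullet> w = Re (F v)"
  proof (rule riesz)
    show "\<bar>Re (F u)\<bar> \<le> K * sqrt (u \<bullet> u)" for u
    proof (cases "u = 0")
      case True
      then show ?thesis using scaleR[of 0 0] by simp
    next
      case False
      have "cmod (F u) = cmod (F (norm u *\<^sub>R sgn u))" by (simp add: sgn_div_norm False)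
      also have "\<dots> = norm u * cmod (F (sgn u))" by (simp add: scaleR norm_mult)
      also have "\<dots> \<le> norm u * K" using False by (intro mult_left_mono bound) (auto simp: norm_sgn)
      finally show ?thesis using abs_Re_le_cmod[of "F u"] by (simp add: norm_eq_sqrt_inner mult.commute)
    qed
  qed (simp_all add: add scaleR)
  then obtain w where w: "\<And>v. v \<bullet> w = Re (F v)" by blast
  have "F v = cinner v w" for v
    using w[of v] w[of "\<i> *\<^sub>C v"] by (simp add: inner_L2_def cinner_scaleC_left scaleC complex_eq_iff)
  then show ?thesis by blast
qed

context pvm
begin

lemma P_representable:
  assumes "bborel f" shows "\<exists>w. \<forall>v. P f v u = cinner v w"
  using assms
proof (induction rule: bborel_induct)
  case (indicator A)
  then show ?case using P_indicator by blast
next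
  case (mult f c)
  then obtain w where "\<And>v. P f v u = cinner v w" by blast
  then have "\<forall>v. P (\<lambda>s. c * f s) v u = cinner v (c *\<^sub>R w)" by (simp add: P_mult cinner_simps)
  then show ?case by blast
next
  case (add f g)
  then obtain w w' where "\<And>v. P f v u = cinner v w" "\<And>v. P g v u = cinner v w'" by blast
  then have "\<forall>v. P (\<lambda>s. f s + g s) v u = cinner v (w + w')" using add by (simp add: P_add cinner_simps)
  then show ?case by blast
next
  case (seq U f K)
  from seq.IH obtain w where w: "\<And>i v. P (U i) v u = cinner v (w i)" by metis
  have lim: "(\<lambda>i. cinner v (w i)) \<longlonglongrightarrow> P f v u" for v
    using tendsto_P_bounded[OF seq(1,2) bborelD[OF seq(3)] seq.hyps(4), of v u] by (simp add: w)
  obtain L where L: "\<And>s. \<bar>f s\<bar> \<le> L" using seq(3) by (rule bborel_bound) blast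
  show ?case
  proof (rule riesz_L2)
    show "P f (x + y) u = P f x u + P f y u" for x y
      using LIMSEQ_unique[OF lim[of "x + y"]] tendsto_add[OF lim[of x] lim[of y]]
      by (simp add: cinner_add_left)
    show "P f (c *\<^sub>C x) u = cnj c * P f x u" for c x
      using LIMSEQ_unique[OF lim[of "c *\<^sub>C x"]] tendsto_mult[OF tendsto_const lim[of x], of "cnj c"]
      by (simp add: cinner_scaleC_left)
    show "cmod (P f x u) \<le> L * (norm u + 1)\<^sup>2" if "norm x = 1" for x
      using norm_P_le[OF seq(3) L, of x u] that by simp
  qed
qed

definition T :: "(real \<Rightarrow> real) \<Rightarrow> 'a L2 \<Rightarrow> 'a L2" where
  "T f u = (SOME w. \<forall>v. P f v u = cinner v w)"

lemma P_eq_cinner_T: "bborel f \<Longrightarrow> P f v u = cinner v (T f u)"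
  unfolding T_def using someI_ex[OF P_representable, of f u] by blast

lemma T_indicator: "A \<in> sets borel \<Longrightarrow> T (indicator A) u = E A u"
  by (rule cinner_eqI) (simp add: P_eq_cinner_T[symmetric] P_indicator bborel_indicator)

lemma P_E_left:
  assumes A: "A \<in> sets borel" and f: "bborel f"
  shows "P f (E A v) u = P (\<lambda>s. indicator A s * f s) v u"
  using f
proof (induction rule: bborel_induct)
  case (indicator B)
  have "(\<lambda>s. indicator A s * indicator B s) = (indicator (A \<inter> B) :: real \<Rightarrow> real)" by (auto simp: indicator_def)
  then show ?case
    using P_indicator[of "A \<inter> B" v u] indicator A
    by (simp add: P_indicator E_sym E_Int)
next
  case (mult f c)
  then show ?case using P_mult[of c "\<lambda>s. indicator A s * f s" v u] by (simp add: P_mult mult_ac)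
next
  case (add f g)
  then show ?case
    using P_add[of "\<lambda>s. indicator A s * f s" "\<lambda>s. indicator A s * g s" v u] A
    by (simp add: P_add distrib_left bborel_mult bborel_indicator)
next
  case (seq U f K)
  have [measurable]: "A \<in> sets borel" "U i \<in> borel_measurable borel" "f \<in> borel_measurable borel" for i
    using A seq(1,3) by (auto dest: bborelD)
  have "(\<lambda>i. P (U i) (E A v) u) \<longlonglongrightarrow> P f (E A v) u"
    by (rule tendsto_P_bounded[OF seq(1,2) bborelD[OF seq(3)] seq.hyps(4)])
  moreover have "(\<lambda>i. P (\<lambda>s. indicator A s * U i s) v u) \<longlonglongrightarrow> P (\<lambda>s. indicator A s * f s) v u"
  proof (rule tendsto_P_bounded)
    show "\<bar>indicator A s * U i s\<bar> \<le> K" for i s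
      using seq(2)[of i s] by (auto simp: indicator_def intro: order_trans[OF abs_ge_zero])
    show "(\<lambda>i. indicator A s * U i s) \<longlonglongrightarrow> indicator A s * f s" for s
      by (intro tendsto_intros seq)
  qed measurable
  ultimately show ?case unfolding seq.IH by (rule LIMSEQ_unique)
qed

lemma P_T:
  assumes f: "bborel f" and g: "bborel g"
  shows "P f v (T g u) = P (\<lambda>s. f s * g s) v u"
  using f
proof (induction rule: bborel_induct)
  case (indicator A)
  then show ?case
    by (simp add: P_indicator E_sym[symmetric] P_eq_cinner_T[OF g, symmetric] P_E_left g)
next
  case (mult f c)
  then show ?case using P_mult[of c "\<lambda>s. f s * g s" v u] by (simp add: P_mult mult_ac)
next
  case (add f h)
  then show ?case
    using P_add[of "\<lambda>s. f s * g s" "\<lambda>s. h s * g s" v u] g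
    by (simp add: P_add distrib_right bborel_mult)
next
  case (seq U f K)
  obtain L where L: "0 \<le> L" "\<And>s. \<bar>g s\<bar> \<le> L" using g by (rule bborel_bound) blast
  have [measurable]: "g \<in> borel_measurable borel" "U i \<in> borel_measurable borel" "f \<in> borel_measurable borel" for i
    using g seq(1,3) by (auto dest: bborelD)
  have "(\<lambda>i. P (U i) v (T g u)) \<longlonglongrightarrow> P f v (T g u)"
    by (rule tendsto_P_bounded[OF seq(1,2) bborelD[OF seq(3)] seq.hyps(4)])
  moreover have "(\<lambda>i. P (\<lambda>s. U i s * g s) v u) \<longlonglongrightarrow> P (\<lambda>s. f s * g s) v u"
  proof (rule tendsto_P_bounded)
    show "\<bar>U i s * g s\<bar> \<le> K * L" for i s
      using seq(2)[of i s] L unfolding abs_mult by (intro mult_mono) (auto intro: order_trans[OF abs_ge_zero])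
    show "(\<lambda>i. U i s * g s) \<longlonglongrightarrow> f s * g s" for s
      by (intro tendsto_intros seq)
  qed measurable
  ultimately show ?case unfolding seq.IH by (rule LIMSEQ_unique)
qed

lemma P_zero_right:
  assumes f: "bborel f" shows "P f v 0 = 0"
  using P_T[OF f bborel_indicator[of "{}"], of v 0] P_mult[of 0 "\<lambda>_. 0" v 0]
  by (simp add: T_indicator E_empty)

lemma P_diagonal:
  assumes "bborel f" shows "P f u u = complex_of_real (LINT s|M u. f s)"
  using assms
proof (induction rule: bborel_induct)
  case (indicator A)
  then show ?case by (simp add: P_indicator cinner_E_self measure_M)
next
  case (mult f c)
  then show ?case by (simp add: P_mult)
next
  case (add f g)
  then show ?case by (simp add: P_add integrable_M)
next
  case (seq U f K)
  have "(\<lambda>i. P (U i) u u) \<longlonglongrightarrow> P f u u"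
    by (rule tendsto_P_bounded[OF seq(1,2) bborelD[OF seq(3)] seq.hyps(4)])
  moreover have "(\<lambda>i. complex_of_real (LINT s|M u. U i s)) \<longlonglongrightarrow> complex_of_real (LINT s|M u. f s)"
    by (intro tendsto_of_real integral_dominated_convergence[where w = "\<lambda>_. K"])
       (use seq integrable_M[OF bborel_const] in \<open>auto dest: bborelD\<close>)
  ultimately show ?case unfolding seq.IH by (rule LIMSEQ_unique)
qed

lemma spectral_domain_bborel: "bborel f \<Longrightarrow> spectral_domain E f = UNIV"
  using integrable_M[OF bborel_mult[of f f]] by (auto simp: spectral_domain_def power2_eq_square)

lemma op_apply_spectral_integral:
  assumes f: "bborel f" shows "op_apply (spectral_integral E f) u = T f u"
  unfolding op_apply_def spectral_integral_def spectral_domain_bborel[OF f]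
  by (rule the_equality) (auto simp: P_eq_cinner_T[OF f] intro: cinner_eqI)

lemma cinner_cos_sqrt_op: "cinner v (cos_sqrt_op E t u) = P (\<lambda>s. cos (t * sqrt s)) v u"
proof -
  have "bborel (\<lambda>s. cos (t * sqrt s))" by (rule bborelI[of _ 1]) auto
  then show ?thesis by (simp add: cos_sqrt_op_def op_apply_spectral_integral P_eq_cinner_T)
qed

section \<open>The unbounded spectral integral\<close>

lemma nn_integral_M_add_le:
  assumes f: "f \<in> borel_measurable borel"
  shows "(\<integral>\<^sup>+s. f s \<partial>M (u + v)) \<le> 2 * (\<integral>\<^sup>+s. f s \<partial>M u) + 2 * (\<integral>\<^sup>+s. f s \<partial>M v)"
  using f
proof (induction rule: borel_measurable_induct)
  case (cong f g) then show ?case by simp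
next
  case (set A)
  have "(norm (E A (u + v)))\<^sup>2 \<le> (norm (E A u) + norm (E A v))\<^sup>2"
    unfolding E_add[OF set] by (intro power_mono norm_triangle_ineq) auto
  also have "\<dots> \<le> 2 * (norm (E A u))\<^sup>2 + 2 * (norm (E A v))\<^sup>2"
    using sum_squares_bound[of "norm (E A u)" "norm (E A v)"] by (simp add: power2_sum)
  finally have "ennreal ((norm (E A (u + v)))\<^sup>2) \<le> ennreal (2 * (norm (E A u))\<^sup>2 + 2 * (norm (E A v))\<^sup>2)"
    by (rule ennreal_leI)
  then show ?case using set by (simp add: emeasure_M ennreal_plus ennreal_mult)
next
  case (mult f c)
  then have "c * (\<integral>\<^sup>+s. f s \<partial>M (u + v)) \<le> c * (2 * (\<integral>\<^sup>+s. f s \<partial>M u) + 2 * (\<integral>\<^sup>+s. f s \<partial>M v))"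
    by (intro mult_left_mono) auto
  then show ?case using mult by (simp add: nn_integral_cmult distrib_left mult_ac)
next
  case (add f g)
  then show ?case
    using add_mono[OF add.IH] by (simp add: nn_integral_add distrib_left ac_simps)
next
  case (seq U)
  have lim: "(\<integral>\<^sup>+s. (SUP i. U i) s \<partial>M x) = (SUP i. \<integral>\<^sup>+s. U i s \<partial>M x)" for x
    unfolding SUP_apply using seq by (intro nn_integral_monotone_convergence_SUP) auto
  have "(\<integral>\<^sup>+s. U i s \<partial>M (u + v)) \<le> 2 * (SUP i. \<integral>\<^sup>+s. U i s \<partial>M u) + 2 * (SUP i. \<integral>\<^sup>+s. U i s \<partial>M v)" for i
    by (rule order_trans[OF seq.IH]) (intro add_mono mult_left_mono SUP_upper, auto)
  then have "(SUP i. \<integral>\<^sup>+s. U i s \<partial>M (u + v)) \<le> 2 * (SUP i. \<integral>\<^sup>+s. U i s \<partial>M u) + 2 * (SUP i. \<integral>\<^sup>+s. U i s \<partial>M v)"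
    by (rule SUP_least)
  then show ?case by (simp only: lim)
qed

lemma spectral_domain_id_add:
  assumes "u \<in> spectral_domain E (\<lambda>s. s)" "v \<in> spectral_domain E (\<lambda>s. s)"
  shows "u + v \<in> spectral_domain E (\<lambda>s. s)"
proof -
  have fin: "(\<integral>\<^sup>+s. ennreal (s\<^sup>2) \<partial>M x) < \<infinity>" if "x \<in> spectral_domain E (\<lambda>s. s)" for x
    using that by (auto simp: spectral_domain_def integrable_iff_bounded)
  have "(\<integral>\<^sup>+s. ennreal (s\<^sup>2) \<partial>M (u + v)) \<le> 2 * (\<integral>\<^sup>+s. ennreal (s\<^sup>2) \<partial>M u) + 2 * (\<integral>\<^sup>+s. ennreal (s\<^sup>2) \<partial>M v)"
    by (rule nn_integral_M_add_le) measurable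
  also have "\<dots> < \<infinity>" using fin[OF assms(1)] fin[OF assms(2)] by (simp add: ennreal_mult_less_top)
  finally show ?thesis by (auto simp: spectral_domain_def integrable_iff_bounded)
qed

lemma M_scaleC_unit: "cmod c = 1 \<Longrightarrow> M (c *\<^sub>C u) = M u"
  by (rule measure_eqI) (auto simp: emeasure_M E_scaleC norm_scaleC)

lemma E_bounded_in_domain:
  assumes A: "A \<in> sets borel" "A \<subseteq> {-K..K}"
  shows "E A v \<in> spectral_domain E (\<lambda>s. s)"
proof -
  have "emeasure (M (E A v)) (- A) = 0"
    using A E_Int[of "- A" A v] by (simp add: emeasure_M E_empty)
  then have "- A \<in> null_sets (M (E A v))" using A by (intro null_setsI) auto
  then have "AE s in M (E A v). s \<in> A" using AE_not_in[of "- A" "M (E A v)"] by simp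
  then have "AE s in M (E A v). norm (s\<^sup>2) \<le> K\<^sup>2"
  proof eventually_elim
    case (elim s)
    then have "\<bar>s\<bar> \<le> K" using subsetD[OF A(2), of s] by (simp add: abs_le_iff)
    then show ?case using power_mono[of "\<bar>s\<bar>" K 2] by simp
  qed
  then show ?thesis
    unfolding spectral_domain_def
    by (auto intro!: finite_measure.integrable_const_bound[OF finite_measure_M])
qed

lemma cinner_E_spectral_integral:
  assumes wg: "(w, g) \<in> spectral_integral E (\<lambda>s. s)" and A: "A \<in> sets borel" "A \<subseteq> {-K..K}"
  shows "cinner v (E A g) = P (\<lambda>s. indicator A s * s) v w"
proof -
  let ?x = "E A v"
  have x: "?x \<in> spectral_domain E (\<lambda>s. s)" by (rule E_bounded_in_domain[OF A])
  have w: "w \<in> spectral_domain E (\<lambda>s. s)" using wg by (simp add: spectral_integral_def)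
  define U where "U i s = indicator {- real i..real i} s * s" for i :: nat and s :: real
  have U: "bborel (U i)" for i
    unfolding U_def by (rule bborelI[of _ "real i"]) (auto simp: indicator_def)
  have "(\<lambda>i. P (U i) ?x w) \<longlonglongrightarrow> P (\<lambda>s. s) ?x w"
  proof (rule tendsto_P[where b = "\<lambda>s. 1 + s\<^sup>2"])
    show "AE s in M x. \<bar>U i s\<bar> \<le> 1 + s\<^sup>2" for x i
    proof (rule AE_I2)
      fix s :: real
      have "0 \<le> (\<bar>s\<bar> - 1)\<^sup>2" by simp
      then have "2 * \<bar>s\<bar> \<le> 1 + s\<^sup>2" by (simp add: power2_diff)
      then have "\<bar>s\<bar> \<le> 1 + s\<^sup>2" by linarith
      then show "\<bar>U i s\<bar> \<le> 1 + s\<^sup>2" by (auto simp: U_def indicator_def)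
    qed
    show "integrable (M (w + \<i> ^ k *\<^sub>C ?x)) (\<lambda>s. 1 + s\<^sup>2)" for k
    proof -
      have "\<i> ^ k *\<^sub>C ?x \<in> spectral_domain E (\<lambda>s. s)"
        using x by (simp add: spectral_domain_def M_scaleC_unit norm_power)
      from spectral_domain_id_add[OF w this] show ?thesis
        using integrable_M[OF bborel_const] by (auto simp: spectral_domain_def)
    qed
    show "(\<lambda>i. U i s) \<longlonglongrightarrow> s" for s
    proof -
      obtain N where N: "\<bar>s\<bar> \<le> real N" using real_arch_simple by blast
      have "U i s = s" if "N \<le> i" for i using N that by (auto simp: U_def indicator_def abs_le_iff)
      then show ?thesis by (intro tendsto_eventually eventually_sequentiallyI[of N])
    qed
  qed (use U in \<open>auto dest: bborelD\<close>)
  moreover have "(\<lambda>i. P (U i) ?x w) \<longlonglongrightarrow> P (\<lambda>s. indicator A s * s) v w"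
  proof -
    obtain N where N: "K \<le> real N" using real_arch_simple by blast
    have "P (U i) ?x w = P (\<lambda>s. indicator A s * s) v w" if "N \<le> i" for i
    proof -
      have "(\<lambda>s. indicator A s * U i s) = (\<lambda>s. indicator A s * s)"
        using A(2) N that by (auto simp: U_def indicator_def fun_eq_iff subset_iff)
      then show ?thesis by (simp add: P_E_left[OF A(1) U])
    qed
    then show ?thesis by (intro tendsto_eventually eventually_sequentiallyI[of N])
  qed
  ultimately have "P (\<lambda>s. s) ?x w = P (\<lambda>s. indicator A s * s) v w" by (rule LIMSEQ_unique)
  moreover have "cinner ?x g = P (\<lambda>s. s) ?x w" using wg x by (simp add: spectral_integral_def)
  ultimately show ?thesis using A(1) by (simp add: E_sym)
qed

lemma norm_E_le: "A \<in> sets borel \<Longrightarrow> norm (E A u) \<le> norm u"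
proof -
  assume A: "A \<in> sets borel"
  have "(norm (E A u))\<^sup>2 = Re (cinner u (E A u))" using A by (simp add: cinner_E_self)
  also have "\<dots> \<le> norm u * norm (E A u)"
    using abs_Re_le_cmod[of "cinner u (E A u)"] norm_cinner_le[of u "E A u"] by linarith
  finally show ?thesis by (cases "E A u = 0") (auto simp: power2_eq_square)
qed

text \<open>If \<open>G\<close> is positive and \<open>A\<close> lies in the negative half-line, then \<open>w = (G + 1)\<inverse> E A x\<close> satisfies
  \<open>\<integral>\<^sub>A s d(w, E w) \<ge> 0\<close>, which forces \<open>E A w = 0\<close> and hence \<open>E A x = 0\<close>.\<close>

lemma E_negative:
  assumes G: "self_adjoint_op G" "positive_op G" "G = spectral_integral E (\<lambda>s. s)"
    and A: "A \<in> sets borel" "A \<subseteq> {-K..<0}"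
  shows "E A x = 0"
proof -
  define \<phi> where "\<phi> = E A x"
  define w where "w = resolvent G (-1) \<phi>"
  have wG: "(w, \<phi> - w) \<in> G"
    using self_adjoint_resolvent[OF G(1,2), of "-1" \<phi>] by (simp add: w_def scaleC_minus_one)
  have E\<phi>: "E A \<phi> = \<phi>" unfolding \<phi>_def by (rule E_idem[OF A(1)])
  define f where "f s = indicator A s * s" for s :: real
  have f: "bborel f" unfolding f_def
    using A by (intro bborelI[of _ "\<bar>K\<bar>"]) (auto simp: indicator_def subset_iff)
  have AK: "A \<subseteq> {-K..K}" using A(2) by (auto simp: subset_iff)
  have E_diff: "E A (\<phi> - w) = \<phi> - E A w"
    using E_add[OF A(1), of \<phi> "(-1) *\<^sub>C w"] E_scaleC[OF A(1), of "-1" w] by (simp add: scaleC_minus_one E\<phi>)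
  have eq: "cinner v \<phi> - cinner v (E A w) = P f v w" for v
    using cinner_E_spectral_integral[OF wG[unfolded G(3)] A(1) AK, of v]
    by (simp add: f_def[abs_def] E_diff cinner_diff_right)
  have "0 \<le> Re (cinner w (\<phi> - w))" using G(2) wG by (auto simp: positive_op_def)
  then have "(norm w)\<^sup>2 \<le> Re (cinner w \<phi>)" by (simp add: cinner_diff_right cinner_norm)
  also have "\<dots> = (norm (E A w))\<^sup>2 + (LINT s|M w. f s)"
    using arg_cong[OF eq[of w], of Re] A(1) by (simp add: P_diagonal[OF f] cinner_E_self)
  also have "(norm (E A w))\<^sup>2 \<le> (norm w)\<^sup>2" using norm_E_le[OF A(1)] by (intro power_mono) auto
  finally have ge: "0 \<le> (LINT s|M w. f s)" by simp
  have neg: "f s \<le> 0" for s using A(2) by (auto simp: f_def indicator_def)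
  have "(LINT s|M w. - f s) = 0"
  proof -
    have "0 \<le> (LINT s|M w. - f s)" by (rule integral_nonneg_AE) (simp add: neg)
    then show ?thesis using ge by simp
  qed
  then have "AE s in M w. - f s = 0"
    using integrable_M[OF f, of w] neg by (subst (asm) integral_nonneg_eq_0_iff_AE) auto
  then have "AE s in M w. s \<notin> A"
    by eventually_elim (use A(2) in \<open>auto simp: f_def indicator_def split: if_splits\<close>)
  then have "emeasure (M w) A = 0" using A(1) by (subst (asm) AE_iff_null_sets[symmetric]) auto
  then have EAw: "E A w = 0" using A(1) by (simp add: emeasure_M)
  have "cinner v \<phi> = cinner v 0" for v
  proof -
    have ff: "(\<lambda>s. f s * indicator A s) = f" by (auto simp: f_def indicator_def)
    have "P f v w = P f v (T (indicator A) w)" by (simp add: P_T[OF f bborel_indicator[OF A(1)]] ff)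
    also have "\<dots> = 0" by (simp add: T_indicator A(1) EAw P_zero_right f)
    finally show ?thesis using eq[of v] EAw by simp
  qed
  then show ?thesis unfolding \<phi>_def[symmetric] by (rule cinner_eqI)
qed

lemma M_nonneg:
  assumes G: "self_adjoint_op G" "positive_op G" "G = spectral_integral E (\<lambda>s. s)"
  shows "AE s in M u. 0 \<le> s"
proof -
  have "{- real n..<0} \<in> null_sets (M u)" for n
    by (rule null_setsI) (auto simp: emeasure_M E_negative[OF G, of _ "real n"])
  then have "AE s in M u. \<forall>n. s \<notin> {- real n..<0}"
    unfolding AE_all_countable by (intro allI AE_not_in)
  then show ?thesis
  proof eventually_elim
    case (elim s)
    obtain n where "- s \<le> real n" using real_arch_simple by blast
    then show ?case using elim[rule_format, of n] by auto
  qed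
qed

lemma P_cong_nonneg:
  assumes "\<And>u. AE s in M u. 0 \<le> s" "f \<in> borel_measurable borel" "g \<in> borel_measurable borel"
    "\<And>s. 0 \<le> s \<Longrightarrow> f s = g s"
  shows "P f v u = P g v u"
proof -
  have "(LINT s|M x. f s) = (LINT s|M x. g s)" for x
    by (rule integral_cong_AE, use assms in \<open>auto intro: AE_mp[OF assms(1)]\<close>)
  then show ?thesis by (simp add: polarized_integral_def)
qed

lemma cinner_resolvent:
  assumes G: "self_adjoint_op G" "positive_op G" "G = spectral_integral E (\<lambda>s. s)" and k: "0 < \<kappa>"
  shows "cinner v (resolvent G (complex_of_real (- \<kappa>)) \<phi>) = P (\<lambda>s. if 0 \<le> s then 1 / (s + \<kappa>) else 0) v \<phi>"
proof -
  note nonneg = M_nonneg[OF G]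
  define w where "w = resolvent G (complex_of_real (- \<kappa>)) \<phi>"
  have wG: "(w, \<phi> - \<kappa> *\<^sub>R w) \<in> G"
    using self_adjoint_resolvent[OF G(1,2), of "complex_of_real (- \<kappa>)" \<phi>] k
    by (simp add: w_def scaleR_L2_def scaleC_minus_one[symmetric] scaleC_scaleC del: scaleC_minus_one)
       (metis (no_types, lifting) add_uminus_conv_diff scaleC_minus_one scaleC_scaleC mult_minus1)
  define g where "g s = (if 0 \<le> s then 1 / (s + \<kappa>) else 0)" for s :: real
  have g: "bborel g" unfolding g_def
  proof (rule bborelI[of _ "1 / \<kappa>"])
    show "\<bar>if 0 \<le> s then 1 / (s + \<kappa>) else 0\<bar> \<le> 1 / \<kappa>" for s
      using k by (auto intro!: divide_left_mono mult_pos_pos)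
  qed measurable
  have step: "P (\<lambda>s. g s * indicator {0..real n} s) v \<phi> = P (indicator {0..real n}) v w" for n :: nat
  proof -
    let ?B = "{0..real n}"
    define h where "h s = indicator ?B s * s + \<kappa> * indicator ?B s" for s :: real
    have id: "bborel (\<lambda>s. indicator ?B s * s)"
      by (rule bborelI[of _ "real n"]) (auto simp: indicator_def)
    have h: "bborel h" unfolding h_def
      by (intro bborel_add bborel_mult id bborel_const bborel_indicator) auto
    have "E ?B \<phi> = T h w"
    proof (rule cinner_eqI)
      fix v
      have "cinner v (E ?B (\<phi> - \<kappa> *\<^sub>R w)) = P (\<lambda>s. indicator ?B s * s) v w"
        by (rule cinner_E_spectral_integral[OF wG[unfolded G(3)], of _ "real n"]) auto
      moreover have "E ?B (\<phi> - \<kappa> *\<^sub>R w) = E ?B \<phi> - \<kappa> *\<^sub>R E ?B w"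
        using E_add[of ?B \<phi> "complex_of_real (- \<kappa>) *\<^sub>C w"] E_scaleC[of ?B "complex_of_real (- \<kappa>)" w]
        by (simp add: scaleC_of_real del: of_real_minus)
      ultimately have "cinner v (E ?B \<phi>) = P (\<lambda>s. indicator ?B s * s) v w + complex_of_real \<kappa> * cinner v (E ?B w)"
        by (simp add: cinner_simps algebra_simps)
      also have "\<dots> = P h v w"
        unfolding h_def using id
        by (simp add: P_add P_mult P_indicator bborel_mult bborel_const bborel_indicator)
      finally show "cinner v (E ?B \<phi>) = cinner v (T h w)" by (simp add: P_eq_cinner_T h)
    qed
    then have "P g v (T (indicator ?B) \<phi>) = P g v (T h w)" by (simp add: T_indicator)
    then have "P (\<lambda>s. g s * indicator ?B s) v \<phi> = P (\<lambda>s. g s * h s) v w"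
      by (simp add: P_T g h bborel_indicator)
    also have "(\<lambda>s. g s * h s) = indicator ?B"
      using k by (auto simp: g_def h_def indicator_def fun_eq_iff)
    finally show ?thesis .
  qed
  have ind_lim: "(\<lambda>n. indicator {0..real n} s) \<longlonglongrightarrow> (indicator {0..} s :: real)" for s :: real
  proof -
    obtain N where N: "s \<le> real N" using real_arch_simple by blast
    have "indicator {0..real n} s = (indicator {0..} s :: real)" if "N \<le> n" for n
      using N that by (auto simp: indicator_def)
    then show ?thesis by (intro tendsto_eventually eventually_sequentiallyI[of N])
  qed
  obtain L where L: "0 \<le> L" "\<And>s. \<bar>g s\<bar> \<le> L" using g by (rule bborel_bound) blast
  have [measurable]: "g \<in> borel_measurable borel" by (rule bborelD[OF g])
  have "(\<lambda>n. P (\<lambda>s. g s * indicator {0..real n} s) v \<phi>) \<longlonglongrightarrow> P g v \<phi>"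
  proof (rule tendsto_P_bounded)
    show "\<bar>g s * indicator {0..real n} s\<bar> \<le> L" for n s using L by (auto simp: indicator_def)
    show "(\<lambda>n. g s * indicator {0..real n} s) \<longlonglongrightarrow> g s" for s
      using tendsto_mult[OF tendsto_const ind_lim, of "g s" s] by (cases "0 \<le> s") (auto simp: g_def)
  qed measurable
  moreover have "(\<lambda>n. P (indicator {0..real n}) v w) \<longlonglongrightarrow> P (indicator {0..}) v w"
  proof (rule tendsto_P_bounded)
    show "\<bar>indicator {0..real n} s\<bar> \<le> (1 :: real)" for n s by (simp add: indicator_def)
  qed (simp_all add: ind_lim)
  moreover have "P (indicator {0..}) v w = P (indicator UNIV) v w"
    by (rule P_cong_nonneg[OF nonneg]) auto
  ultimately have "P g v \<phi> = P (indicator UNIV) v w"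
    unfolding step using LIMSEQ_unique by metis
  also have "\<dots> = cinner v w" using P_indicator[of UNIV v w] by (simp add: E_UNIV)
  finally show ?thesis by (simp add: w_def g_def[abs_def])
qed

end

section \<open>Laplace transforms\<close>

definition exp_ind :: "real \<Rightarrow> real \<Rightarrow> real" where
  "exp_ind l \<tau> = indicator {0<..} \<tau> * exp (- (l * \<tau>))"

lemma measurable_exp_ind [measurable]: "exp_ind l \<in> borel_measurable borel"
  unfolding exp_ind_def[abs_def] by measurable

lemma exp_ind_nonneg: "0 \<le> exp_ind l \<tau>"
  by (simp add: exp_ind_def)

lemma tendsto_exp_neg_mult_at_top:
  assumes "0 < l" shows "((\<lambda>\<tau>. exp (- (l * \<tau>))) \<longlongrightarrow> (0::real)) at_top"
proof -
  have "filterlim (\<lambda>\<tau>. l * \<tau>) at_top at_top"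
    using assms by (intro filterlim_tendsto_pos_mult_at_top[OF tendsto_const] filterlim_ident)
  then show ?thesis
    by (intro filterlim_compose[OF exp_at_bot] filterlim_uminus_at_bot_at_top[THEN filterlim_compose])
qed

lemma integrable_exp_ind:
  assumes l: "0 < l"
  shows "integrable lborel (exp_ind l)"
proof (rule integrableI_bounded)
  have "(\<integral>\<^sup>+\<tau>. ennreal (norm (exp_ind l \<tau>)) \<partial>lborel) \<le> (\<integral>\<^sup>+\<tau>. ennreal (exp (- (l * \<tau>))) * indicator {0..} \<tau> \<partial>lborel)"
    by (intro nn_integral_mono) (auto simp: exp_ind_def indicator_def)
  also have "\<dots> = ennreal (0 - (- (exp (- (l * 0)) / l)))"
  proof (rule nn_integral_FTC_atLeast)
    show "((\<lambda>\<tau>. - (exp (- (l * \<tau>)) / l)) has_real_derivative exp (- (l * \<tau>))) (at \<tau>)" for \<tau>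
      using l by (auto intro!: derivative_eq_intros)
    from tendsto_minus[OF tendsto_divide[OF tendsto_exp_neg_mult_at_top[OF l] tendsto_const, of l]] l
    show "((\<lambda>\<tau>. - (exp (- (l * \<tau>)) / l)) \<longlongrightarrow> 0) at_top" by simp
  qed auto
  also have "\<dots> < \<infinity>" by simp
  finally show "(\<integral>\<^sup>+\<tau>. ennreal (norm (exp_ind l \<tau>)) \<partial>lborel) < \<infinity>" .
qed simp

lemma integrable_exp_ind_mult:
  fixes g :: "real \<Rightarrow> 'b::{banach, second_countable_topology, real_normed_algebra_1}"
  assumes l: "0 < l" and g: "g \<in> borel_measurable borel" "\<And>\<tau>. norm (g \<tau>) \<le> K"
  shows "integrable lborel (\<lambda>\<tau>. of_real (exp_ind l \<tau>) * g \<tau>)"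
proof (rule Bochner_Integration.integrable_bound)
  show "integrable lborel (\<lambda>\<tau>. exp_ind l \<tau> * K)" using integrable_exp_ind[OF l] by simp
  show "(\<lambda>\<tau>. of_real (exp_ind l \<tau>) * g \<tau>) \<in> borel_measurable lborel" using g(1) by measurable
  show "AE \<tau> in lborel. norm (of_real (exp_ind l \<tau>) * g \<tau>) \<le> norm (exp_ind l \<tau> * K)"
  proof (rule AE_I2)
    fix \<tau>
    have "norm (of_real (exp_ind l \<tau>) * g \<tau>) \<le> exp_ind l \<tau> * norm (g \<tau>)"
      using norm_mult_ineq[of "of_real (exp_ind l \<tau>)" "g \<tau>"] by (simp add: exp_ind_nonneg)
    also have "\<dots> \<le> exp_ind l \<tau> * K" using g(2) by (intro mult_left_mono exp_ind_nonneg)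
    finally show "norm (of_real (exp_ind l \<tau>) * g \<tau>) \<le> norm (exp_ind l \<tau> * K)" by simp
  qed
qed

lemma laplace_cos:
  assumes l: "0 < l"
  shows "(LINT \<tau>|lborel. exp_ind l \<tau> * cos (\<tau> * a)) = l / (l\<^sup>2 + a\<^sup>2)"
proof -
  have pos: "0 < l\<^sup>2 + a\<^sup>2" using l by (simp add: add_pos_nonneg)
  define F where "F \<tau> = exp (- (l * \<tau>)) * ((a * sin (\<tau> * a) - l * cos (\<tau> * a)) / (l\<^sup>2 + a\<^sup>2))" for \<tau>
  have "(LBINT \<tau>=0..\<infinity>. exp (- (l * \<tau>)) * cos (\<tau> * a)) = 0 - (- l / (l\<^sup>2 + a\<^sup>2))"
  proof (rule interval_integral_FTC_integrable[where F = F])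
    show "(F has_vector_derivative exp (- (l * \<tau>)) * cos (\<tau> * a)) (at \<tau>)" for \<tau>
    proof -
      define D where "D = l\<^sup>2 + a\<^sup>2"
      have "((\<lambda>\<tau>. exp (- (l * \<tau>)) * (a * sin (\<tau> * a) - l * cos (\<tau> * a))) has_real_derivative
          exp (- (l * \<tau>)) * cos (\<tau> * a) * D) (at \<tau>)"
        unfolding D_def by (auto intro!: derivative_eq_intros simp: power2_eq_square algebra_simps)
      from DERIV_cdivide[OF this, of D] show ?thesis
        using pos unfolding F_def[abs_def] D_def[symmetric]
        by (simp add: has_real_derivative_iff_has_vector_derivative)
    qed
    show "isCont (\<lambda>\<tau>. exp (- (l * \<tau>)) * cos (\<tau> * a)) \<tau>" for \<tau> by (intro continuous_intros)
    have "einterval 0 \<infinity> = {0<..}" by (auto simp: einterval_def)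
    then show "set_integrable lborel (einterval 0 \<infinity>) (\<lambda>\<tau>. exp (- (l * \<tau>)) * cos (\<tau> * a))"
      using integrable_exp_ind_mult[OF l, of "\<lambda>\<tau>. cos (\<tau> * a)" 1]
      by (simp add: set_integrable_def exp_ind_def mult.assoc)
    have "isCont F 0" unfolding F_def using pos by (intro continuous_intros) auto
    then have "(F \<longlongrightarrow> F 0) (at_right 0)" by (simp add: isCont_def filterlim_at_split)
    then show "((F \<circ> real_of_ereal) \<longlongrightarrow> - l / (l\<^sup>2 + a\<^sup>2)) (at_right 0)"
      unfolding zero_ereal_def ereal_tendsto_simps by (simp add: F_def)
    have "(F \<longlongrightarrow> 0) at_top"
    proof (rule Lim_null_comparison)
      show "\<forall>\<^sub>F \<tau> in at_top. norm (F \<tau>) \<le> exp (- (l * \<tau>)) * ((\<bar>a\<bar> + l) / (l\<^sup>2 + a\<^sup>2))"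
      proof (rule always_eventually, rule allI)
        fix \<tau>
        have "\<bar>a * sin (\<tau> * a) - l * cos (\<tau> * a)\<bar> \<le> \<bar>a * sin (\<tau> * a)\<bar> + \<bar>l * cos (\<tau> * a)\<bar>"
          by (rule abs_triangle_ineq4)
        also have "\<dots> \<le> \<bar>a\<bar> * 1 + l * 1"
          using l unfolding abs_mult by (intro add_mono mult_mono) auto
        finally have "\<bar>a * sin (\<tau> * a) - l * cos (\<tau> * a)\<bar> / (l\<^sup>2 + a\<^sup>2) \<le> (\<bar>a\<bar> + l) / (l\<^sup>2 + a\<^sup>2)"
          using pos by (intro divide_right_mono) auto
        from mult_left_mono[OF this, of "exp (- (l * \<tau>))"]
        show "norm (F \<tau>) \<le> exp (- (l * \<tau>)) * ((\<bar>a\<bar> + l) / (l\<^sup>2 + a\<^sup>2))"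
          using pos by (simp add: F_def abs_mult)
      qed
      from tendsto_mult_left_zero[OF tendsto_exp_neg_mult_at_top[OF l]]
      show "((\<lambda>\<tau>. exp (- (l * \<tau>)) * ((\<bar>a\<bar> + l) / (l\<^sup>2 + a\<^sup>2))) \<longlongrightarrow> 0) at_top" .
    qed
    then show "((F \<circ> real_of_ereal) \<longlongrightarrow> 0) (at_left \<infinity>)" by (simp add: ereal_tendsto_simps)
  qed auto
  moreover have "(LBINT \<tau>=0..\<infinity>. exp (- (l * \<tau>)) * cos (\<tau> * a)) = (LINT \<tau>|lborel. exp_ind l \<tau> * cos (\<tau> * a))"
  proof -
    have "einterval 0 \<infinity> = {0<..}" by (auto simp: einterval_def)
    then show ?thesis
      by (simp add: interval_lebesgue_integral_def set_lebesgue_integral_def exp_ind_def mult.assoc)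
  qed
  ultimately show ?thesis by simp
qed

context pvm
begin

lemma laplace_M:
  assumes nonneg: "AE s in M x. 0 \<le> s" and l: "0 < l"
  shows "(LINT \<tau>|lborel. exp_ind l \<tau> * (LINT s|M x. cos (\<tau> * sqrt s)))
    = l * (LINT s|M x. (if 0 \<le> s then 1 / (s + l\<^sup>2) else 0))"
proof -
  interpret Mx: finite_measure "M x" by (rule finite_measure_M)
  interpret pair_sigma_finite lborel "M x" ..
  define f where "f \<tau> s = exp_ind l \<tau> * cos (\<tau> * sqrt s)" for \<tau> s
  have [measurable]: "case_prod f \<in> borel_measurable (lborel \<Otimes>\<^sub>M M x)"
    unfolding f_def by measurable
  have "integrable (lborel \<Otimes>\<^sub>M M x) (case_prod f)"
  proof (rule Bochner_Integration.integrable_bound)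
    show "integrable (lborel \<Otimes>\<^sub>M M x) (\<lambda>(\<tau>, s). exp_ind l \<tau>)"
      by (rule Fubini_integrable) (auto simp: exp_ind_nonneg integrable_exp_ind[OF l] split_beta')
    show "AE z in lborel \<Otimes>\<^sub>M M x. norm (case_prod f z) \<le> norm (case z of (\<tau>, s) \<Rightarrow> exp_ind l \<tau>)"
      by (intro AE_I2) (auto simp: f_def abs_mult exp_ind_nonneg mult_left_le split: prod.split)
  qed simp
  from Fubini_integral[OF this]
  have "(LINT \<tau>|lborel. LINT s|M x. f \<tau> s) = (LINT s|M x. LINT \<tau>|lborel. f \<tau> s)" ..
  also have "\<dots> = (LINT s|M x. l * (if 0 \<le> s then 1 / (s + l\<^sup>2) else 0))"
  proof (rule integral_cong_AE)
    show "AE s in M x. (LINT \<tau>|lborel. f \<tau> s) = l * (if 0 \<le> s then 1 / (s + l\<^sup>2) else 0)"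
      using nonneg by eventually_elim (simp add: f_def laplace_cos[OF l] add.commute)
    show "(\<lambda>s. LINT \<tau>|lborel. f \<tau> s) \<in> borel_measurable (M x)"
      by (rule lborel.borel_measurable_lebesgue_integral)
         (simp add: f_def, measurable)
  qed measurable
  finally show ?thesis by (simp add: f_def)
qed

lemma bborel_cos: "bborel (\<lambda>s. cos (\<tau> * sqrt s))"
  by (rule bborelI[of _ 1]) auto

lemma continuous_P_cos: "continuous_on UNIV (\<lambda>\<tau>. P (\<lambda>s. cos (\<tau> * sqrt s)) v u)"
proof (rule continuous_at_imp_continuous_on, intro ballI)
  fix \<tau> :: real
  show "isCont (\<lambda>\<tau>. P (\<lambda>s. cos (\<tau> * sqrt s)) v u) \<tau>"
    unfolding continuous_at_sequentially
  proof (intro allI impI)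
    fix X assume "X \<longlonglongrightarrow> \<tau>"
    then show "((\<lambda>\<tau>. P (\<lambda>s. cos (\<tau> * sqrt s)) v u) \<circ> X) \<longlonglongrightarrow> P (\<lambda>s. cos (\<tau> * sqrt s)) v u"
      unfolding o_def
      by (intro tendsto_P_bounded[where K = 1] tendsto_intros) auto
  qed
qed

lemma laplace_P:
  assumes nonneg: "\<And>x. AE s in M x. 0 \<le> s" and l: "0 < l"
  shows "(LINT \<tau>|lborel. complex_of_real (exp_ind l \<tau>) * P (\<lambda>s. cos (\<tau> * sqrt s)) v u)
    = complex_of_real l * P (\<lambda>s. if 0 \<le> s then 1 / (s + l\<^sup>2) else 0) v u"
proof -
  define G where "G k \<tau> = (LINT s|M (u + \<i> ^ k *\<^sub>C v). cos (\<tau> * sqrt s))" for k :: nat and \<tau>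
  have G_le: "\<bar>G k \<tau>\<bar> \<le> (norm (u + \<i> ^ k *\<^sub>C v))\<^sup>2" for k \<tau>
    using abs_integral_M_le[OF bborel_cos, of \<tau> 1 "u + \<i> ^ k *\<^sub>C v"] by (simp add: G_def)
  have G_meas: "G k \<in> borel_measurable borel" for k
  proof -
    interpret finite_measure "M (u + \<i> ^ k *\<^sub>C v)" by (rule finite_measure_M)
    show ?thesis unfolding G_def[abs_def]
      by (rule borel_measurable_lebesgue_integral) measurable
  qed
  have int: "integrable lborel (\<lambda>\<tau>. exp_ind l \<tau> * G k \<tau>)" for k
    using integrable_exp_ind_mult[OF l G_meas, of k] G_le[of k] by auto
  have "(LINT \<tau>|lborel. complex_of_real (exp_ind l \<tau>) * P (\<lambda>s. cos (\<tau> * sqrt s)) v u)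
    = (LINT \<tau>|lborel. (\<Sum>k<4. \<i> ^ k / 4 * complex_of_real (exp_ind l \<tau> * G k \<tau>)))"
    by (simp add: polarized_integral_def G_def sum_distrib_left sum_divide_distrib mult_ac)
  also have "\<dots> = (\<Sum>k<4. LINT \<tau>|lborel. \<i> ^ k / 4 * complex_of_real (exp_ind l \<tau> * G k \<tau>))"
    using int by (intro Bochner_Integration.integral_sum integrable_mult_right integrable_of_real)
  also have "\<dots> = (\<Sum>k<4. \<i> ^ k / 4 * complex_of_real (LINT \<tau>|lborel. exp_ind l \<tau> * G k \<tau>))"
    by (simp only: integral_mult_right_zero integral_complex_of_real)
  also have "\<dots> = complex_of_real l * P (\<lambda>s. if 0 \<le> s then 1 / (s + l\<^sup>2) else 0) v u"
    unfolding G_def laplace_M[OF nonneg l]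
    by (simp add: polarized_integral_def sum_distrib_left sum_divide_distrib mult_ac)
  finally show ?thesis .
qed

end

text \<open>The series \<open>\<Sum>k\<ge>1. (-1)\<^sup>k\<^sup>-\<^sup>1 / k! exp (k n (y - \<tau>)) = 1 - exp (- exp (n (y - \<tau>)))\<close> converges to
  the indicator function of \<open>\<tau> < y\<close> as \<open>n \<rightarrow> \<infinity>\<close>. Integrated against \<open>g\<close>, it only involves the values of the
  Laplace transform at multiples of \<open>n\<close>, and these are exponentially small.\<close>

lemma sums_exp_Suc: "(\<lambda>k. x ^ Suc k / fact (Suc k)) sums (exp x - 1)" for x :: real
  using exp_converges[of x] sums_Suc_iff[of "\<lambda>k. x ^ k / fact k" "exp x - 1"]
  by (simp add: divide_inverse mult.commute del: power_Suc)

lemma laplace_decay_imp_integral_zero: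
  fixes g :: "real \<Rightarrow> complex"
  assumes g: "g \<in> borel_measurable borel" and K: "\<And>\<tau>. cmod (g \<tau>) \<le> K"
    and decay: "\<And>n::nat. n \<ge> 1 \<Longrightarrow>
      cmod (LINT \<tau>|lborel. complex_of_real (exp_ind (real n) \<tau>) * g \<tau>) \<le> N * exp (- (real n * T))"
    and y: "0 < y" "y < T"
  shows "(LINT \<tau>|lborel. complex_of_real (indicator {0<..<y} \<tau>) * g \<tau>) = 0"
proof -
  note [measurable] = g
  have K0: "0 \<le> K" using K[of 0] norm_ge_zero order_trans by blast
  define q where "q n \<tau> = exp (real (Suc n) * (y - \<tau>))" for n :: nat and \<tau> :: real
  define S where "S n \<tau> = complex_of_real (indicator {0<..} \<tau> * (1 - exp (- q n \<tau>))) * g \<tau>" for n \<tau>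
  have bound: "cmod (LINT \<tau>|lborel. S n \<tau>) \<le> N * (exp (exp (- (real (Suc n) * (T - y)))) - 1)" for n
  proof -
    define m where "m k = Suc n * Suc k" for k
    have m: "1 \<le> m k" "0 < real (m k)" "1 \<le> real (m k)" for k
    proof -
      show *: "1 \<le> m k" by (simp add: m_def)
      from * show "0 < real (m k)" "1 \<le> real (m k)" by linarith+
    qed
    define c where "c k = - ((-1) ^ Suc k / fact (Suc k) * exp (real (m k) * y))" for k
    define a where "a k \<tau> = complex_of_real (c k) * (complex_of_real (exp_ind (real (m k)) \<tau>) * g \<tau>)" for k \<tau>
    have mk: "real (m k) = real (Suc n) * real (Suc k)" for k by (simp only: m_def of_nat_mult)
    have qk: "q n \<tau> ^ Suc k = exp (real (m k) * y) * exp (- (real (m k) * \<tau>))" for k \<tau>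
      by (simp add: q_def mk exp_of_nat_mult[symmetric] exp_add[symmetric] algebra_simps del: power_Suc of_nat_Suc)
    have a_eq: "a k \<tau> = complex_of_real (indicator {0<..} \<tau> * (- ((- q n \<tau>) ^ Suc k / fact (Suc k)))) * g \<tau>" for k \<tau>
      unfolding power_minus[of "q n \<tau>"] qk by (simp add: a_def c_def exp_ind_def del: power_Suc fact_Suc)
    have a_sums: "(\<lambda>k. a k \<tau>) sums S n \<tau>" for \<tau>
    proof -
      have "(\<lambda>k. indicator {0<..} \<tau> * (- ((- q n \<tau>) ^ Suc k / fact (Suc k)))) sums (indicator {0<..} \<tau> * (- (exp (- q n \<tau>) - 1)))"
        by (intro sums_mult sums_minus sums_exp_Suc)
      then have "(\<lambda>k. complex_of_real (indicator {0<..} \<tau> * (- ((- q n \<tau>) ^ Suc k / fact (Suc k))))) sums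
          complex_of_real (indicator {0<..} \<tau> * (- (exp (- q n \<tau>) - 1)))"
        by (rule sums_of_real)
      from sums_mult2[OF this, of "g \<tau>"] show ?thesis by (simp add: a_eq S_def)
    qed
    have a_int: "integrable lborel (a k)" for k
      unfolding a_def[abs_def]
      by (intro integrable_mult_right integrable_exp_ind_mult[OF m(2) g K])
    have norm_a: "norm (a k \<tau>) \<le> \<bar>c k\<bar> * K * exp_ind 1 \<tau>" for k \<tau>
    proof -
      have "exp_ind (real (m k)) \<tau> \<le> exp_ind 1 \<tau>"
        using m(3)[of k] by (auto simp: exp_ind_def indicator_def mult_right_mono)
      then have "exp_ind (real (m k)) \<tau> * cmod (g \<tau>) \<le> exp_ind 1 \<tau> * K"
        by (intro mult_mono K exp_ind_nonneg) auto
      then have "\<bar>c k\<bar> * (exp_ind (real (m k)) \<tau> * cmod (g \<tau>)) \<le> \<bar>c k\<bar> * (exp_ind 1 \<tau> * K)"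
        by (intro mult_left_mono) auto
      then show ?thesis by (simp add: a_def norm_mult exp_ind_nonneg mult_ac)
    qed
    have abs_c: "\<bar>c k\<bar> = exp (real (Suc n) * y) ^ Suc k / fact (Suc k)" for k
      by (simp add: c_def mk abs_mult exp_of_nat_mult[symmetric] mult_ac del: power_Suc fact_Suc of_nat_Suc)
    have c_summable: "summable (\<lambda>k. \<bar>c k\<bar>)"
      unfolding abs_c using sums_exp_Suc by (rule sums_summable)
    have sums: "(\<lambda>k. LINT \<tau>|lborel. a k \<tau>) sums (LINT \<tau>|lborel. (\<Sum>k. a k \<tau>))"
    proof (rule sums_integral[OF a_int])
      have "summable (\<lambda>k. norm (a k \<tau>))" for \<tau>
        by (rule summable_comparison_test'[OF summable_mult2[OF summable_mult2[OF c_summable]], of 0 _ K "exp_ind 1 \<tau>"])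
           (use norm_a in auto)
      then show "AE \<tau> in lborel. summable (\<lambda>k. norm (a k \<tau>))" by auto
      have "(LINT \<tau>|lborel. norm (a k \<tau>)) \<le> \<bar>c k\<bar> * K * (LINT \<tau>|lborel. exp_ind 1 \<tau>)" for k
      proof -
        have "(LINT \<tau>|lborel. norm (a k \<tau>)) \<le> (LINT \<tau>|lborel. \<bar>c k\<bar> * K * exp_ind 1 \<tau>)"
          using a_int norm_a integrable_exp_ind[of 1] by (intro integral_mono) auto
        then show ?thesis by simp
      qed
      then show "summable (\<lambda>k. LINT \<tau>|lborel. norm (a k \<tau>))"
        by (intro summable_comparison_test'[OF summable_mult2[OF summable_mult2[OF c_summable]], of 0 _ K "LINT \<tau>|lborel. exp_ind 1 \<tau>"]) auto
    qed
    have term_le: "norm (LINT \<tau>|lborel. a k \<tau>) \<le> N * (exp (- (real (Suc n) * (T - y))) ^ Suc k / fact (Suc k))" for k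
    proof -
      have "norm (LINT \<tau>|lborel. a k \<tau>) = \<bar>c k\<bar> * cmod (LINT \<tau>|lborel. complex_of_real (exp_ind (real (m k)) \<tau>) * g \<tau>)"
        by (simp add: a_def norm_mult)
      also have "\<dots> \<le> \<bar>c k\<bar> * (N * exp (- (real (m k) * T)))"
        by (intro mult_left_mono decay m(1)) auto
      also have "\<dots> = N * (exp (- (real (Suc n) * (T - y))) ^ Suc k / fact (Suc k))"
        unfolding abs_c by (simp add: mk exp_of_nat_mult[symmetric] exp_add[symmetric] algebra_simps del: power_Suc fact_Suc of_nat_Suc)
      finally show ?thesis .
    qed
    have "(LINT \<tau>|lborel. S n \<tau>) = (\<Sum>k. LINT \<tau>|lborel. a k \<tau>)"
      using sums_unique[OF sums] sums_unique[OF a_sums] by simp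
    also have "norm \<dots> \<le> (\<Sum>k. N * (exp (- (real (Suc n) * (T - y))) ^ Suc k / fact (Suc k)))"
      by (intro norm_suminf_le term_le sums_summable[OF sums_mult[OF sums_exp_Suc]])
    also have "\<dots> = N * (exp (exp (- (real (Suc n) * (T - y)))) - 1)"
      by (rule sums_unique[symmetric]) (intro sums_mult sums_exp_Suc)
    finally show ?thesis .
  qed
  have lin: "filterlim (\<lambda>n. real (Suc n) * b) at_top sequentially" if "0 < b" for b
    using that filterlim_compose[OF filterlim_real_sequentially filterlim_Suc]
    by (intro filterlim_at_top_mult_tendsto_pos[OF tendsto_const]) auto
  have "(\<lambda>n. N * (exp (exp (- (real (Suc n) * (T - y)))) - 1)) \<longlonglongrightarrow> N * (exp 0 - 1)"
    using y by (intro tendsto_intros filterlim_compose[OF exp_at_bot]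
        filterlim_compose[OF filterlim_uminus_at_bot_at_top] lin) auto
  then have lim: "(\<lambda>n. N * (exp (exp (- (real (Suc n) * (T - y)))) - 1)) \<longlonglongrightarrow> 0" by simp
  have "(\<lambda>n. LINT \<tau>|lborel. S n \<tau>) \<longlonglongrightarrow> 0"
    by (rule Lim_null_comparison[OF always_eventually lim]) (intro allI bound)
  moreover have "(\<lambda>n. LINT \<tau>|lborel. S n \<tau>) \<longlonglongrightarrow> (LINT \<tau>|lborel. complex_of_real (indicator {0<..<y} \<tau>) * g \<tau>)"
  proof (rule integral_dominated_convergence[where w = "\<lambda>\<tau>. exp y * exp_ind 1 \<tau> * K"])
    show "integrable lborel (\<lambda>\<tau>. exp y * exp_ind 1 \<tau> * K)" using integrable_exp_ind[of 1] by simp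
    show "S n \<in> borel_measurable lborel" for n unfolding S_def[abs_def] q_def by measurable
    show "AE \<tau> in lborel. norm (S n \<tau>) \<le> exp y * exp_ind 1 \<tau> * K" for n
    proof (rule AE_I2)
      fix \<tau> :: real
      have "1 - exp (- q n \<tau>) \<le> exp (y - \<tau>)"
      proof (cases "\<tau> \<le> y")
        case True
        then have "1 \<le> exp (y - \<tau>)" by simp
        then show ?thesis using exp_gt_zero[of "- q n \<tau>"] by linarith
      next
        case False
        have "1 - exp (- q n \<tau>) \<le> q n \<tau>" using exp_ge_add_one_self[of "- q n \<tau>"] by linarith
        also have "\<dots> \<le> exp (y - \<tau>)"
          using mult_right_mono_neg[of 1 "real (Suc n)" "y - \<tau>"] False by (simp add: q_def)
        finally show ?thesis .
      qed
      moreover have "0 \<le> 1 - exp (- q n \<tau>)" by (simp add: q_def)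
      ultimately have "indicator {0<..} \<tau> * ((1 - exp (- q n \<tau>)) * cmod (g \<tau>)) \<le> indicator {0<..} \<tau> * (exp (y - \<tau>) * K)"
        by (intro mult_left_mono mult_mono K) auto
      moreover have "norm (S n \<tau>) = indicator {0<..} \<tau> * ((1 - exp (- q n \<tau>)) * cmod (g \<tau>))"
        unfolding S_def norm_mult norm_of_real abs_mult using \<open>0 \<le> 1 - exp (- q n \<tau>)\<close> by simp
      moreover have "exp y * exp_ind 1 \<tau> * K = indicator {0<..} \<tau> * (exp (y - \<tau>) * K)"
        by (simp add: exp_ind_def exp_diff exp_minus divide_inverse)
      ultimately show "norm (S n \<tau>) \<le> exp y * exp_ind 1 \<tau> * K" by (simp only:)
    qed
    have "AE \<tau> in lborel. \<tau> \<noteq> y" by (rule AE_lborel_singleton)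
    then show "AE \<tau> in lborel. (\<lambda>n. S n \<tau>) \<longlonglongrightarrow> complex_of_real (indicator {0<..<y} \<tau>) * g \<tau>"
    proof eventually_elim
      case (elim \<tau>)
      have "(\<lambda>n. 1 - exp (- q n \<tau>)) \<longlonglongrightarrow> (if \<tau> < y then 1 else 0)"
      proof (cases "\<tau> < y")
        case True
        have "filterlim (\<lambda>n. q n \<tau>) at_top sequentially"
          unfolding q_def using True by (intro filterlim_compose[OF exp_at_top] lin) auto
        then have "(\<lambda>n. exp (- q n \<tau>)) \<longlonglongrightarrow> 0"
          by (intro filterlim_compose[OF exp_at_bot] filterlim_compose[OF filterlim_uminus_at_bot_at_top])
        from tendsto_diff[OF tendsto_const this, of 1] True show ?thesis by simp
      next
        case False
        have "(\<lambda>n. exp (- (real (Suc n) * (\<tau> - y)))) \<longlonglongrightarrow> 0"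
          using False elim by (intro filterlim_compose[OF exp_at_bot]
              filterlim_compose[OF filterlim_uminus_at_bot_at_top] lin) auto
        then have "(\<lambda>n. q n \<tau>) \<longlonglongrightarrow> 0" unfolding q_def by (simp add: algebra_simps)
        then have "(\<lambda>n. 1 - exp (- q n \<tau>)) \<longlonglongrightarrow> 1 - exp (- 0)" by (intro tendsto_intros)
        then show ?thesis using False by simp
      qed
      then have "(\<lambda>n. S n \<tau>) \<longlonglongrightarrow> complex_of_real (indicator {0<..} \<tau> * (if \<tau> < y then 1 else 0)) * g \<tau>"
        unfolding S_def by (intro tendsto_intros)
      also have "indicator {0<..} \<tau> * (if \<tau> < y then 1 else 0) = (indicator {0<..<y} \<tau> :: real)"
        by (auto simp: indicator_def)
      finally show ?case .
    qed
  qed measurable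
  ultimately show ?thesis using LIMSEQ_unique by blast
qed

lemma laplace_decay_imp_zero:
  fixes g :: "real \<Rightarrow> complex"
  assumes g: "continuous_on UNIV g" and K: "\<And>\<tau>. cmod (g \<tau>) \<le> K"
    and decay: "\<And>n::nat. n \<ge> 1 \<Longrightarrow>
      cmod (LINT \<tau>|lborel. complex_of_real (exp_ind (real n) \<tau>) * g \<tau>) \<le> N * exp (- (real n * T))"
    and y: "0 < y" "y < T"
  shows "g y = 0"
proof -
  have meas: "g \<in> borel_measurable borel" by (rule borel_measurable_continuous_onI[OF g])
  obtain b where b: "y < b" "b < T" using dense[OF y(2)] by blast
  have zero: "integral {0..z} g = 0" if "0 < z" "z < T" for z
  proof -
    have "set_integrable lborel {0..z} g"
      unfolding set_integrable_def
      by (intro borel_integrable_compact compact_Icc continuous_on_subset[OF g] subset_UNIV)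
    then have "integral {0..z} g = (LINT \<tau>:{0..z}|lborel. g \<tau>)"
      by (rule set_borel_integral_eq_integral(2)[symmetric])
    also have "\<dots> = (LINT \<tau>|lborel. complex_of_real (indicator {0<..<z} \<tau>) * g \<tau>)"
      unfolding set_lebesgue_integral_def
    proof (rule integral_cong_AE)
      have "AE \<tau> in lborel. \<tau> \<noteq> 0" "AE \<tau> in lborel. \<tau> \<noteq> z" by (rule AE_lborel_singleton)+
      then show "AE \<tau> in lborel. indicator {0..z} \<tau> *\<^sub>R g \<tau> = complex_of_real (indicator {0<..<z} \<tau>) * g \<tau>"
        by eventually_elim (auto simp: indicator_def)
    qed (use meas in measurable)
    also have "\<dots> = 0" by (rule laplace_decay_imp_integral_zero[OF meas K decay that])
    finally show ?thesis .
  qed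
  have "((\<lambda>z. integral {0..z} g) has_vector_derivative g y) (at y within {0..b})"
    using y b by (intro integral_has_vector_derivative continuous_on_subset[OF g]) auto
  then have "((\<lambda>z. integral {0..z} g) has_vector_derivative g y) (at y)"
    using y b at_within_Icc_at[of 0 y b] by simp
  moreover have "((\<lambda>z. integral {0..z} g) has_vector_derivative 0) (at y)"
    by (rule has_vector_derivative_transform_within_open[of "\<lambda>_. 0" _ _ "{0<..<b}"])
       (use y b zero in auto)
  ultimately show ?thesis by (rule vector_derivative_unique_at)
qed

section \<open>Finite speed of propagation\<close>

lemma dist_functions_uminus:
  assumes "\<psi> \<in> dist_functions C" shows "(\<lambda>x. - \<psi> x) \<in> dist_functions C"
proof -
  have t: "\<psi> \<in> test_functions" using assms by (simp add: dist_functions_def)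
  have d: "partial_deriv i (\<lambda>x. - \<psi> x) = (\<lambda>x. - partial_deriv i \<psi> x)" for i
    using partial_deriv_cmult[of \<psi> i "-1"] test_functionsD(3)[OF t] by simp
  show ?thesis
    using assms test_functions_cmult[OF t, of "-1"] by (simp add: dist_functions_def d)
qed

lemma dist_functions_le_d_C: "\<psi> \<in> dist_functions C \<Longrightarrow> ereal \<bar>\<psi> x - \<psi> y\<bar> \<le> d_C C x y"
  unfolding d_C_def by (rule SUP_upper)

lemma dist_functions_on_ball:
  assumes "\<psi> \<in> dist_functions C" "y \<in> B_C C x r" shows "\<bar>\<psi> x - \<psi> y\<bar> < r"
proof -
  have "ereal \<bar>\<psi> x - \<psi> y\<bar> < ereal r"
    using le_less_trans[OF dist_functions_le_d_C[OF assms(1)]] assms(2) unfolding B_C_def by blast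
  then show ?thesis by simp
qed

lemma B_C_disjoint:
  assumes "ereal (r1 + r2) \<le> d_C C x1 x2" shows "B_C C x1 r1 \<inter> B_C C x2 r2 = {}"
proof (rule ccontr)
  assume "B_C C x1 r1 \<inter> B_C C x2 r2 \<noteq> {}"
  then obtain y where y: "d_C C x1 y < ereal r1" "d_C C x2 y < ereal r2" by (auto simp: B_C_def)
  have "(\<lambda>x. 0) \<in> dist_functions C"
    using C_k_const[of _ 0]
    by (auto simp: dist_functions_def partial_deriv_const intro!: test_functionsI[of _ "{}"])
  from dist_functions_le_d_C[OF this, of x1 y] dist_functions_le_d_C[OF this, of x2 y]
  have "0 \<le> d_C C x1 y" "0 \<le> d_C C x2 y" by (auto simp: zero_ereal_def)
  with y obtain a b where ab: "d_C C x1 y = ereal a" "d_C C x2 y = ereal b"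
    by (cases "d_C C x1 y"; cases "d_C C x2 y") auto
  have "d_C C x1 x2 \<le> ereal (a + b)"
    unfolding d_C_def[of C x1 x2]
  proof (rule SUP_least)
    fix \<psi> assume \<psi>: "\<psi> \<in> dist_functions C"
    have "\<bar>\<psi> x1 - \<psi> y\<bar> \<le> a" "\<bar>\<psi> x2 - \<psi> y\<bar> \<le> b"
      using dist_functions_le_d_C[OF \<psi>, of x1 y] dist_functions_le_d_C[OF \<psi>, of x2 y] by (auto simp: ab)
    then show "ereal \<bar>\<psi> x1 - \<psi> x2\<bar> \<le> ereal (a + b)" by simp
  qed
  moreover have "ereal (a + b) < ereal (r1 + r2)" using y ab by simp
  ultimately show False using assms by (meson le_less_trans not_less)
qed

lemma cinner_disjoint_supports:
  assumes "\<phi>1 \<in> L2_on V1" "\<phi>2 \<in> L2_on V2" "negligible (V1 \<inter> V2)"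
  shows "cinner \<phi>1 \<phi>2 = 0"
proof -
  have "AE x in lebesgue. x \<notin> V1 \<inter> V2"
    using assms(3) by (intro AE_not_in) (simp add: negligible_iff_null_sets)
  moreover have "AE x in lebesgue. x \<notin> V1 \<longrightarrow> L2_fun \<phi>1 x = 0" "AE x in lebesgue. x \<notin> V2 \<longrightarrow> L2_fun \<phi>2 x = 0"
    using assms(1,2) by (auto simp: L2_on_def)
  ultimately have "AE x in lebesgue. cnj (L2_fun \<phi>1 x) * L2_fun \<phi>2 x = 0"
    by eventually_elim auto
  then show ?thesis unfolding cinner_L2_fun by (rule integral_eq_zero_AE)
qed

lemma cos_sqrt_op_off_diagonal:
  assumes C: "coefficient_matrix C" and H: "viscosity_operator C H0" and E: "spectral_resolution H0 E"
    and \<psi>: "\<psi> \<in> dist_functions C"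
    and \<phi>1: "\<phi>1 \<in> L2_on V1" "\<And>x. x \<in> V1 \<Longrightarrow> b \<le> \<psi> x"
    and \<phi>2: "\<phi>2 \<in> L2_on V2" "\<And>x. x \<in> V2 \<Longrightarrow> \<psi> x \<le> a"
    and t: "0 < t" "t < b - a"
  shows "cinner \<phi>1 (cos_sqrt_op E t \<phi>2) = 0"
proof -
  interpret pvm E using E by unfold_locales (simp add: spectral_resolution_def)
  have G: "self_adjoint_op H0" "positive_op H0" "H0 = spectral_integral E (\<lambda>s. s)"
    using H E by (auto simp: viscosity_operator_def spectral_resolution_def)
  define N where "N = norm \<phi>1 * norm \<phi>2"
  define g where "g \<tau> = P (\<lambda>s. cos (\<tau> * sqrt s)) \<phi>1 \<phi>2" for \<tau>
  have "g t = 0"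
  proof (rule laplace_decay_imp_zero)
    show "continuous_on UNIV g" unfolding g_def by (rule continuous_P_cos)
    show "cmod (g \<tau>) \<le> 1 * (norm \<phi>2 + norm \<phi>1)\<^sup>2" for \<tau>
      unfolding g_def by (rule norm_P_le[OF bborel_cos]) simp
    show "cmod (LINT \<tau>|lborel. complex_of_real (exp_ind (real n) \<tau>) * g \<tau>)
        \<le> exp (b - a) * N * exp (- (real n * (b - a)))" if n: "n \<ge> 1" for n :: nat
    proof -
      let ?R = "cmod (cinner \<phi>1 (resolvent H0 (complex_of_real (- (real n)\<^sup>2)) \<phi>2))"
      have R: "cinner \<phi>1 (resolvent H0 (complex_of_real (- (real n)\<^sup>2)) \<phi>2)
          = P (\<lambda>s. if 0 \<le> s then 1 / (s + (real n)\<^sup>2) else 0) \<phi>1 \<phi>2"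
        using n by (intro cinner_resolvent[OF G]) simp
      have "(LINT \<tau>|lborel. complex_of_real (exp_ind (real n) \<tau>) * g \<tau>)
          = complex_of_real (real n) * cinner \<phi>1 (resolvent H0 (complex_of_real (- (real n)\<^sup>2)) \<phi>2)"
        unfolding g_def R using n by (intro laplace_P[OF M_nonneg[OF G]]) simp
      then have "cmod (LINT \<tau>|lborel. complex_of_real (exp_ind (real n) \<tau>) * g \<tau>) = real n * ?R"
        by (simp add: norm_mult)
      also have "\<dots> \<le> ((real n)\<^sup>2 - (real n - 1)\<^sup>2) * ?R"
        using n by (intro mult_right_mono) (auto simp: power2_diff)
      also have "\<dots> \<le> exp (- ((real n - 1) * (b - a))) * N"
        unfolding N_def using n by (intro viscosity_resolvent_decay[OF C H \<psi> _ _ \<phi>1 \<phi>2]) auto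
      also have "exp (- ((real n - 1) * (b - a))) = exp (b - a) * exp (- (real n * (b - a)))"
        by (simp add: exp_add[symmetric] algebra_simps)
      finally show ?thesis by (simp add: mult_ac)
    qed
  qed (use t in auto)
  then show ?thesis by (simp add: cinner_cos_sqrt_op g_def)
qed

theorem proposition3p2:
  fixes C :: "real^'n \<Rightarrow> real^'n^'n"
    and x1 x2 :: "real^'n"
    and r1 r2 t :: real
    and H0 :: "(real^'n) operator"
    and E :: "real set \<Rightarrow> (real^'n) L2 \<Rightarrow> (real^'n) L2"
    and \<phi>1 \<phi>2 :: "(real^'n) L2"
  assumes "coefficient_matrix C"
    and "viscosity_operator C H0"
    and "spectral_resolution H0 E"
    and "r1 > 0" and "r2 > 0"
    and "\<phi>1 \<in> L2_on (B_C C x1 r1)"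
    and "\<phi>2 \<in> L2_on (B_C C x2 r2)"
    and "d_C C x1 x2 < ereal (r1 + r2) \<Longrightarrow> negligible (B_C C x1 r1 \<inter> B_C C x2 r2)"
    and "0 \<le> t"
    and "ereal t \<le> d_tilde C x1 r1 x2 r2"
  shows "cinner \<phi>1 (cos_sqrt_op E t \<phi>2) = 0"
proof -
  interpret pvm E using assms(3) by unfold_locales (simp add: spectral_resolution_def)
  define g where "g \<tau> = cinner \<phi>1 (cos_sqrt_op E \<tau> \<phi>2)" for \<tau>
  show ?thesis
  proof (cases "t = 0")
    case True
    have "negligible (B_C C x1 r1 \<inter> B_C C x2 r2)"
      using assms(8) B_C_disjoint[of r1 r2 C x1 x2] by (cases "d_C C x1 x2 < ereal (r1 + r2)") auto
    then have "cinner \<phi>1 \<phi>2 = 0" by (rule cinner_disjoint_supports[OF assms(6,7)])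
    then show ?thesis
      using P_indicator[of UNIV \<phi>1 \<phi>2] True by (simp add: cinner_cos_sqrt_op E_UNIV)
  next
    case False
    then have t: "0 < t" using assms(9) by simp
    then have td: "ereal t \<le> d_C C x1 x2 - ereal r1 - ereal r2"
      using assms(10) unfolding d_tilde_def by (simp add: le_max_iff_disj)
    have zero: "g \<tau> = 0" if \<tau>: "0 < \<tau>" "\<tau> < t" for \<tau>
    proof -
      have "ereal (\<tau> + r1 + r2) < d_C C x1 x2"
        using td \<tau> by (cases "d_C C x1 x2") auto
      then obtain \<psi>0 where \<psi>0: "\<psi>0 \<in> dist_functions C" "\<tau> + r1 + r2 < \<bar>\<psi>0 x1 - \<psi>0 x2\<bar>"
        unfolding d_C_def less_SUP_iff by auto
      obtain \<psi> where \<psi>: "\<psi> \<in> dist_functions C" "\<tau> + r1 + r2 < \<psi> x1 - \<psi> x2"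
      proof (cases "\<psi>0 x2 \<le> \<psi>0 x1")
        case True
        then show ?thesis using that[of \<psi>0] \<psi>0 by simp
      next
        case False
        then show ?thesis using that[OF dist_functions_uminus[OF \<psi>0(1)]] \<psi>0(2) by simp
      qed
      show ?thesis
        unfolding g_def
      proof (rule cos_sqrt_op_off_diagonal[OF assms(1,2,3) \<psi>(1) assms(6) _ assms(7)])
        show "\<psi> x1 - r1 \<le> \<psi> x" if "x \<in> B_C C x1 r1" for x
          using dist_functions_on_ball[OF \<psi>(1) that] by linarith
        show "\<psi> x \<le> \<psi> x2 + r2" if "x \<in> B_C C x2 r2" for x
          using dist_functions_on_ball[OF \<psi>(1) that] by linarith
      qed (use \<tau> \<psi>(2) in auto)
    qed
    have "continuous_on UNIV g"
      unfolding g_def cinner_cos_sqrt_op by (rule continuous_P_cos)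
    then have "(g \<longlongrightarrow> g t) (at_left t)"
      by (simp add: continuous_on_eq_continuous_at isCont_def filterlim_at_split)
    moreover have "\<forall>\<^sub>F \<tau> in at_left t. 0 = g \<tau>"
      using eventually_at_left_real[OF t] by eventually_elim (use zero in auto)
    then have "(g \<longlongrightarrow> 0) (at_left t)"
      by (rule Lim_transform_eventually[OF tendsto_const])
    ultimately have "g t = 0" using tendsto_unique[of "at_left t"] by fastforce
    then show ?thesis by (simp add: g_def)
  qed
qed

end
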